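(* Let $\Gamma$ be a connected tropical curve of genus $g\ge3$ with model $(G=(V,E),\ell)$, with positive integer edge lengths, and let $T=(V,F)$ be a spanning tree of $G$. There is an embedding (injective homomorphism) $$\Phi_\Gamma\colon\overline B(\delta_\Gamma)\to\overline{\mathrm{JH}}_{2,1}(\mathrm{Jac}(\Gamma)),\qquad \alpha_{\varepsilon_1}\wedge\beta_{\varepsilon_2}\wedge\beta_{\varepsilon_3}\mapsto[\mathsf a_{\varepsilon_1},\mathsf b_{\varepsilon_2}\wedge\mathsf b_{\varepsilon_3}]\qquad(\varepsilon_1,\varepsilon_2,\varepsilon_3\in F^c).$$
   Context: **The curve and its Jacobian.** $\Gamma$ is a compact metric graph with model $(G,\ell)$, $G=(V,E)$ a finite connected graph, genus $=$ first Betti number. Edges are oriented, with source $s_e$ and target $t_e$; $F^c=E\setminus F$. $H_{\mathbb Z}=\mathrm H_1(\Gamma,\mathbb Z)$. $\Omega_{\mathbb Z}$ is the group of functions $\omega\colon E\to\mathbb Z$ with $\sum_{s_e=v}\omega(e)=\sum_{t_e=v}\omega(e)$ for all $v$ (integral harmonic 1-forms), $\Omega=\Omega_{\mathbb Z}\otimes\mathbb R$. The map $\gamma\mapsto\mathbf I_\gamma=(\omega\mapsto\int_\gamma\omega)$, with $\int_e\omega=\ell(e)\omega(e)$, embeds $H_{\mathbb Z}$ as a lattice in $\Omega^\vee$; $\mathrm{Jac}(\Gamma)=\Omega^\vee/H_{\mathbb Z}$ with integral affine structure given by $\Omega_{\mathbb Z}^\vee\subset\Omega^\vee$. Its tropical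 homology is $\mathrm H_{p,q}(\mathrm{Jac}(\Gamma),\mathbb R)=\bigwedge^q(H_{\mathbb Z}\otimes\mathbb R)\otimes\bigwedge^p\Omega^\vee$; $[a,b]$ denotes $a\otimes b$. Let $\mathsf b_e\in\Omega_{\mathbb Z}^\vee$ be $\omega\mapsto\omega(e)$, and for $\varepsilon\in F^c$ let $\mathsf a_\varepsilon\in H_{\mathbb Z}$ be the class of the unique cycle in $T\cup\varepsilon$, oriented along $\varepsilon$. The subgroup $\mathrm L_{2,1}\subset\mathrm H_{2,1}(\mathrm{Jac}(\Gamma),\mathbb R)$, the image of $\mathrm H_{1,2}(\mathrm{Jac}(\Gamma),\mathbb Z)$ under the tropical monodromy operator, is generated by $a\otimes(a'\wedge b)-a'\otimes(a\wedge b)$ for $a,a'\in H_{\mathbb Z}$, $b\in\Omega_{\mathbb Z}^\vee$ (with $H_{\mathbb Z}\subset\Omega^\vee$). With $\omega=\sum_{\varepsilon\in F^c}\mathsf a_\varepsilon\otimes\mathsf b_\varepsilon$ and $\omega\wedge v=\sum_\varepsilon\mathsf a_\varepsilon\otimes(\mathsf b_\varepsilon\wedge v)$, $$\overline{\mathrm{JH}}_{2,1}(\mathrm{Jac}(\Gamma))=\frac{\mathrm H_{2,1}(\mathrm{Jac}(\Gamma),\mathbb R)}{\omega\wedge\Omega^\vee+\mathrm L_{2,1}}.$$ **The topological side.** $\Sigma_g$ is the closed oriented surface of genus $g$, $H=\mathrm H_1(\Sigma_g,\mathbb Z)$ with algebraic intersection pairing $\langle\cdot,\cdot\rangle$ and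 symplectic form $\omega_{\mathrm{top}}\in\bigwedge^2H$; $H\subset\bigwedge^3H$ via $h\mapsto\omega_{\mathrm{top}}\wedge h$. Fix pairwise disjoint, pairwise non-isotopic simple closed curves $\gamma_e$ ($e\in E$) on $\Sigma_g$ such that all components of $\Sigma_g\setminus\bigcup_e\gamma_e$ have genus $0$ and whose dual graph (a vertex for each component, an edge for each curve joining the components on its two sides) is $G$. Orient the curves consistently with the orientation of $G$, let $\beta_e=[\gamma_e]\in H$ and $Y=\mathrm{span}\{\beta_e\}$, a Lagrangian subgroup with basis $\{\beta_\varepsilon\}_{\varepsilon\in F^c}$; extend it to a symplectic basis $\{\alpha_\varepsilon,\beta_\varepsilon\}_{\varepsilon\in F^c}$ of $H$, $\langle\alpha_\varepsilon,\beta_{\varepsilon'}\rangle=\delta_{\varepsilon\varepsilon'}$. Let $\mathrm T_\Gamma=\prod_e\mathrm T_{\gamma_e}^{\ell(e)}$ be the multitwist, where $\mathrm T_\gamma$ is the left-handed Dehn twist, acting on homology by $\zeta\mapsto\zeta+\langle\zeta,[\gamma]\rangle[\gamma]$, and let $\delta_\Gamma$ be its action on $H$, and the induced action on $(\bigwedge^3H)/H$. So $(\delta_\Gamma-I)(\alpha_\varepsilon)=\sum_{\varepsilon'}Q_{\varepsilon\varepsilon'}\beta_{\varepsilon'}$ with $Q_{\varepsilon\varepsilon'}=\sum_e\ell(e)\,\omega_\varepsilon(e)\,\omega_{\varepsilon'}(e)$, $\omega_\varepsilon(e)$ the coefficient of $e$ in $\mathsf a_\varepsilon$, and $(\delta_\Gamma-I)(\beta_\varepsilon)=0$.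 Let $W_{-6}$, $W_{-4}$, $W_{-2}$ be the images in $(\bigwedge^3H)/H$ of $\bigwedge^3Y$, $H\wedge Y\wedge Y$, $H\wedge H\wedge Y$. Then $$\overline B(\delta_\Gamma)=W_{-4}\big/\big((\delta_\Gamma-I)W_{-2}+W_{-6}\big).$$ *)

theory Defs
  imports "HOL-Homology.Homology" "HOL-Analysis.Analysis" "Graph_Theory.Digraph_Component"
begin

section \<open>Tensor products and exterior powers\<close>

text \<open>
  The additive map \<open>f\<close> of \<open>G\<close>, which is assumed to preserve the subgroup \<open>N\<close>, acts on the
  cosets of \<open>N\<close>: for a coset \<open>N + c\<close> the set \<open>N + f (N + c)\<close> is the coset of \<open>f c\<close>.
\<close>

definition quot_map :: "('a, 'm) monoid_scheme \<Rightarrow> 'a set \<Rightarrow> ('a \<Rightarrow> 'a) \<Rightarrow> 'a set \<Rightarrow> 'a set" where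
  "quot_map G N f C = N <#>\<^bsub>G\<^esub> (f ` C)"

text \<open>
  A module is given by its underlying abelian group \<open>A\<close> (written multiplicatively, as always in
  HOL-Algebra) and its scalar multiplication \<open>sc\<close>. Both constructions below are the usual
  quotients of a free abelian group. The scalars are always the integers or the reals; in these
  cases the alternation relation for two equal arguments implies the one for two proportional
  arguments.
\<close>

definition wedge_lists :: "nat \<Rightarrow> 'a monoid \<Rightarrow> 'a list set" where
  "wedge_lists k A = {xs. length xs = k \<and> set xs \<subseteq> carrier A}"

definition wedge_rels :: "('r \<Rightarrow> 'a \<Rightarrow> 'a) \<Rightarrow> nat \<Rightarrow> 'a monoid \<Rightarrow> ('a list \<Rightarrow>\<^sub>0 int) set" where
  "wedge_rels sc k A =
     {frag_of (xs[i := x \<otimes>\<^bsub>A\<^esub> y]) - frag_of (xs[i := x]) - frag_of (xs[i := y]) | xs i x y.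
        xs \<in> wedge_lists k A \<and> i < k \<and> x \<in> carrier A \<and> y \<in> carrier A}
   \<union> {frag_of (xs[i := sc r (xs ! i)]) - frag_of (xs[j := sc r (xs ! j)]) | xs i j r.
        xs \<in> wedge_lists k A \<and> i < k \<and> j < k}
   \<union> {frag_of xs | xs i j. xs \<in> wedge_lists k A \<and> i < j \<and> j < k \<and> xs ! i = xs ! j}"

definition wedge_kernel :: "('r \<Rightarrow> 'a \<Rightarrow> 'a) \<Rightarrow> nat \<Rightarrow> 'a monoid \<Rightarrow> ('a list \<Rightarrow>\<^sub>0 int) set" where
  "wedge_kernel sc k A = generate (free_Abelian_group (wedge_lists k A)) (wedge_rels sc k A)"

definition exterior_power ::
    "('r \<Rightarrow> 'a \<Rightarrow> 'a) \<Rightarrow> nat \<Rightarrow> 'a monoid \<Rightarrow> ('a list \<Rightarrow>\<^sub>0 int) set monoid" where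
  "exterior_power sc k A = free_Abelian_group (wedge_lists k A) Mod wedge_kernel sc k A"

definition wedge :: "('r \<Rightarrow> 'a \<Rightarrow> 'a) \<Rightarrow> 'a monoid \<Rightarrow> 'a list \<Rightarrow> ('a list \<Rightarrow>\<^sub>0 int) set" where
  "wedge sc A xs =
     wedge_kernel sc (length xs) A #>\<^bsub>free_Abelian_group (wedge_lists (length xs) A)\<^esub> frag_of xs"

definition exterior_map ::
    "('r \<Rightarrow> 'a \<Rightarrow> 'a) \<Rightarrow> nat \<Rightarrow> 'a monoid \<Rightarrow> ('a \<Rightarrow> 'a) \<Rightarrow> ('a list \<Rightarrow>\<^sub>0 int) set \<Rightarrow> ('a list \<Rightarrow>\<^sub>0 int) set"
  where "exterior_map sc k A f =
     quot_map (free_Abelian_group (wedge_lists k A)) (wedge_kernel sc k A)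
       (frag_extend (\<lambda>xs. frag_of (map f xs)))"

text \<open>Scalar multiplication on an exterior power of positive degree.\<close>

definition exterior_scale ::
    "('r \<Rightarrow> 'a \<Rightarrow> 'a) \<Rightarrow> nat \<Rightarrow> 'a monoid \<Rightarrow> 'r \<Rightarrow> ('a list \<Rightarrow>\<^sub>0 int) set \<Rightarrow> ('a list \<Rightarrow>\<^sub>0 int) set"
  where "exterior_scale sc k A r =
     quot_map (free_Abelian_group (wedge_lists k A)) (wedge_kernel sc k A)
       (frag_extend (\<lambda>xs. frag_of (xs[0 := sc r (xs ! 0)])))"

definition tensor_rels ::
    "('r \<Rightarrow> 'a \<Rightarrow> 'a) \<Rightarrow> ('r \<Rightarrow> 'b \<Rightarrow> 'b) \<Rightarrow> 'a monoid \<Rightarrow> 'b monoid \<Rightarrow> ('a \<times> 'b \<Rightarrow>\<^sub>0 int) set" where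
  "tensor_rels sc sc' A B =
     {frag_of (x \<otimes>\<^bsub>A\<^esub> x', y) - frag_of (x, y) - frag_of (x', y) | x x' y.
        x \<in> carrier A \<and> x' \<in> carrier A \<and> y \<in> carrier B}
   \<union> {frag_of (x, y \<otimes>\<^bsub>B\<^esub> y') - frag_of (x, y) - frag_of (x, y') | x y y'.
        x \<in> carrier A \<and> y \<in> carrier B \<and> y' \<in> carrier B}
   \<union> {frag_of (sc r x, y) - frag_of (x, sc' r y) | r x y. x \<in> carrier A \<and> y \<in> carrier B}"

definition tensor_kernel ::
    "('r \<Rightarrow> 'a \<Rightarrow> 'a) \<Rightarrow> ('r \<Rightarrow> 'b \<Rightarrow> 'b) \<Rightarrow> 'a monoid \<Rightarrow> 'b monoid \<Rightarrow> ('a \<times> 'b \<Rightarrow>\<^sub>0 int) set" where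
  "tensor_kernel sc sc' A B =
     generate (free_Abelian_group (carrier A \<times> carrier B)) (tensor_rels sc sc' A B)"

definition tensor_product ::
    "('r \<Rightarrow> 'a \<Rightarrow> 'a) \<Rightarrow> ('r \<Rightarrow> 'b \<Rightarrow> 'b) \<Rightarrow> 'a monoid \<Rightarrow> 'b monoid \<Rightarrow> ('a \<times> 'b \<Rightarrow>\<^sub>0 int) set monoid"
  where "tensor_product sc sc' A B =
     free_Abelian_group (carrier A \<times> carrier B) Mod tensor_kernel sc sc' A B"

definition pure_tensor ::
    "('r \<Rightarrow> 'a \<Rightarrow> 'a) \<Rightarrow> ('r \<Rightarrow> 'b \<Rightarrow> 'b) \<Rightarrow> 'a monoid \<Rightarrow> 'b monoid \<Rightarrow> 'a \<Rightarrow> 'b \<Rightarrow> ('a \<times> 'b \<Rightarrow>\<^sub>0 int) set"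
  where "pure_tensor sc sc' A B x y =
     tensor_kernel sc sc' A B #>\<^bsub>free_Abelian_group (carrier A \<times> carrier B)\<^esub> frag_of (x, y)"


section \<open>The tropical curve and its Jacobian\<close>

text \<open>
  The oriented graph is a digraph whose loops and parallel arcs are allowed; source and target of
  an arc are its tail and head. The acyclicity in the library's notion of a spanning tree only
  excludes directed cycles, so the notion for the underlying undirected graph is defined here.
  (\<open>Digraph_Component.connected\<close> does refer to the underlying undirected graph.)
\<close>

definition undirected_cycle :: "('v, 'e) pre_digraph \<Rightarrow> 'v list \<Rightarrow> 'e list \<Rightarrow> bool" where
  "undirected_cycle G vs p \<longleftrightarrow>
     p \<noteq> [] \<and> length vs = length p \<and> distinct vs \<and> distinct p \<and> set p \<subseteq> arcs G \<and>
     (\<forall>i<length p. {tail G (p ! i), head G (p ! i)} = {vs ! i, vs ! (Suc i mod length p)})"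

definition undirected_spanning_tree :: "('v, 'e) pre_digraph \<Rightarrow> ('v, 'e) pre_digraph \<Rightarrow> bool" where
  "undirected_spanning_tree T G \<longleftrightarrow>
     spanning T G \<and> Digraph_Component.connected T \<and> (\<nexists>vs p. undirected_cycle T vs p)"

text \<open>
  The same Kirchhoff condition describes the cellular 1-cycles, that is, the first homology of
  the metric graph with the respective coefficients, and the harmonic 1-forms. Real flows are
  the scalar extension of integral flows.
\<close>

definition flows :: "('v, 'e) pre_digraph \<Rightarrow> ('e \<Rightarrow> 'r::comm_ring_1) set" where
  "flows G = {c. (\<forall>e. e \<notin> arcs G \<longrightarrow> c e = 0) \<and>
     (\<forall>v\<in>verts G. (\<Sum>e | e \<in> arcs G \<and> tail G e = v. c e) = (\<Sum>e | e \<in> arcs G \<and> head G e = v. c e))}"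

definition cycle_group :: "('v, 'e) pre_digraph \<Rightarrow> ('e \<Rightarrow> 'r::comm_ring_1) monoid" where
  "cycle_group G = \<lparr>carrier = flows G, monoid.mult = (\<lambda>c d e. c e + d e), one = (\<lambda>e. 0)\<rparr>"

definition cycle_scale :: "real \<Rightarrow> ('e \<Rightarrow> real) \<Rightarrow> 'e \<Rightarrow> real" where
  "cycle_scale r c = (\<lambda>e. r * c e)"

abbreviation real_cycle :: "('e \<Rightarrow> int) \<Rightarrow> 'e \<Rightarrow> real" where
  "real_cycle c \<equiv> (\<lambda>e. real_of_int (c e))"

definition forms_dual :: "('v, 'e) pre_digraph \<Rightarrow> (('e \<Rightarrow> real) \<Rightarrow> real) monoid" where
  "forms_dual G = \<lparr>carrier = {\<phi> \<in> extensional (flows G).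
       (\<forall>\<omega>\<in>flows G. \<forall>\<eta>\<in>flows G. \<phi> (\<lambda>e. \<omega> e + \<eta> e) = \<phi> \<omega> + \<phi> \<eta>) \<and>
       (\<forall>r. \<forall>\<omega>\<in>flows G. \<phi> (\<lambda>e. r * \<omega> e) = r * \<phi> \<omega>)},
     monoid.mult = (\<lambda>\<phi> \<psi>. \<lambda>\<omega>\<in>flows G. \<phi> \<omega> + \<psi> \<omega>), one = (\<lambda>\<omega>\<in>flows G. 0)\<rparr>"

definition forms_dual_scale ::
    "('v, 'e) pre_digraph \<Rightarrow> real \<Rightarrow> (('e \<Rightarrow> real) \<Rightarrow> real) \<Rightarrow> ('e \<Rightarrow> real) \<Rightarrow> real" where
  "forms_dual_scale G r \<phi> = (\<lambda>\<omega>\<in>flows G. r * \<phi> \<omega>)"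

definition integral_forms_dual :: "('v, 'e) pre_digraph \<Rightarrow> (('e \<Rightarrow> real) \<Rightarrow> real) set" where
  "integral_forms_dual G = {\<phi> \<in> carrier (forms_dual G). \<forall>\<omega>\<in>flows G. \<phi> (real_cycle \<omega>) \<in> \<int>}"

definition integration ::
    "('v, 'e) pre_digraph \<Rightarrow> ('e \<Rightarrow> nat) \<Rightarrow> ('e \<Rightarrow> int) \<Rightarrow> ('e \<Rightarrow> real) \<Rightarrow> real" where
  "integration G \<l> c = (\<lambda>\<omega>\<in>flows G. \<Sum>e\<in>arcs G. real (\<l> e) * real_of_int (c e) * \<omega> e)"

definition edge_form :: "('v, 'e) pre_digraph \<Rightarrow> 'e \<Rightarrow> ('e \<Rightarrow> real) \<Rightarrow> real" where
  "edge_form G e = (\<lambda>\<omega>\<in>flows G. \<omega> e)"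

definition fundamental_cycle ::
    "('v, 'e) pre_digraph \<Rightarrow> ('v, 'e) pre_digraph \<Rightarrow> 'e \<Rightarrow> 'e \<Rightarrow> int" where
  "fundamental_cycle G T \<epsilon> =
     (THE c. c \<in> flows G \<and> c \<epsilon> = 1 \<and> (\<forall>e. e \<notin> insert \<epsilon> (arcs T) \<longrightarrow> c e = 0))"

definition dual_wedge2 ::
    "('v, 'e) pre_digraph \<Rightarrow> ((('e \<Rightarrow> real) \<Rightarrow> real) list \<Rightarrow>\<^sub>0 int) set monoid" where
  "dual_wedge2 G = exterior_power (forms_dual_scale G) 2 (forms_dual G)"

text \<open>The homology of degree (2,1) of the Jacobian; the first exterior power is omitted.\<close>

definition jac_homology21 ::
    "('v, 'e) pre_digraph \<Rightarrow>
      (('e \<Rightarrow> real) \<times> ((('e \<Rightarrow> real) \<Rightarrow> real) list \<Rightarrow>\<^sub>0 int) set \<Rightarrow>\<^sub>0 int) set monoid" where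
  "jac_homology21 G =
     tensor_product cycle_scale (exterior_scale (forms_dual_scale G) 2 (forms_dual G))
       (cycle_group G) (dual_wedge2 G)"

text \<open>\<open>bracket G c v w\<close> is the class of \<open>c \<otimes> (v \<and> w)\<close>.\<close>

definition bracket ::
    "('v, 'e) pre_digraph \<Rightarrow> ('e \<Rightarrow> int) \<Rightarrow> (('e \<Rightarrow> real) \<Rightarrow> real) \<Rightarrow> (('e \<Rightarrow> real) \<Rightarrow> real) \<Rightarrow>
      (('e \<Rightarrow> real) \<times> ((('e \<Rightarrow> real) \<Rightarrow> real) list \<Rightarrow>\<^sub>0 int) set \<Rightarrow>\<^sub>0 int) set" where
  "bracket G c v w =
     pure_tensor cycle_scale (exterior_scale (forms_dual_scale G) 2 (forms_dual G))
       (cycle_group G) (dual_wedge2 G)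
       (real_cycle c) (wedge (forms_dual_scale G) (forms_dual G) [v, w])"

definition monodromy_lattice ::
    "('v, 'e) pre_digraph \<Rightarrow> ('e \<Rightarrow> nat) \<Rightarrow>
      (('e \<Rightarrow> real) \<times> ((('e \<Rightarrow> real) \<Rightarrow> real) list \<Rightarrow>\<^sub>0 int) set \<Rightarrow>\<^sub>0 int) set set" where
  "monodromy_lattice G \<l> = generate (jac_homology21 G)
     {bracket G a (integration G \<l> a') b \<otimes>\<^bsub>jac_homology21 G\<^esub>
        inv\<^bsub>jac_homology21 G\<^esub> bracket G a' (integration G \<l> a) b | a a' b.
      a \<in> flows G \<and> a' \<in> flows G \<and> b \<in> integral_forms_dual G}"

definition omega_wedge_dual ::
    "('v, 'e) pre_digraph \<Rightarrow> ('v, 'e) pre_digraph \<Rightarrow>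
      (('e \<Rightarrow> real) \<times> ((('e \<Rightarrow> real) \<Rightarrow> real) list \<Rightarrow>\<^sub>0 int) set \<Rightarrow>\<^sub>0 int) set set" where
  "omega_wedge_dual G T =
     {finprod (jac_homology21 G)
        (\<lambda>\<epsilon>. bracket G (fundamental_cycle G T \<epsilon>) (edge_form G \<epsilon>) v) (arcs G - arcs T) | v.
      v \<in> carrier (forms_dual G)}"

definition jh21_kernel ::
    "('v, 'e) pre_digraph \<Rightarrow> ('e \<Rightarrow> nat) \<Rightarrow> ('v, 'e) pre_digraph \<Rightarrow>
      (('e \<Rightarrow> real) \<times> ((('e \<Rightarrow> real) \<Rightarrow> real) list \<Rightarrow>\<^sub>0 int) set \<Rightarrow>\<^sub>0 int) set set" where
  "jh21_kernel G \<l> T = omega_wedge_dual G T <#>\<^bsub>jac_homology21 G\<^esub> monodromy_lattice G \<l>"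

definition jh21 ::
    "('v, 'e) pre_digraph \<Rightarrow> ('e \<Rightarrow> nat) \<Rightarrow> ('v, 'e) pre_digraph \<Rightarrow>
      (('e \<Rightarrow> real) \<times> ((('e \<Rightarrow> real) \<Rightarrow> real) list \<Rightarrow>\<^sub>0 int) set \<Rightarrow>\<^sub>0 int) set set monoid" where
  "jh21 G \<l> T = jac_homology21 G Mod jh21_kernel G \<l> T"


section \<open>Curves on a closed oriented surface\<close>

abbreviation circle :: "complex set" where
  "circle \<equiv> sphere 0 1"

text \<open>
  The orientation is a fundamental class \<open>\<mu>\<close>, a generator of the infinite cyclic second homology;
  the genus is half of the rank of the first homology.
\<close>

definition closed_oriented_surface :: "'p topology \<Rightarrow> 'p chain set \<Rightarrow> nat \<Rightarrow> bool" where
  "closed_oriented_surface S \<mu> g \<longleftrightarrow>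
     compact_space S \<and> Hausdorff_space S \<and> connected_space S \<and>
     (\<forall>x\<in>topspace S. \<exists>U. openin S U \<and> x \<in> U \<and>
        subtopology S U homeomorphic_space (euclidean :: complex topology)) \<and>
     \<mu> \<in> carrier (homology_group 2 S) \<and>
     bij_betw (\<lambda>n::int. \<mu> [^]\<^bsub>homology_group 2 S\<^esub> n) UNIV (carrier (homology_group 2 S)) \<and>
     homology_group 1 S \<cong> free_Abelian_group {..<2 * g}"

definition simple_closed_curve :: "'p topology \<Rightarrow> (complex \<Rightarrow> 'p) \<Rightarrow> bool" where
  "simple_closed_curve S \<gamma> \<longleftrightarrow> embedding_map (top_of_set circle) S \<gamma>"

definition loop_class :: "'p topology \<Rightarrow> (complex \<Rightarrow> 'p) \<Rightarrow> 'p chain set" where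
  "loop_class S \<gamma> =
     homologous_rel_set 1 S {} (frag_of (\<lambda>x\<in>standard_simplex 1. \<gamma> (cis (2 * pi * x 1))))"

text \<open>Isotopy of unoriented curves.\<close>

definition isotopic_curves :: "'p topology \<Rightarrow> (complex \<Rightarrow> 'p) \<Rightarrow> (complex \<Rightarrow> 'p) \<Rightarrow> bool" where
  "isotopic_curves S \<gamma> \<gamma>' \<longleftrightarrow>
     (\<exists>F. continuous_map (prod_topology (top_of_set {0..1::real}) (top_of_set circle)) S
            (\<lambda>(t, z). F t z) \<and>
          (\<forall>t\<in>{0..1}. simple_closed_curve S (F t)) \<and>
          F 0 ` circle = \<gamma> ` circle \<and> F 1 ` circle = \<gamma>' ` circle)"

text \<open>
  An orientation preserving open embedding \<open>\<kappa>\<close> of an annulus in the complex plane, regarded as a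
  bicollar of the curve which is the image of the unit circle. It preserves the orientation if
  at \<open>\<kappa> 1\<close> the fundamental class restricts to the image of a counterclockwise triangle around \<open>1\<close>.
\<close>

definition oriented_annulus :: "'p topology \<Rightarrow> 'p chain set \<Rightarrow> (complex \<Rightarrow> 'p) \<Rightarrow> bool" where
  "oriented_annulus S \<mu> \<kappa> \<longleftrightarrow>
     embedding_map (top_of_set {z. 1/2 < cmod z \<and> cmod z < 2}) S \<kappa> \<and>
     openin S (\<kappa> ` {z. 1/2 < cmod z \<and> cmod z < 2}) \<and>
     hom_induced 2 S {} S (topspace S - {\<kappa> 1}) id \<mu> =
       homologous_rel_set 2 S (topspace S - {\<kappa> 1})
         (frag_of (\<lambda>x\<in>standard_simplex 2. \<kappa> (1 + (\<Sum>k\<le>2. x k *\<^sub>R cis (2 * pi * real k / 3)) / 4)))"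

text \<open>
  For \<open>\<gamma>\<close> the image of the unit circle, the group \<open>H\<^sub>1(S, S - \<gamma>)\<close> is infinite cyclic, generated by
  the class of a radial arc that crosses \<open>\<gamma>\<close> once, from the inner to the outer side. This arc
  followed by the direction of \<open>\<gamma>\<close> is a positive frame, so the image of a class \<open>x\<close> in this
  group is the multiple of the arc by the intersection number of \<open>x\<close> with \<open>\<gamma>\<close>. As the simple
  closed curves generate the homology, this determines the intersection pairing.
\<close>

definition crossing_class :: "'p topology \<Rightarrow> (complex \<Rightarrow> 'p) \<Rightarrow> 'p chain set" where
  "crossing_class S \<kappa> =
     homologous_rel_set 1 S (topspace S - \<kappa> ` circle)
       (frag_of (\<lambda>x\<in>standard_simplex 1. \<kappa> (of_real (3/4 * x 0 + 5/4 * x 1))))"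

definition intersection_pairing ::
    "'p topology \<Rightarrow> 'p chain set \<Rightarrow> ('p chain set \<Rightarrow> 'p chain set \<Rightarrow> int) \<Rightarrow> bool" where
  "intersection_pairing S \<mu> I \<longleftrightarrow>
     (\<forall>x\<in>carrier (homology_group 1 S). \<forall>y\<in>carrier (homology_group 1 S).
        \<forall>z\<in>carrier (homology_group 1 S).
          I (x \<otimes>\<^bsub>homology_group 1 S\<^esub> y) z = I x z + I y z \<and>
          I z (x \<otimes>\<^bsub>homology_group 1 S\<^esub> y) = I z x + I z y) \<and>
     (\<forall>x\<in>carrier (homology_group 1 S). I x x = 0) \<and>
     (\<forall>\<kappa>. oriented_annulus S \<mu> \<kappa> \<longrightarrow> (\<forall>x\<in>carrier (homology_group 1 S).
        hom_induced 1 S {} S (topspace S - \<kappa> ` circle) id x =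
        crossing_class S \<kappa> [^]\<^bsub>relative_homology_group 1 S (topspace S - \<kappa> ` circle)\<^esub>
          I x (loop_class S \<kappa>)))"

text \<open>
  The components of the complement have genus 0, that is, they are spheres with finitely many
  punctures, and correspond to the vertices. The curve \<open>\<gamma> e\<close> has the component of the source of
  \<open>e\<close> on its inner side and that of the target on its outer side (with respect to a bicollar), so
  crossing it from source to target is positive for the intersection pairing.
\<close>

definition curve_system ::
    "'p topology \<Rightarrow> 'p chain set \<Rightarrow> ('v, 'e) pre_digraph \<Rightarrow> ('e \<Rightarrow> complex \<Rightarrow> 'p) \<Rightarrow> bool" where
  "curve_system S \<mu> G \<gamma> \<longleftrightarrow>
     (\<forall>e\<in>arcs G. simple_closed_curve S (\<gamma> e)) \<and>
     (\<forall>e\<in>arcs G. \<forall>e'\<in>arcs G. e \<noteq> e' \<longrightarrow>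
        \<gamma> e ` circle \<inter> \<gamma> e' ` circle = {} \<and> \<not> isotopic_curves S (\<gamma> e) (\<gamma> e')) \<and>
     (\<exists>C. bij_betw C (verts G)
            (connected_components_of (subtopology S (topspace S - (\<Union>e\<in>arcs G. \<gamma> e ` circle)))) \<and>
          (\<forall>v\<in>verts G. \<exists>P. finite P \<and>
             subtopology S (C v) homeomorphic_space top_of_set (sphere (0 :: real^3) 1 - P)) \<and>
          (\<forall>e\<in>arcs G. \<exists>\<kappa>. oriented_annulus S \<mu> \<kappa> \<and> (\<forall>z\<in>circle. \<kappa> z = \<gamma> e z) \<and>
             \<kappa> ` {z. 1/2 < cmod z \<and> cmod z < 1} \<subseteq> C (tail G e) \<and>
             \<kappa> ` {z. 1 < cmod z \<and> cmod z < 2} \<subseteq> C (head G e)))"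


section \<open>Multitwists and their action on the third exterior power\<close>

definition abelian_basis :: "'a monoid \<Rightarrow> 'i set \<Rightarrow> ('i \<Rightarrow> 'a) \<Rightarrow> bool" where
  "abelian_basis A J b \<longleftrightarrow> b \<in> J \<rightarrow> carrier A \<and>
     bij_betw (\<lambda>n. finprod A (\<lambda>j. b j [^]\<^bsub>A\<^esub> (n j :: int)) J) (J \<rightarrow>\<^sub>E UNIV) (carrier A)"

definition symplectic_basis ::
    "'a monoid \<Rightarrow> ('a \<Rightarrow> 'a \<Rightarrow> int) \<Rightarrow> 'e set \<Rightarrow> ('e \<Rightarrow> 'a) \<Rightarrow> ('e \<Rightarrow> 'a) \<Rightarrow> bool" where
  "symplectic_basis H I J \<alpha> \<beta> \<longleftrightarrow>
     abelian_basis H (J <+> J) (case_sum \<alpha> \<beta>) \<and>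
     (\<forall>i\<in>J. \<forall>j\<in>J. I (\<alpha> i) (\<beta> j) = (if i = j then 1 else 0) \<and>
        I (\<alpha> i) (\<alpha> j) = 0 \<and> I (\<beta> i) (\<beta> j) = 0)"

text \<open>
  The action of a left-handed Dehn twist on homology, and of a multitwist along disjoint curves,
  composed in the order given by a list.
\<close>

definition twist_action :: "'a monoid \<Rightarrow> ('a \<Rightarrow> 'a \<Rightarrow> int) \<Rightarrow> 'a \<Rightarrow> 'a \<Rightarrow> 'a" where
  "twist_action H I b x = x \<otimes>\<^bsub>H\<^esub> (b [^]\<^bsub>H\<^esub> I x b)"

definition multitwist_action ::
    "'a monoid \<Rightarrow> ('a \<Rightarrow> 'a \<Rightarrow> int) \<Rightarrow> ('e \<Rightarrow> 'a) \<Rightarrow> ('e \<Rightarrow> nat) \<Rightarrow> 'e list \<Rightarrow> 'a \<Rightarrow> 'a" where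
  "multitwist_action H I \<beta> \<l> es = foldr (\<lambda>e f. (twist_action H I (\<beta> e) ^^ \<l> e) \<circ> f) es id"

abbreviation int_scale :: "'a monoid \<Rightarrow> int \<Rightarrow> 'a \<Rightarrow> 'a" where
  "int_scale A \<equiv> (\<lambda>n x. x [^]\<^bsub>A\<^esub> n)"

definition ext3 :: "'a monoid \<Rightarrow> ('a list \<Rightarrow>\<^sub>0 int) set monoid" where
  "ext3 H = exterior_power (int_scale H) 3 H"

definition wedge3 :: "'a monoid \<Rightarrow> 'a \<Rightarrow> 'a \<Rightarrow> 'a \<Rightarrow> ('a list \<Rightarrow>\<^sub>0 int) set" where
  "wedge3 H x y z = wedge (int_scale H) H [x, y, z]"

text \<open>
  The image of \<open>H\<close> in its third exterior power under the product with the symplectic form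
  \<open>\<Sum>j. \<alpha> j \<and> \<beta> j\<close>, for a symplectic basis \<open>\<alpha>, \<beta>\<close>.
\<close>

definition omega_wedge ::
    "'a monoid \<Rightarrow> 'e set \<Rightarrow> ('e \<Rightarrow> 'a) \<Rightarrow> ('e \<Rightarrow> 'a) \<Rightarrow> ('a list \<Rightarrow>\<^sub>0 int) set set" where
  "omega_wedge H J \<alpha> \<beta> = {finprod (ext3 H) (\<lambda>j. wedge3 H (\<alpha> j) (\<beta> j) h) J | h. h \<in> carrier H}"

text \<open>Below, \<open>U\<close> stands for the subgroup \<open>omega_wedge H J \<alpha> \<beta>\<close>.\<close>

definition ext3_quot ::
    "'a monoid \<Rightarrow> ('a list \<Rightarrow>\<^sub>0 int) set set \<Rightarrow> ('a list \<Rightarrow>\<^sub>0 int) set set monoid" where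
  "ext3_quot H U = ext3 H Mod U"

definition wedge3_quot ::
    "'a monoid \<Rightarrow> ('a list \<Rightarrow>\<^sub>0 int) set set \<Rightarrow> 'a \<Rightarrow> 'a \<Rightarrow> 'a \<Rightarrow> ('a list \<Rightarrow>\<^sub>0 int) set set" where
  "wedge3_quot H U x y z = U #>\<^bsub>ext3 H\<^esub> wedge3 H x y z"

definition wedge3_span ::
    "'a monoid \<Rightarrow> ('a list \<Rightarrow>\<^sub>0 int) set set \<Rightarrow> 'a set \<Rightarrow> 'a set \<Rightarrow> 'a set \<Rightarrow>
      ('a list \<Rightarrow>\<^sub>0 int) set set set" where
  "wedge3_span H U X Y Z =
     (\<lambda>c. U #>\<^bsub>ext3 H\<^esub> c) ` generate (ext3 H) {wedge3 H x y z | x y z. x \<in> X \<and> y \<in> Y \<and> z \<in> Z}"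

definition ext3_quot_map ::
    "'a monoid \<Rightarrow> ('a list \<Rightarrow>\<^sub>0 int) set set \<Rightarrow> ('a \<Rightarrow> 'a) \<Rightarrow>
      ('a list \<Rightarrow>\<^sub>0 int) set set \<Rightarrow> ('a list \<Rightarrow>\<^sub>0 int) set set" where
  "ext3_quot_map H U f = quot_map (ext3 H) U (exterior_map (int_scale H) 3 H f)"

definition B_kernel ::
    "'a monoid \<Rightarrow> ('a list \<Rightarrow>\<^sub>0 int) set set \<Rightarrow> 'a set \<Rightarrow> ('a \<Rightarrow> 'a) \<Rightarrow>
      ('a list \<Rightarrow>\<^sub>0 int) set set set" where
  "B_kernel H U Y \<delta> =
     {ext3_quot_map H U \<delta> x \<otimes>\<^bsub>ext3_quot H U\<^esub> inv\<^bsub>ext3_quot H U\<^esub> x | x.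
        x \<in> wedge3_span H U (carrier H) (carrier H) Y}
     <#>\<^bsub>ext3_quot H U\<^esub> wedge3_span H U Y Y Y"

definition B_quot ::
    "'a monoid \<Rightarrow> ('a list \<Rightarrow>\<^sub>0 int) set set \<Rightarrow> 'a set \<Rightarrow> ('a \<Rightarrow> 'a) \<Rightarrow>
      ('a list \<Rightarrow>\<^sub>0 int) set set set monoid" where
  "B_quot H U Y \<delta> =
     (ext3_quot H U)\<lparr>carrier := wedge3_span H U (carrier H) Y Y\<rparr> Mod B_kernel H U Y \<delta>"

end

theory Submission
  imports Defs
begin

text \<open>
  The proof compares both sides through two projections of the homology \<open>H\<close> of the surface. Counting
  intersections with the curves maps \<open>x\<close> to the function \<open>e \<mapsto> \<langle>x, \<beta>\<^sub>e\<rangle>\<close> on the edges. By Kirchhoff's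
  law (\<open>intersection_numbers_flow\<close>) this is an integral flow, that is, a cycle of the graph; a flow is
  determined by its values off the tree (\<open>flow_on_forest_eq_0\<close>), so \<open>\<alpha>\<^sub>\<epsilon>\<close> goes to the
  fundamental cycle of \<open>\<epsilon>\<close> and all of \<open>Y\<close> goes to zero. The second projection maps \<open>\<beta>\<^sub>\<epsilon>\<close> to the
  edge functional \<open>b\<^sub>\<epsilon>\<close> and \<open>\<alpha>\<^sub>\<epsilon>\<close> to zero; the flow property of the \<open>\<alpha>\<^sub>\<epsilon>\<close> makes it map \<open>\<beta>\<^sub>e\<close> to
  \<open>b\<^sub>e\<close> for every edge.

  Applying the first projection to one factor and the second to the other two is alternating, and
  defines a homomorphism \<open>\<Psi>\<close> from the third exterior power of \<open>H\<close> to the tropical homology. It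
  sends \<open>\<omega> \<and> h\<close> to \<open>\<omega> \<and> v\<close>, where \<open>v\<close> is the second projection of \<open>h\<close> (\<open>Psi_omega\<close>), and kills
  \<open>Y \<and> Y \<and> Y\<close>. The multitwist adds to \<open>x\<close> an element of \<open>Y\<close> whose second projection is the integration
  along the first projection of \<open>x\<close> (\<open>form_shear\<close>). Therefore \<open>\<Psi>\<close> maps \<open>(\<delta> - 1)(x \<and> y \<and> z)\<close>, for \<open>z\<close>
  in \<open>Y\<close>, to a generator of the monodromy lattice, and all generators arise in this way
  (\<open>Psi_variation_w3\<close>, \<open>lattice_lift\<close>). So \<open>\<Psi>\<close> descends to the quotients.

  For the injectivity, an element of \<open>H \<and> Y \<and> Y\<close> that \<open>\<Psi>\<close> maps into the kernel on the tropical side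
  can be corrected by some \<open>(\<delta> - 1) u\<close> so that its image is \<open>\<omega> \<and> v\<close> with a real vector \<open>v\<close>. As
  the element is integral, the coordinates of \<open>\<omega> \<and> v\<close> are integers, and they contain the coordinates
  of \<open>v\<close>. So a second correction, by \<open>\<omega> \<and> y\<close> with \<open>y\<close> in \<open>Y\<close>, makes the image zero in all coordinates,
  and the remaining element lies in \<open>Y \<and> Y \<and> Y\<close> (\<open>comparison_kernel\<close>). The coordinates are given by
  explicit functionals on the tensor product (\<open>jac_coordinate_exists\<close>).
\<close>

section \<open>Crossing numbers and Kirchhoff's law\<close>

text \<open>
  The augmentation of a 0-chain, restricted to the points of \<open>A\<close>: the free Abelian group on one
  generator serves as the integers, and the value of a 0-simplex at the only point of the standard
  simplex is the point that it represents.
\<close>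

definition point_count :: "'p set \<Rightarrow> 'p chain \<Rightarrow> int" where
  "point_count A z = Poly_Mapping.lookup
     (frag_extend (\<lambda>f. if f (\<lambda>j. if j = 0 then 1 else 0) \<in> A then frag_of () else 0) z) ()"

lemma point_count_0 [simp]: "point_count A 0 = 0"
  by (simp add: point_count_def)

lemma point_count_add: "point_count A (a + b) = point_count A a + point_count A b"
  by (simp add: point_count_def frag_extend_add lookup_add)

lemma point_count_minus: "point_count A (- a) = - point_count A a"
  by (simp add: point_count_def frag_extend_minus)

lemma point_count_diff: "point_count A (a - b) = point_count A a - point_count A b"
  using point_count_add[of A a "- b"] by (simp add: point_count_minus)

lemma point_count_cmul: "point_count A (frag_cmul n a) = n * point_count A a"
  by (simp add: point_count_def frag_extend_cmul)

lemma point_count_sum: "point_count A (sum f J) = (\<Sum>j\<in>J. point_count A (f j))"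
  by (induction J rule: infinite_finite_induct) (auto simp: point_count_add)

lemma point_count_of:
  "point_count A (frag_of f) = (if f (\<lambda>j. if j = 0 then 1 else 0) \<in> A then 1 else 0)"
  by (simp add: point_count_def)

lemma point_count_cong:
  assumes "singular_chain 0 (subtopology S D) z" "A \<inter> D = B \<inter> D"
  shows "point_count A z = point_count B z"
proof -
  have "frag_extend (\<lambda>f. if f (\<lambda>j. if j = 0 then 1 else 0) \<in> A then frag_of () else 0) z =
        frag_extend (\<lambda>f. if f (\<lambda>j. if j = 0 then 1 else 0) \<in> B then frag_of () else 0) z"
  proof (rule frag_extend_eq)
    fix f assume "f \<in> Poly_Mapping.keys z"
    then have "f (\<lambda>j. if j = 0 then 1 else 0) \<in> D"
      using assms(1) by (auto simp: singular_chain_subtopology standard_simplex_0)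
    then show "(if f (\<lambda>j. if j = 0 then 1 else 0) \<in> A then frag_of () else 0) =
      (if f (\<lambda>j. if j = 0 then 1 else 0) \<in> B then frag_of () else 0)"
      using assms(2) by auto
  qed
  then show ?thesis by (simp add: point_count_def)
qed

lemma point_count_empty [simp]: "point_count {} z = 0"
proof -
  have "Poly_Mapping.keys z \<subseteq> UNIV" by simp
  then show ?thesis
    by (induction z rule: frag_induction) (auto simp: point_count_of point_count_diff)
qed

lemma point_count_Un:
  assumes "A \<inter> B = {}"
  shows "point_count (A \<union> B) z = point_count A z + point_count B z"
proof -
  have "Poly_Mapping.keys z \<subseteq> UNIV" by simp
  then show ?thesis
  proof (induction z rule: frag_induction)
    case (one x)
    then show ?case using assms by (auto simp: point_count_of)
  qed (auto simp: point_count_diff)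
qed

lemma chain_boundary_1_of:
  "chain_boundary 1 (frag_of f) = frag_of (singular_face 1 0 f) - frag_of (singular_face 1 1 f)"
  by (simp add: chain_boundary_of frag_cmul_minus_one)

lemma singular_face_1_vertex:
  "singular_face 1 0 f (\<lambda>j. if j = 0 then 1 else 0) = f (\<lambda>j. if j = 1 then 1 else 0)"
  "singular_face 1 1 f (\<lambda>j. if j = 0 then 1 else 0) = f (\<lambda>j. if j = 0 then 1 else 0)"
proof -
  have v: "(\<lambda>j. if j = 0 then 1 else 0) \<in> standard_simplex 0"
    by (simp add: standard_simplex_0)
  have "simplical_face 0 (\<lambda>j. if j = 0 then 1 else (0::real)) = (\<lambda>j. if j = 1 then 1 else 0)"
    by (auto simp: simplical_face_def)
  then show "singular_face 1 0 f (\<lambda>j. if j = 0 then 1 else 0) = f (\<lambda>j. if j = 1 then 1 else 0)"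
    using v by (simp add: singular_face_def)
  have "simplical_face 1 (\<lambda>j. if j = 0 then 1 else (0::real)) = (\<lambda>j. if j = 0 then 1 else 0)"
    by (auto simp: simplical_face_def)
  then show "singular_face 1 1 f (\<lambda>j. if j = 0 then 1 else 0) = f (\<lambda>j. if j = 0 then 1 else 0)"
    using v by (simp add: singular_face_def)
qed

lemma point_count_boundary_of:
  "point_count A (chain_boundary 1 (frag_of f)) =
     (if f (\<lambda>j. if j = 1 then 1 else 0) \<in> A then 1 else 0) -
     (if f (\<lambda>j. if j = 0 then 1 else 0) \<in> A then 1 else 0)"
  by (simp only: chain_boundary_1_of point_count_diff point_count_of singular_face_1_vertex)

lemma basis_in_simplex_1:
  "(\<lambda>j. if j = 1 then 1 else 0) \<in> standard_simplex 1"
  "(\<lambda>j. if j = 0 then 1 else 0) \<in> standard_simplex 1"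
  by (rule basis_in_standard_simplex[THEN iffD2]; simp)+

text \<open>
  Each path contributes its two end points with opposite signs, and they lie on the same side of
  \<open>A\<close>.
\<close>

lemma point_count_boundary_eq_0:
  assumes "\<And>f. f \<in> Poly_Mapping.keys c \<Longrightarrow>
             f ` standard_simplex 1 \<subseteq> A \<or> f ` standard_simplex 1 \<inter> A = {}"
  shows "point_count A (chain_boundary 1 c) = 0"
proof -
  let ?P = "{f. f ` standard_simplex 1 \<subseteq> A \<or> f ` standard_simplex 1 \<inter> A = {}}"
  have "Poly_Mapping.keys c \<subseteq> ?P" using assms by auto
  then show ?thesis
  proof (induction c rule: frag_induction)
    case (one f)
    note b = basis_in_simplex_1
    from one consider "f ` standard_simplex 1 \<subseteq> A" | "f ` standard_simplex 1 \<inter> A = {}" by auto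
    then show ?case
    proof cases
      case 1
      then have "f (\<lambda>j. if j = 1 then 1 else 0) \<in> A" "f (\<lambda>j. if j = 0 then 1 else 0) \<in> A"
        using b by blast+
      then show ?thesis by (simp only: point_count_boundary_of)
    next
      case 2
      then have "f (\<lambda>j. if j = 1 then 1 else 0) \<notin> A" "f (\<lambda>j. if j = 0 then 1 else 0) \<notin> A"
        using b by blast+
      then show ?thesis by (simp only: point_count_boundary_of)
    qed
  qed (auto simp: chain_boundary_diff point_count_diff)
qed

lemma connectedin_singular_simplex:
  assumes "singular_simplex p X f"
  shows "connectedin X (f ` standard_simplex p)"
  using assms connectedin_continuous_map_image connectedin_standard_simplex
  by (metis connectedin_absolute connectedin_subtopology inf.idem singular_simplex_def
      connectedin_topspace topspace_standard_simplex)

lemma point_count_boundary_separation: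
  assumes c: "singular_chain 1 (subtopology S (A \<union> B)) c"
    and A: "openin S A" and B: "openin S B" and AB: "A \<inter> B = {}"
  shows "point_count A (chain_boundary 1 c) = 0"
proof (rule point_count_boundary_eq_0)
  fix f assume "f \<in> Poly_Mapping.keys c"
  then have f: "singular_simplex 1 S f" "f ` standard_simplex 1 \<subseteq> A \<union> B"
    using c by (auto simp: singular_chain_def singular_simplex_subtopology subset_eq)
  have "connectedin S (f ` standard_simplex 1)"
    by (rule connectedin_singular_simplex[OF f(1)])
  then have "A \<inter> f ` standard_simplex 1 = {} \<or> B \<inter> f ` standard_simplex 1 = {}"
    using A B AB f(2) unfolding connectedin
    by (metis (no_types, lifting) inf_assoc inf_bot_left)
  then show "f ` standard_simplex 1 \<subseteq> A \<or> f ` standard_simplex 1 \<inter> A = {}"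
    using f(2) by blast
qed

lemma relboundary_excision:
  assumes D: "openin S D" and K: "closedin S K" and KD: "K \<subseteq> D"
    and c: "singular_relcycle p (subtopology S D) (D - K) c"
    and b: "singular_relboundary p S (topspace S - K) c"
  shows "singular_relboundary p (subtopology S D) (D - K) c"
proof -
  let ?U = "topspace S - D" and ?T = "topspace S - K"
  have sub: "D \<subseteq> topspace S" using D openin_subset by blast
  have eq: "topspace S - ?U = D" "?T - ?U = D - K" using sub KD by auto
  have "S closure_of ?U \<subseteq> S interior_of ?T"
  proof -
    have "closedin S ?U" "openin S ?T" using D K by auto
    then show ?thesis using KD by (simp add: closure_of_closedin interior_of_openin Diff_mono)
  qed
  then have iso: "hom_induced p (subtopology S D) (D - K) S ?T id
      \<in> iso (relative_homology_group p (subtopology S D) (D - K)) (relative_homology_group p S ?T)"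
    using homology_excision_axiom[of S ?U ?T "topspace S" p] unfolding eq by simp
  let ?h = "hom_induced p (subtopology S D) (D - K) S ?T id"
  let ?A = "relative_homology_group p (subtopology S D) (D - K)"
  let ?B = "relative_homology_group p S ?T"
  have hom: "?h \<in> hom ?A ?B" and inj: "inj_on ?h (carrier ?A)"
    using iso by (auto simp: iso_def bij_betw_def)
  let ?c = "homologous_rel_set p (subtopology S D) (D - K) c"
  have cin: "?c \<in> carrier ?A" using c by (auto simp: carrier_relative_homology_group)
  have "?h ?c = homologous_rel_set p S ?T (chain_map p id c)"
    by (rule hom_induced_chain_map) (use c sub in \<open>auto intro: continuous_map_from_subtopology\<close>)
  also have "chain_map p id c = c"
    using c by (intro chain_map_id_gen[of _ "subtopology S D"]) (auto simp: singular_relcycle_def)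
  also have "homologous_rel_set p S ?T c = \<one>\<^bsub>?B\<^esub>"
    using b by (simp add: homologous_rel_set_eq_relboundary)
  also have "\<dots> = ?h \<one>\<^bsub>?A\<^esub>"
    using hom_one[OF hom] group_relative_homology_group by simp
  finally have "?c = \<one>\<^bsub>?A\<^esub>"
    using inj cin by (meson group.is_monoid group_relative_homology_group inj_onD monoid.one_closed)
  then show ?thesis by (simp add: homologous_rel_set_eq_relboundary)
qed

text \<open>
  By excision the bounding chain may be taken inside the collar \<open>D\<close>. The boundary of the cycle is
  then that of a chain which avoids \<open>K\<close>, hence of paths that stay on one side of \<open>K\<close>. So the
  number of boundary points on a side depends only on the class relative to the complement of \<open>K\<close>.
\<close>

lemma point_count_excision:
  assumes D: "openin S D" and K: "closedin S K" and KD: "K \<subseteq> D" and DAB: "D - K = A \<union> B"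
    and AB: "A \<inter> B = {}" "openin S A" "openin S B"
    and c: "singular_relcycle 1 (subtopology S D) (D - K) c"
    and b: "singular_relboundary 1 S (topspace S - K) c"
  shows "point_count A (chain_boundary 1 c) = 0"
proof -
  have "singular_relboundary 1 (subtopology S D) (D - K) c"
    by (rule relboundary_excision[OF D K KD c b])
  then obtain d r' where d: "singular_chain 2 (subtopology S D) d"
    and r': "singular_chain 1 (subtopology (subtopology S D) (D - K)) r'"
    and eq': "chain_boundary 2 d = c + r'"
    unfolding singular_relboundary_alt
    by (metis Suc_1 One_nat_def)
  define r where "r = - r'"
  have r: "singular_chain 1 (subtopology (subtopology S D) (D - K)) r"
    and eq: "c = chain_boundary 2 d + r"
    using r' eq' by (simp_all add: r_def singular_chain_minus)
  have "subtopology (subtopology S D) (D - K) = subtopology S (A \<union> B)"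
    using DAB by (simp add: subtopology_subtopology inf.absorb2)
      (metis DAB Diff_subset inf.absorb2)
  with r have r1: "singular_chain 1 (subtopology S (A \<union> B)) r" by simp
  have "chain_boundary 1 (chain_boundary 2 d) = 0"
    using chain_boundary_boundary_alt[of 1 _ d] d by (metis Suc_1)
  then have "chain_boundary 1 c = chain_boundary 1 r" by (simp add: eq chain_boundary_add)
  then show ?thesis using point_count_boundary_separation[OF r1 AB(2,3,1)] by simp
qed

lemma homology_class_int_pow:
  assumes "singular_relcycle p X S c"
  shows "homologous_rel_set p X S c [^]\<^bsub>relative_homology_group (int p) X S\<^esub> (n::int) =
    homologous_rel_set p X S (frag_cmul n c)"
proof -
  have c: "c \<in> carrier (relcycle_group p X S)" using assms by simp
  have hom: "(\<lambda>a. homologous_rel_set p X S a) \<in> hom (relcycle_group p X S) (relative_homology_group (int p) X S)"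
    using normal.r_coset_hom_Mod[OF normal_subgroup_singular_relboundary_relcycle[of p X S]]
    by (simp add: relative_homology_group_def right_coset_singular_relboundary)
  have "c [^]\<^bsub>relcycle_group p X S\<^esub> n = c [^]\<^bsub>chain_group p X\<^esub> n"
    unfolding relcycle_group_def
    by (rule group.int_pow_subgroup_generated) (use c in \<open>simp_all add: relcycle_group_def\<close>)
  also have "\<dots> = frag_cmul n c"
    using assms by (auto simp: chain_group_def singular_relcycle_def singular_chain_def)
  finally have n: "c [^]\<^bsub>relcycle_group p X S\<^esub> n = frag_cmul n c" .
  show ?thesis
    using hom_int_pow[OF hom c group_relcycle_group group_relative_homology_group, of n]
    unfolding n by simp
qed

text \<open>
  The intersection number of a cycle with a curve can be read off from the part \<open>d\<close> of the cycle
  inside a bicollar of the curve. The intersection pairing is specified by an equality of classes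
  relative to the complement of the curve, between the cycle and a multiple of the crossing arc;
  the arc has one boundary point on the outer side and, with negative sign, one on the inner side.
\<close>

lemma crossing_number:
  fixes S :: "'p topology" and \<kappa> :: "complex \<Rightarrow> 'p"
  defines "D \<equiv> \<kappa> ` {z. 1/2 < cmod z \<and> cmod z < 2}" and "K \<equiv> \<kappa> ` circle"
    and "Inner \<equiv> \<kappa> ` {z. 1/2 < cmod z \<and> cmod z < 1}"
    and "Outer \<equiv> \<kappa> ` {z. 1 < cmod z \<and> cmod z < 2}"
  assumes S: "Hausdorff_space S" and I: "intersection_pairing S \<mu> I"
    and \<kappa>: "oriented_annulus S \<mu> \<kappa>"
    and c: "singular_relcycle 1 S {} c"
    and d: "singular_chain 1 (subtopology S D) d"
    and cd: "singular_chain 1 (subtopology S (topspace S - K)) (c - d)"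
  shows "point_count Outer (chain_boundary 1 d) = I (homologous_rel_set 1 S {} c) (loop_class S \<kappa>)"
    and "point_count Inner (chain_boundary 1 d) = - I (homologous_rel_set 1 S {} c) (loop_class S \<kappa>)"
    and "singular_chain 0 (subtopology S (Inner \<union> Outer)) (chain_boundary 1 d)"
proof -
  define An where "An = {z. 1/2 < cmod z \<and> cmod z < 2}"
  define n where "n = I (homologous_rel_set 1 S {} c) (loop_class S \<kappa>)"
  have emb: "embedding_map (top_of_set An) S \<kappa>" and D: "openin S D"
    using \<kappa> by (auto simp: oriented_annulus_def An_def D_def)
  have cont: "continuous_map (top_of_set An) S \<kappa>"
    using emb homeomorphic_imp_continuous_map continuous_map_in_subtopology
    unfolding embedding_map_def by blast
  have inj: "inj_on \<kappa> An"
    using emb by (auto simp: embedding_map_def homeomorphic_eq_everything_map)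
  have circ: "circle \<subseteq> An" by (auto simp: An_def)
  have DA: "D = \<kappa> ` An" by (simp add: D_def An_def)
  have KD: "K \<subseteq> D" unfolding K_def DA using circ by blast
  have DK: "D - K = Inner \<union> Outer"
  proof -
    have "D - K = \<kappa> ` (An - circle)"
      unfolding DA K_def using inj_on_image_set_diff[OF inj, of An circle] circ by auto
    also have "An - circle = {z. 1/2 < cmod z \<and> cmod z < 1} \<union> {z. 1 < cmod z \<and> cmod z < 2}"
      by (auto simp: An_def)
    finally show ?thesis by (simp add: image_Un Inner_def Outer_def)
  qed
  have disj: "Inner \<inter> Outer = {}"
  proof -
    have "Inner \<inter> Outer = \<kappa> ` ({z. 1/2 < cmod z \<and> cmod z < 1} \<inter> {z. 1 < cmod z \<and> cmod z < 2})"
      unfolding Inner_def Outer_def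
      by (rule inj_on_image_Int[OF inj, symmetric]) (auto simp: An_def)
    then show ?thesis by auto
  qed
  have K: "closedin S K"
  proof -
    have "compactin (top_of_set An) circle"
      using circ by (simp add: compactin_subtopology)
    then have "compactin S K"
      unfolding K_def by (rule image_compactin[OF _ cont])
    then show ?thesis using S by (simp add: compactin_imp_closedin)
  qed
  have op: "openin S (\<kappa> ` W)" if W: "open W" "W \<subseteq> An" for W
  proof -
    have "openin (top_of_set An) W" using W by (simp add: open_subset)
    moreover have "homeomorphic_map (top_of_set An) (subtopology S D) \<kappa>"
      using emb by (simp add: embedding_map_def DA)
    ultimately have "openin (subtopology S D) (\<kappa> ` W)"
      using homeomorphic_imp_open_map open_map_def by blast
    then show ?thesis using D openin_trans_full by blast
  qed
  have "open {z::complex. 1/2 < cmod z \<and> cmod z < 1}" "open {z::complex. 1 < cmod z \<and> cmod z < 2}"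
    by (auto intro!: open_Collect_conj open_Collect_less continuous_intros)
  then have oI: "openin S Inner" and oO: "openin S Outer"
    unfolding Inner_def Outer_def by (auto intro!: op simp: An_def)
  define f where "f = (\<lambda>x\<in>standard_simplex 1. \<kappa> (of_real (3/4 * x 0 + 5/4 * x 1)))"
  have ann: "complex_of_real (3/4 * x 0 + 5/4 * x 1) \<in> An" if "x \<in> standard_simplex 1" for x
  proof -
    have "x 0 + x 1 = 1" "0 \<le> x 0" "0 \<le> x 1" using that by (auto simp: standard_simplex_def)
    then have "1/2 < 3/4 * x 0 + 5/4 * x 1" "3/4 * x 0 + 5/4 * x 1 < 2" by linarith+
    then show ?thesis unfolding An_def mem_Collect_eq norm_of_real by linarith
  qed
  have f: "singular_simplex 1 (subtopology S D) f"
  proof -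
    let ?X = "subtopology (powertop_real UNIV) (standard_simplex 1)"
    have "continuous_map ?X euclideanreal (\<lambda>x. 3/4 * x 0 + 5/4 * x 1)"
      by (intro continuous_intros continuous_map_from_subtopology) auto
    then have "continuous_map ?X euclidean (complex_of_real \<circ> (\<lambda>x. 3/4 * x 0 + 5/4 * x 1))"
      by (rule continuous_map_compose) (auto intro: continuous_intros)
    then have "continuous_map ?X (top_of_set An) (complex_of_real \<circ> (\<lambda>x. 3/4 * x 0 + 5/4 * x 1))"
      using ann by (auto simp: continuous_map_in_subtopology)
    then have "continuous_map ?X S (\<kappa> \<circ> (complex_of_real \<circ> (\<lambda>x. 3/4 * x 0 + 5/4 * x 1)))"
      by (rule continuous_map_compose[OF _ cont])
    then have "continuous_map ?X S f"
      by (rule continuous_map_eq) (auto simp: f_def)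
    then show ?thesis
      using ann by (auto simp: singular_simplex_def continuous_map_in_subtopology f_def DA)
  qed
  have b1: "f (\<lambda>j. if j = 1 then 1 else 0) = \<kappa> (5/4)"
    using basis_in_simplex_1 unfolding f_def by simp
  have b0: "f (\<lambda>j. if j = 0 then 1 else 0) = \<kappa> (3/4)"
    using basis_in_simplex_1 unfolding f_def by simp
  have ends: "\<kappa> (5/4) \<in> Outer" "\<kappa> (3/4) \<in> Inner" "\<kappa> (5/4) \<notin> Inner" "\<kappa> (3/4) \<notin> Outer"
  proof -
    show "\<kappa> (5/4) \<in> Outer" "\<kappa> (3/4) \<in> Inner"
      unfolding Outer_def Inner_def by (rule imageI; simp)+
    then show "\<kappa> (5/4) \<notin> Inner" "\<kappa> (3/4) \<notin> Outer" using disj by auto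
  qed
  have sub: "subtopology (subtopology S D) (D - K) = subtopology S (Inner \<union> Outer)"
    by (simp add: subtopology_subtopology) (metis DK Diff_subset inf.absorb2)
  have bf: "singular_chain 0 (subtopology S (Inner \<union> Outer)) (chain_boundary 1 (frag_of f))"
  proof -
    have "singular_chain 0 S (chain_boundary 1 (frag_of f))"
      using f singular_chain_boundary[of 1 S "frag_of f"]
      by (simp add: singular_chain_of singular_simplex_subtopology)
    moreover have "g ` standard_simplex 0 \<subseteq> Inner \<union> Outer"
      if "g \<in> Poly_Mapping.keys (chain_boundary 1 (frag_of f))" for g
    proof -
      have "g = singular_face 1 0 f \<or> g = singular_face 1 1 f"
        using that keys_diff[of "frag_of (singular_face 1 0 f)" "frag_of (singular_face 1 1 f)"]
        unfolding chain_boundary_1_of by auto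
      then show ?thesis
        unfolding standard_simplex_0
        using singular_face_1_vertex[of f] ends unfolding b0 b1 by auto
    qed
    ultimately show ?thesis by (simp add: singular_chain_subtopology)
  qed
  have bd: "singular_chain 0 (subtopology S (Inner \<union> Outer)) (chain_boundary 1 d)"
  proof -
    have "chain_boundary 1 c = 0" using c by (simp add: singular_cycle)
    then have "chain_boundary 1 (c - d) = - chain_boundary 1 d" by (simp add: chain_boundary_diff)
    then have "singular_chain 0 (subtopology S (topspace S - K)) (chain_boundary 1 d)"
      using singular_chain_boundary[OF cd] by (simp add: singular_chain_minus)
    moreover have "singular_chain 0 (subtopology S D) (chain_boundary 1 d)"
      using singular_chain_boundary[OF d] by simp
    ultimately show ?thesis
      unfolding singular_chain_subtopology DK[symmetric] by blast
  qed
  then show "singular_chain 0 (subtopology S (Inner \<union> Outer)) (chain_boundary 1 d)" .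
  (* c' is homologous to zero relative to the complement of the curve, and lives in the annulus *)
  define c' where "c' = d - frag_cmul n (frag_of f)"
  have arc: "singular_relcycle 1 S (topspace S - K) (frag_of f)"
  proof -
    have "Inner \<union> Outer \<subseteq> topspace S - K" using DK D openin_subset by fast
    then show ?thesis
      using f singular_chain_mono[OF bf] by (simp add: singular_relcycle singular_chain_of singular_simplex_subtopology)
  qed
  have "hom_induced 1 S {} S (topspace S - K) id (homologous_rel_set 1 S {} c) =
      homologous_rel_set 1 S (topspace S - K) c"
  proof -
    have "chain_map 1 id c = c"
      using c by (intro chain_map_id_gen[of _ S]) (auto simp: singular_relcycle_def)
    then show ?thesis
      using hom_induced_chain_map[of S S id "{}" "topspace S - K" 1 c] c by simp
  qed
  moreover have "hom_induced 1 S {} S (topspace S - K) id (homologous_rel_set 1 S {} c) =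
      crossing_class S \<kappa> [^]\<^bsub>relative_homology_group 1 S (topspace S - K)\<^esub> n"
  proof -
    have "homologous_rel_set 1 S {} c \<in> carrier (homology_group 1 S)"
      using c carrier_relative_homology_group[of 1 S "{}"] by auto
    then show ?thesis using I \<kappa> unfolding intersection_pairing_def K_def n_def by blast
  qed
  moreover have "crossing_class S \<kappa> [^]\<^bsub>relative_homology_group 1 S (topspace S - K)\<^esub> n =
      homologous_rel_set 1 S (topspace S - K) (frag_cmul n (frag_of f))"
    using homology_class_int_pow[OF arc] by (simp add: crossing_class_def K_def f_def)
  ultimately have "homologous_rel 1 S (topspace S - K) c (frag_cmul n (frag_of f))"
    by (metis homologous_rel_set_eq)
  then have "singular_relboundary 1 S (topspace S - K) (c - frag_cmul n (frag_of f))"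
    by (simp add: homologous_rel_def)
  moreover have "singular_relboundary 1 S (topspace S - K) (c - d)"
    by (rule singular_chain_imp_relboundary[OF cd])
  ultimately have rb: "singular_relboundary 1 S (topspace S - K) c'"
    using singular_relboundary_diff[of 1 S _ "c - frag_cmul n (frag_of f)" "c - d"]
    unfolding c'_def by (metis (no_types, opaque_lifting) diff_diff_eq2 diff_add_cancel add_diff_eq add_diff_cancel_left' diff_add_eq)
  have bc': "chain_boundary 1 c' = chain_boundary 1 d - frag_cmul n (chain_boundary 1 (frag_of f))"
    unfolding c'_def chain_boundary_diff chain_boundary_cmul ..
  have rc: "singular_relcycle 1 (subtopology S D) (D - K) c'"
  proof -
    have "singular_chain 1 (subtopology S D) c'"
      unfolding c'_def using d f by (intro singular_chain_diff singular_chain_cmul) (auto simp: singular_chain_of)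
    moreover have "singular_chain 0 (subtopology S (Inner \<union> Outer)) (chain_boundary 1 c')"
      unfolding bc' using bd bf by (intro singular_chain_diff singular_chain_cmul)
    ultimately show ?thesis by (simp add: singular_relcycle sub)
  qed
  have "point_count Outer (chain_boundary 1 c') = 0"
    by (rule point_count_excision[OF D K KD _ _ oO oI rc rb]) (use DK disj in auto)
  then show "point_count Outer (chain_boundary 1 d) = I (homologous_rel_set 1 S {} c) (loop_class S \<kappa>)"
    unfolding bc' point_count_diff point_count_cmul point_count_boundary_of b0 b1
    using ends by (simp add: n_def)
  have "point_count Inner (chain_boundary 1 c') = 0"
    by (rule point_count_excision[OF D K KD _ _ oI oO rc rb]) (use DK disj in auto)
  then show "point_count Inner (chain_boundary 1 d) = - I (homologous_rel_set 1 S {} c) (loop_class S \<kappa>)"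
    unfolding bc' point_count_diff point_count_cmul point_count_boundary_of b0 b1
    using ends by (simp add: n_def)
qed

definition chain_filter :: "('a \<Rightarrow> bool) \<Rightarrow> ('a \<Rightarrow>\<^sub>0 int) \<Rightarrow> 'a \<Rightarrow>\<^sub>0 int" where
  "chain_filter P = frag_extend (\<lambda>f. if P f then frag_of f else 0)"

lemma lookup_chain_filter:
  "Poly_Mapping.lookup (chain_filter P c) f = (if P f then Poly_Mapping.lookup c f else 0)"
proof -
  have "Poly_Mapping.keys c \<subseteq> UNIV" by simp
  then show ?thesis
    unfolding chain_filter_def
    by (induction c rule: frag_induction) (auto simp: frag_extend_diff lookup_minus lookup_frag_of)
qed

text \<open>
  Kirchhoff's law: a closed curve enters the region of a vertex as often as it leaves it. To prove it
  for chains, cut a cycle with small simplices into its parts near the curves and a rest that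
  avoids all curves. The boundary of the rest has no points in a region, counted with sign, because
  each of its paths stays in one region; and the boundaries of the other parts count the crossings.
\<close>

theorem intersection_numbers_flow:
  fixes S :: "'p topology" and G :: "('v, 'e) pre_digraph"
  assumes G: "fin_digraph G"
    and S: "compact_space S" "Hausdorff_space S" and cs: "curve_system S \<mu> G \<gamma>"
    and I: "intersection_pairing S \<mu> I"
    and x: "x \<in> carrier (homology_group 1 S)" and v: "v \<in> verts G"
  shows "(\<Sum>e | e \<in> arcs G \<and> tail G e = v. I x (loop_class S (\<gamma> e))) =
         (\<Sum>e | e \<in> arcs G \<and> head G e = v. I x (loop_class S (\<gamma> e)))"
proof -
  interpret fin_digraph G by (rule G)
  define K where "K e = \<gamma> e ` circle" for e
  define K0 where "K0 = (\<Union>e\<in>arcs G. K e)"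
  from cs obtain C where
    Cbij: "bij_betw C (verts G) (connected_components_of (subtopology S (topspace S - K0)))"
    and ex: "\<forall>e\<in>arcs G. \<exists>\<kappa>. oriented_annulus S \<mu> \<kappa> \<and> (\<forall>z\<in>circle. \<kappa> z = \<gamma> e z) \<and>
             \<kappa> ` {z. 1/2 < cmod z \<and> cmod z < 1} \<subseteq> C (tail G e) \<and>
             \<kappa> ` {z. 1 < cmod z \<and> cmod z < 2} \<subseteq> C (head G e)"
    unfolding curve_system_def K0_def K_def by (elim conjE exE) blast
  obtain \<kappa> where \<kappa>_all: "\<forall>e\<in>arcs G. oriented_annulus S \<mu> (\<kappa> e) \<and> (\<forall>z\<in>circle. \<kappa> e z = \<gamma> e z) \<and>
             \<kappa> e ` {z. 1/2 < cmod z \<and> cmod z < 1} \<subseteq> C (tail G e) \<and>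
             \<kappa> e ` {z. 1 < cmod z \<and> cmod z < 2} \<subseteq> C (head G e)"
    using bchoice[OF ex] by blast
  then have \<kappa>: "\<And>e. e \<in> arcs G \<Longrightarrow> oriented_annulus S \<mu> (\<kappa> e)"
    and \<kappa>\<gamma>: "\<And>e z. e \<in> arcs G \<Longrightarrow> z \<in> circle \<Longrightarrow> \<kappa> e z = \<gamma> e z"
    and inner: "\<And>e. e \<in> arcs G \<Longrightarrow> \<kappa> e ` {z. 1/2 < cmod z \<and> cmod z < 1} \<subseteq> C (tail G e)"
    and outer: "\<And>e. e \<in> arcs G \<Longrightarrow> \<kappa> e ` {z. 1 < cmod z \<and> cmod z < 2} \<subseteq> C (head G e)"
    by simp_all
  define D where "D e = \<kappa> e ` {z. 1/2 < cmod z \<and> cmod z < 2}" for e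
  define In where "In e = \<kappa> e ` {z. 1/2 < cmod z \<and> cmod z < 1}" for e
  define Out where "Out e = \<kappa> e ` {z. 1 < cmod z \<and> cmod z < 2}" for e
  have K\<kappa>: "\<kappa> e ` circle = K e" if "e \<in> arcs G" for e
    unfolding K_def using \<kappa>\<gamma>[OF that] by (rule image_cong[OF refl])
  have loop: "loop_class S (\<kappa> e) = loop_class S (\<gamma> e)" if "e \<in> arcs G" for e
    unfolding loop_class_def using \<kappa>\<gamma>[OF that] by (auto cong: restrict_cong)
  have compC: "C u \<in> connected_components_of (subtopology S (topspace S - K0))" if "u \<in> verts G" for u
    using Cbij that by (auto simp: bij_betw_def)
  have Csub: "C u \<subseteq> topspace S - K0" if "u \<in> verts G" for u
    using connected_components_of_subset[OF compC[OF that]] by auto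
  have Cdisj: "C u \<inter> C w = {}" if "u \<in> verts G" "w \<in> verts G" "u \<noteq> w" for u w
  proof -
    have "C u \<noteq> C w" using Cbij that by (auto simp: bij_betw_def inj_on_def)
    then show ?thesis
      using pairwise_disjoint_connected_components_of[of "subtopology S (topspace S - K0)"]
        compC that by (auto simp: pairwise_def disjnt_def)
  qed
  have Dopen: "openin S (D e)" if "e \<in> arcs G" for e
    using \<kappa>[OF that] by (simp add: oriented_annulus_def D_def)
  have Deq: "D e = In e \<union> K e \<union> Out e" if "e \<in> arcs G" for e
  proof -
    have "{z. 1/2 < cmod z \<and> cmod z < 2} =
        {z. 1/2 < cmod z \<and> cmod z < 1} \<union> circle \<union> {z. 1 < cmod z \<and> cmod z < 2}" by auto
    then show ?thesis
      unfolding D_def In_def Out_def K\<kappa>[OF that, symmetric] by (metis image_Un)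
  qed
  have InOut: "In e \<subseteq> C (tail G e)" "Out e \<subseteq> C (head G e)" if "e \<in> arcs G" for e
    using inner[OF that] outer[OF that] by (simp_all add: In_def Out_def)
  have InOutK0: "In e \<union> Out e \<subseteq> topspace S - K0" if "e \<in> arcs G" for e
    using InOut[OF that] Csub tail_in_verts[OF that] head_in_verts[OF that] by blast
  have Kdisj: "K e \<inter> K e' = {}" if "e \<in> arcs G" "e' \<in> arcs G" "e \<noteq> e'" for e e'
    using cs that unfolding curve_system_def K_def by blast
  have DK: "D e \<inter> K e' = {}" if "e \<in> arcs G" "e' \<in> arcs G" "e \<noteq> e'" for e e'
    using Deq[OF that(1)] Kdisj[OF that] InOutK0[OF that(1)] that(2) unfolding K0_def by blast
  have Kclosed: "closedin S (K e)" if "e \<in> arcs G" for e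
  proof -
    have "embedding_map (top_of_set circle) S (\<gamma> e)"
      using cs that by (auto simp: curve_system_def simple_closed_curve_def)
    then have "continuous_map (top_of_set circle) S (\<gamma> e)"
      using homeomorphic_imp_continuous_map continuous_map_in_subtopology
      unfolding embedding_map_def by blast
    moreover have "compactin (top_of_set circle) circle" by (simp add: compactin_subtopology)
    ultimately show ?thesis
      unfolding K_def by (intro compactin_imp_closedin[OF S(2)] image_compactin)
  qed
  have K0closed: "closedin S K0"
    unfolding K0_def by (rule closedin_Union) (use Kclosed in auto)
  have K0sub: "K0 \<subseteq> topspace S" using K0closed closedin_subset by blast
  obtain c0 where c0: "singular_relcycle 1 S {} c0" "x = homologous_rel_set 1 S {} c0"
    using x carrier_relative_homology_group[of 1 S "{}"] by auto
  obtain c where c: "singular_relcycle 1 S {} c" and hc: "homologous_rel 1 S {} c0 c"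
    and small: "\<And>f. f \<in> Poly_Mapping.keys c \<Longrightarrow>
       \<exists>V\<in>insert (topspace S - K0) (D ` arcs G). f \<in> standard_simplex 1 \<rightarrow> V"
  proof (rule small_homologous_rel_relcycle_exists[OF _ _ c0(1)])
    show "openin S W" if "W \<in> insert (topspace S - K0) (D ` arcs G)" for W
      using that Dopen K0closed by auto
    show "topspace S \<subseteq> \<Union> (insert (topspace S - K0) (D ` arcs G))"
      using Deq unfolding K0_def by auto
  qed blast
  have xc: "x = homologous_rel_set 1 S {} c"
    using hc by (simp add: c0(2) homologous_rel_set_eq)
  (* A simplex is assigned to the curve that it meets. It meets at most one, since it is small and the
     annulus around a curve is disjoint from the other curves; the annuli themselves may overlap. *)
  define meets where "meets e f \<longleftrightarrow> f ` standard_simplex 1 \<inter> K e \<noteq> {}" for e and f :: "(nat \<Rightarrow> real) \<Rightarrow> 'p"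
  define part where "part e = chain_filter (meets e) c" for e
  define rest where "rest = c - (\<Sum>e\<in>arcs G. part e)"
  have keys_part: "f \<in> Poly_Mapping.keys (part e) \<longleftrightarrow> f \<in> Poly_Mapping.keys c \<and> meets e f" for f e
    by (simp add: part_def in_keys_iff lookup_chain_filter)
  have small_D: "f ` standard_simplex 1 \<subseteq> D e"
    if f: "f \<in> Poly_Mapping.keys c" "meets e f" and e: "e \<in> arcs G" for f e
  proof -
    obtain y where y: "y \<in> standard_simplex 1" "f y \<in> K e"
      using f(2) by (auto simp: meets_def)
    from small[OF f(1)] obtain W where
      W: "W \<in> insert (topspace S - K0) (D ` arcs G)" "f \<in> standard_simplex 1 \<rightarrow> W" by blast
    have "f y \<in> W" using W(2) y(1) by blast
    have "W \<noteq> topspace S - K0" using \<open>f y \<in> W\<close> y(2) e by (auto simp: K0_def)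
    then obtain e' where e': "e' \<in> arcs G" "W = D e'" using W(1) by blast
    have "e' = e" using DK[OF e'(1) e] \<open>f y \<in> W\<close> y(2) e'(2) by blast
    then show ?thesis using W(2) e'(2) by auto
  qed
  have cch: "singular_chain 1 S c" using c by (simp add: singular_cycle)
  have key_S: "singular_simplex 1 S f" if "f \<in> Poly_Mapping.keys c" for f
    using cch that by (auto simp: singular_chain_def)
  have part_D: "singular_chain 1 (subtopology S (D e)) (part e)" if "e \<in> arcs G" for e
    using key_S small_D that by (auto simp: singular_chain_def singular_simplex_subtopology keys_part)
  have avoid: "singular_chain 1 (subtopology S (topspace S - A)) b"
    if b: "Poly_Mapping.keys b \<subseteq> Poly_Mapping.keys c"
      "\<And>f. f \<in> Poly_Mapping.keys b \<Longrightarrow> f ` standard_simplex 1 \<inter> A = {}" for A b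
    unfolding singular_chain_def
  proof
    fix f assume f: "f \<in> Poly_Mapping.keys b"
    then have fS: "singular_simplex 1 S f" using b(1) key_S by blast
    then have "f ` standard_simplex 1 \<subseteq> topspace S"
      using connectedin_singular_simplex connectedin_subset_topspace by blast
    then show "f \<in> singular_simplex_set 1 (subtopology S (topspace S - A))"
      using fS b(2)[OF f] by (auto simp: singular_simplex_subtopology)
  qed
  have lookup_rest: "Poly_Mapping.lookup rest f =
      (if \<exists>e\<in>arcs G. meets e f then 0 else Poly_Mapping.lookup c f)" for f
  proof (cases "f \<in> Poly_Mapping.keys c \<and> (\<exists>e\<in>arcs G. meets e f)")
    case True
    then obtain e where e: "e \<in> arcs G" "meets e f" and f: "f \<in> Poly_Mapping.keys c" by blast
    have "\<not> meets e' f" if "e' \<in> arcs G" "e' \<noteq> e" for e'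
      using small_D[OF f e(2,1)] DK[OF e(1) that(1)] that(2) unfolding meets_def by blast
    then have "(\<Sum>e\<in>arcs G. Poly_Mapping.lookup (part e) f) =
        (\<Sum>e'\<in>arcs G. if e' = e then Poly_Mapping.lookup c f else 0)"
      using e by (intro sum.cong refl) (auto simp: part_def lookup_chain_filter)
    also have "\<dots> = Poly_Mapping.lookup c f" using e by simp
    finally show ?thesis using e by (auto simp: rest_def lookup_minus lookup_sum)
  next
    case False
    then have "(\<Sum>e\<in>arcs G. Poly_Mapping.lookup (part e) f) = 0"
      by (intro sum.neutral) (auto simp: part_def lookup_chain_filter in_keys_iff)
    then show ?thesis using False by (auto simp: rest_def lookup_minus lookup_sum in_keys_iff)
  qed
  have rest_avoid: "singular_chain 1 (subtopology S (topspace S - K0)) rest"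
  proof (rule avoid)
    show "Poly_Mapping.keys rest \<subseteq> Poly_Mapping.keys c"
      by (auto simp: in_keys_iff lookup_rest split: if_splits)
    show "f ` standard_simplex 1 \<inter> K0 = {}" if "f \<in> Poly_Mapping.keys rest" for f
      using that by (auto simp: in_keys_iff lookup_rest meets_def K0_def split: if_splits)
  qed
  have c_part: "singular_chain 1 (subtopology S (topspace S - K e)) (c - part e)"
    if "e \<in> arcs G" for e
  proof (rule avoid)
    have *: "Poly_Mapping.lookup (c - part e) f = (if meets e f then 0 else Poly_Mapping.lookup c f)" for f
      by (simp add: lookup_minus part_def lookup_chain_filter)
    have nz: "\<not> meets e f \<and> Poly_Mapping.lookup c f \<noteq> 0" if "f \<in> Poly_Mapping.keys (c - part e)" for f
      using that *[of f] unfolding in_keys_iff by metis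
    then show "Poly_Mapping.keys (c - part e) \<subseteq> Poly_Mapping.keys c"
      by (auto simp: in_keys_iff)
    show "f ` standard_simplex 1 \<inter> K e = {}" if "f \<in> Poly_Mapping.keys (c - part e)" for f
      using nz[OF that] by (simp add: meets_def)
  qed
  define n where "n e = I x (loop_class S (\<gamma> e))" for e
  have cross: "point_count (Out e) (chain_boundary 1 (part e)) = n e"
      "point_count (In e) (chain_boundary 1 (part e)) = - n e"
      "singular_chain 0 (subtopology S (In e \<union> Out e)) (chain_boundary 1 (part e))"
    if e: "e \<in> arcs G" for e
    using crossing_number[OF S(2) I \<kappa>[OF e] c, of "part e"] part_D[OF e] c_part[OF e] K\<kappa>[OF e]
    by (simp_all add: D_def In_def Out_def n_def loop[OF e] xc)
  have count_v: "point_count (C v) (chain_boundary 1 (part e)) =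
      (if head G e = v then n e else 0) - (if tail G e = v then n e else 0)"
    if e: "e \<in> arcs G" for e
  proof -
    let ?A = "(if head G e = v then Out e else {})" and ?B = "(if tail G e = v then In e else {})"
    have d: "In e \<inter> Out e = {}"
    proof -
      have inj: "inj_on (\<kappa> e) {z. 1/2 < cmod z \<and> cmod z < 2}"
        using \<kappa>[OF e] by (auto simp: oriented_annulus_def embedding_map_def homeomorphic_eq_everything_map)
      show ?thesis
      proof (rule ccontr)
        assume "In e \<inter> Out e \<noteq> {}"
        then obtain z w where "\<kappa> e z = \<kappa> e w" "1/2 < cmod z" "cmod z < 1" "1 < cmod w" "cmod w < 2"
          by (auto simp: In_def Out_def)
        then show False using inj_onD[OF inj, of z w] by auto
      qed
    qed
    have "point_count (C v) (chain_boundary 1 (part e)) = point_count (?A \<union> ?B) (chain_boundary 1 (part e))"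
    proof (rule point_count_cong[OF cross(3)[OF e]])
      have "Out e \<inter> C v = {}" if "head G e \<noteq> v"
        using InOut(2)[OF e] Cdisj[OF head_in_verts[OF e] v that] by blast
      moreover have "In e \<inter> C v = {}" if "tail G e \<noteq> v"
        using InOut(1)[OF e] Cdisj[OF tail_in_verts[OF e] v that] by blast
      ultimately show "C v \<inter> (In e \<union> Out e) = (?A \<union> ?B) \<inter> (In e \<union> Out e)"
        using InOut[OF e] d by auto
    qed
    also have "\<dots> = point_count ?A (chain_boundary 1 (part e)) + point_count ?B (chain_boundary 1 (part e))"
      by (rule point_count_Un) (use d in auto)
    also have "\<dots> = (if head G e = v then n e else 0) - (if tail G e = v then n e else 0)"
      using cross[OF e] by (auto simp: point_count_empty)
    finally show ?thesis .
  qed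
  have rest0: "point_count (C v) (chain_boundary 1 rest) = 0"
  proof (rule point_count_boundary_eq_0)
    fix f assume "f \<in> Poly_Mapping.keys rest"
    then have "singular_simplex 1 (subtopology S (topspace S - K0)) f"
      using rest_avoid by (auto simp: singular_chain_def)
    then have "connectedin (subtopology S (topspace S - K0)) (f ` standard_simplex 1)"
      by (rule connectedin_singular_simplex)
    then show "f ` standard_simplex 1 \<subseteq> C v \<or> f ` standard_simplex 1 \<inter> C v = {}"
      using connected_components_of_maximal[OF compC[OF v], of "f ` standard_simplex 1"]
      by (auto simp: disjnt_def)
  qed
  have "chain_boundary 1 c = 0" using c by (simp add: singular_cycle)
  then have "chain_boundary 1 rest = - (\<Sum>e\<in>arcs G. chain_boundary 1 (part e))"
    by (simp add: rest_def chain_boundary_diff chain_boundary_sum)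
  then have *: "(\<Sum>e\<in>arcs G. point_count (C v) (chain_boundary 1 (part e))) = 0"
    using rest0 by (simp add: point_count_minus point_count_sum)
  have "(\<Sum>e\<in>arcs G. (if head G e = v then n e else 0) - (if tail G e = v then n e else 0)) =
      (\<Sum>e\<in>arcs G. point_count (C v) (chain_boundary 1 (part e)))"
    by (rule sum.cong[OF refl]) (simp only: count_v)
  then show ?thesis
    unfolding * n_def by (simp add: sum_subtractf sum.inter_filter)
qed

lemma loop_class_in_homology:
  assumes "simple_closed_curve S \<gamma>"
  shows "loop_class S \<gamma> \<in> carrier (homology_group 1 S)"
proof -
  have cont: "continuous_map (top_of_set circle) S \<gamma>"
    using assms homeomorphic_imp_continuous_map continuous_map_in_subtopology
    unfolding simple_closed_curve_def embedding_map_def by blast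
  define f where "f = (\<lambda>x\<in>standard_simplex 1. \<gamma> (cis (2 * pi * x 1)))"
  let ?X = "subtopology (powertop_real UNIV) (standard_simplex 1)"
  have "continuous_map ?X euclideanreal (\<lambda>x. 2 * pi * x 1)"
    by (intro continuous_intros continuous_map_from_subtopology) auto
  then have "continuous_map ?X euclidean (cis \<circ> (\<lambda>x. 2 * pi * x 1))"
    by (rule continuous_map_compose) (auto intro: continuous_intros)
  then have "continuous_map ?X (top_of_set circle) (cis \<circ> (\<lambda>x. 2 * pi * x 1))"
    by (auto simp: continuous_map_in_subtopology)
  then have "continuous_map ?X S (\<gamma> \<circ> (cis \<circ> (\<lambda>x. 2 * pi * x 1)))"
    by (rule continuous_map_compose[OF _ cont])
  then have "continuous_map ?X S f"
    by (rule continuous_map_eq) (auto simp: f_def)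
  then have f: "singular_simplex 1 S f" by (simp add: singular_simplex_def f_def)
  have "f (\<lambda>j. if j = 1 then 1 else 0) = \<gamma> 1" "f (\<lambda>j. if j = 0 then 1 else 0) = \<gamma> 1"
    using basis_in_simplex_1 unfolding f_def by simp_all
  then have "singular_face 1 0 f v = singular_face 1 1 f v" if "v \<in> standard_simplex 0" for v
    using that singular_face_1_vertex[of f] unfolding standard_simplex_0 by auto
  moreover have "singular_face 1 k f v = undefined" if "v \<notin> standard_simplex 0" for k v
    using that by (simp add: singular_face_def)
  ultimately have "singular_face 1 0 f v = singular_face 1 1 f v" for v
    by (cases "v \<in> standard_simplex 0") auto
  then have "singular_face 1 0 f = singular_face 1 1 f" by (rule ext)
  then have "chain_boundary 1 (frag_of f) = 0" by (simp only: chain_boundary_1_of) simp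
  then have "singular_relcycle 1 S {} (frag_of f)"
    using f by (simp add: singular_cycle singular_chain_of)
  then show ?thesis
    using carrier_relative_homology_group[of 1 S "{}"] by (auto simp: loop_class_def f_def)
qed

section \<open>Flows on trees\<close>

definition undirected_path :: "('v, 'e) pre_digraph \<Rightarrow> 'e set \<Rightarrow> 'v list \<Rightarrow> 'e list \<Rightarrow> bool" where
  "undirected_path G A vs p \<longleftrightarrow>
     length vs = Suc (length p) \<and> distinct vs \<and> distinct p \<and> set p \<subseteq> A \<and>
     (\<forall>i<length p. {tail G (p ! i), head G (p ! i)} = {vs ! i, vs ! Suc i})"

lemma undirected_path_Cons:
  assumes p: "undirected_path G A vs p" and e: "e \<in> A" "{tail G e, head G e} = {w, vs ! 0}"
    and w: "w \<notin> set vs"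
  shows "undirected_path G A (w # vs) (e # p)"
proof -
  have len: "length vs = Suc (length p)"
    and ends: "\<forall>i<length p. {tail G (p ! i), head G (p ! i)} = {vs ! i, vs ! Suc i}"
    using p by (auto simp: undirected_path_def)
  have "e \<notin> set p"
  proof
    assume "e \<in> set p"
    then obtain i where i: "i < length p" "p ! i = e" by (auto simp: in_set_conv_nth)
    then have "{vs ! i, vs ! Suc i} = {w, vs ! 0}" using ends e(2) by metis
    then have "w = vs ! i \<or> w = vs ! Suc i" by auto
    then show False using w i(1) len by auto
  qed
  moreover have "{tail G ((e # p) ! i), head G ((e # p) ! i)} = {(w # vs) ! i, (w # vs) ! Suc i}"
    if "i < length (e # p)" for i
    using that ends e(2) by (cases i) auto
  ultimately show ?thesis using p w e(1) by (auto simp: undirected_path_def)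
qed

lemma undirected_path_closing:
  assumes p: "undirected_path G A vs p" and k: "0 < k" "k < length vs"
    and e: "e \<in> A" "{tail G e, head G e} = {vs ! 0, vs ! k}" "p \<noteq> []" "e \<noteq> p ! 0"
    and A: "A \<subseteq> arcs G"
  shows "undirected_cycle G (take (Suc k) vs) (take k p @ [e])"
proof -
  have len: "length vs = Suc (length p)" and dvs: "distinct vs"
    and ends: "\<forall>i<length p. {tail G (p ! i), head G (p ! i)} = {vs ! i, vs ! Suc i}"
    using p by (auto simp: undirected_path_def)
  have kp: "k \<le> length p" using k len by simp
  have "e \<notin> set (take k p)"
  proof
    assume "e \<in> set (take k p)"
    then obtain i where i: "i < k" "p ! i = e" by (auto simp: in_set_conv_nth)
    then have "{vs ! i, vs ! Suc i} = {vs ! 0, vs ! k}" using ends e(2) kp by fastforce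
    moreover have "vs ! a = vs ! b \<longleftrightarrow> a = b" if "a \<le> k" "b \<le> k" for a b
      using that k dvs by (simp add: nth_eq_iff_index_eq)
    ultimately have "i = 0" using i(1) k(1) by (auto simp: doubleton_eq_iff)
    then show False using i e by auto
  qed
  moreover have "{tail G ((take k p @ [e]) ! i), head G ((take k p @ [e]) ! i)} =
      {take (Suc k) vs ! i, take (Suc k) vs ! (Suc i mod length (take k p @ [e]))}"
    if i: "i < length (take k p @ [e])" for i
  proof (cases "i < k")
    case True
    then show ?thesis using ends kp by (simp add: nth_append min_absorb2)
  next
    case False
    then have "i = k" using i kp by simp
    then show ?thesis using e(2) kp by (auto simp: nth_append min_absorb2)
  qed
  ultimately show ?thesis
    using p k A e(1) kp len set_take_subset[of k p]
    by (auto simp: undirected_cycle_def undirected_path_def min_absorb2)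
qed

text \<open>
  Consider a longest path in the support of the flow. At its first vertex the flow must continue
  along a second edge of the support; as the path cannot be prolonged, this edge returns to the
  path and closes a cycle.
\<close>

lemma flow_on_forest_eq_0:
  fixes c :: "'e \<Rightarrow> 'r::comm_ring_1"
  assumes G: "fin_digraph G" and T: "undirected_spanning_tree T G"
    and c: "c \<in> flows G" and cT: "\<And>e. e \<notin> arcs T \<Longrightarrow> c e = 0"
  shows "c e = 0"
proof (rule ccontr)
  assume e0: "c e \<noteq> 0"
  interpret fin_digraph G by (rule G)
  define A where "A = {e \<in> arcs T. c e \<noteq> 0}"
  have sub: "arcs T \<subseteq> arcs G" and tl: "tail T = tail G" "head T = head G"
    and nocyc: "\<And>vs p. \<not> undirected_cycle T vs p"
    using T by (auto simp: undirected_spanning_tree_def spanning_def subgraph_def compatible_def)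
  have A: "A \<subseteq> arcs G" "A \<subseteq> arcs T" and cA: "e \<in> A \<longleftrightarrow> c e \<noteq> 0" for e
    using sub cT by (auto simp: A_def)
  have noloop: "tail G a \<noteq> head G a" if "a \<in> A" for a
    using nocyc[of "[tail G a]" "[a]"] that A(2) by (auto simp: undirected_cycle_def tl)
  have path1: "undirected_path T A [tail G e, head G e] [e]"
    using e0 noloop[of e] by (auto simp: undirected_path_def tl cA)
  have finA: "finite A" using A(1) finite_arcs by (rule finite_subset)
  have "length p < Suc (card A)" if "undirected_path T A vs p" for vs p
    using that finA by (auto simp: undirected_path_def card_mono less_Suc_eq_le simp flip: distinct_card)
  then obtain vs p where p: "undirected_path T A vs p"
    and max: "\<And>vs' p'. undirected_path T A vs' p' \<Longrightarrow> length p' \<le> length p"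
    using ex_has_greatest_nat[of "\<lambda>(vs, p). undirected_path T A vs p" "([tail G e, head G e], [e])"
        "\<lambda>(vs, p). length p" "Suc (card A)"] path1 by auto
  have "p \<noteq> []" using max[OF path1] by auto
  then obtain a q where q: "p = a # q" by (cases p) auto
  have len: "length vs = Suc (length p)" and aA: "a \<in> A" and dvs: "distinct vs"
    and ends: "\<forall>i<length p. {tail G (p ! i), head G (p ! i)} = {vs ! i, vs ! Suc i}"
    using p by (simp_all add: undirected_path_def q tl)
  have a: "{tail G a, head G a} = {vs ! 0, vs ! 1}"
    using ends[rule_format, of 0] by (simp add: q)
  have v01: "vs ! 0 \<noteq> vs ! 1" using dvs len q by (simp add: nth_eq_iff_index_eq)
  have "\<exists>b\<in>A. b \<noteq> a \<and> vs ! 0 \<in> {tail G b, head G b}"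
  proof (rule ccontr)
    assume *: "\<not> ?thesis"
    have zero: "c b = 0" if "b \<noteq> a" "tail G b = vs ! 0 \<or> head G b = vs ! 0" for b
      using * that cA by auto
    have fin: "finite {b \<in> arcs G. tail G b = vs ! 0}" "finite {b \<in> arcs G. head G b = vs ! 0}"
      by auto
    have aG: "a \<in> arcs G" using aA A by blast
    have v: "vs ! 0 \<in> verts G" using a tail_in_verts[OF aG] head_in_verts[OF aG] by (auto simp: doubleton_eq_iff)
    have s1: "(\<Sum>b | b \<in> arcs G \<and> tail G b = vs ! 0. c b) = (if tail G a = vs ! 0 then c a else 0)"
    proof -
      have "(\<Sum>b | b \<in> arcs G \<and> tail G b = vs ! 0. c b) =
          (\<Sum>b | b \<in> arcs G \<and> tail G b = vs ! 0. if b = a then c a else 0)"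
        by (intro sum.cong refl) (use zero in auto)
      then show ?thesis using aG by simp
    qed
    have s2: "(\<Sum>b | b \<in> arcs G \<and> head G b = vs ! 0. c b) = (if head G a = vs ! 0 then c a else 0)"
    proof -
      have "(\<Sum>b | b \<in> arcs G \<and> head G b = vs ! 0. c b) =
          (\<Sum>b | b \<in> arcs G \<and> head G b = vs ! 0. if b = a then c a else 0)"
        by (intro sum.cong refl) (use zero in auto)
      then show ?thesis using aG by simp
    qed
    have "(if tail G a = vs ! 0 then c a else 0) = (if head G a = vs ! 0 then c a else 0)"
      using c v s1 s2 by (simp add: flows_def)
    then show False using a v01 aA cA by (auto simp: doubleton_eq_iff)
  qed
  then obtain b w where b: "b \<in> A" "b \<noteq> a" "{tail G b, head G b} = {w, vs ! 0}" by fastforce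
  show False
  proof (cases "w \<in> set vs")
    case True
    then obtain k where k: "k < length vs" "w = vs ! k" by (auto simp: in_set_conv_nth)
    have "k \<noteq> 0" using noloop[OF b(1)] b(3) k(2) by (cases k) (auto simp: doubleton_eq_iff)
    then show False
      using undirected_path_closing[OF p, of k b] k b A nocyc q by (auto simp: tl insert_commute)
  next
    case False
    then have "undirected_path T A (w # vs) (b # p)"
      using undirected_path_Cons[OF p b(1)] b(3) by (simp add: tl)
    then show False using max by fastforce
  qed
qed

section \<open>Quotients of Abelian groups\<close>

(* Products of cosets are computed through representatives, not as products of sets. *)
declare mult_FactGroup [simp del] one_FactGroup [simp del]

lemma (in comm_group) mult_cancel_both:
  assumes "a \<in> carrier G" "b \<in> carrier G"
  shows "a \<otimes> b \<otimes> inv a \<otimes> inv b = \<one>"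
proof -
  have "a \<otimes> b \<otimes> inv a \<otimes> inv b = (a \<otimes> b) \<otimes> (inv a \<otimes> inv b)"
    using assms by (intro m_assoc) auto
  also have "inv a \<otimes> inv b = inv (a \<otimes> b)" using assms by (simp add: inv_mult)
  finally show ?thesis using assms by simp
qed

lemma hom_finprod:
  assumes h: "h \<in> hom G K" and G: "comm_group G" and K: "comm_group K"
    and f: "f \<in> J \<rightarrow> carrier G"
  shows "h (finprod G f J) = finprod K (\<lambda>j. h (f j)) J"
proof -
  interpret G: comm_group G by (rule G)
  interpret K: comm_group K by (rule K)
  have one: "h \<one>\<^bsub>G\<^esub> = \<one>\<^bsub>K\<^esub>" using hom_one[OF h] G.is_group K.is_group by simp
  show ?thesis using f
  proof (induction J rule: infinite_finite_induct)
    case (insert a J)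
    then have "(\<lambda>j. h (f j)) \<in> insert a J \<rightarrow> carrier K" using hom_in_carrier[OF h] by blast
    with insert show ?case by (simp add: hom_mult[OF h] Pi_iff)
  qed (simp_all add: one)
qed

lemma hom_generate_into:
  assumes h: "h \<in> hom G K" and G: "group G" and L: "subgroup L K" and K: "group K"
    and A: "A \<subseteq> carrier G" and into: "\<And>a. a \<in> A \<Longrightarrow> h a \<in> L" and x: "x \<in> generate G A"
  shows "h x \<in> L"
proof -
  interpret group_hom G K h using h G K by (simp add: group_hom_def group_hom_axioms_def)
  have "h ` generate G A = generate K (h ` A)" using generate_img[OF A] by simp
  also have "\<dots> \<subseteq> L" by (rule H.generate_subgroup_incl[OF _ L]) (use into in auto)
  finally show ?thesis using x by blast
qed

lemma trivial_on_generate: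
  assumes h: "h \<in> hom G K" and G: "group G" and K: "group K"
    and A: "A \<subseteq> carrier G" and into: "\<And>a. a \<in> A \<Longrightarrow> h a = \<one>\<^bsub>K\<^esub>" and x: "x \<in> generate G A"
  shows "h x = \<one>\<^bsub>K\<^esub>"
  using hom_generate_into[OF h G group.triv_subgroup[OF K] K A _ x] into by simp

lemma r_coset_hom:
  assumes "comm_group G" "subgroup N G"
  shows "(\<lambda>x. N #>\<^bsub>G\<^esub> x) \<in> hom G (G Mod N)"
  using assms by (simp add: comm_group.subgroup_imp_normal normal.r_coset_hom_Mod)

lemma r_coset_eq_one_iff:
  assumes "comm_group G" "subgroup N G" "x \<in> carrier G"
  shows "N #>\<^bsub>G\<^esub> x = \<one>\<^bsub>G Mod N\<^esub> \<longleftrightarrow> x \<in> N"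
  using assms by (metis FactGroup_def comm_group.axioms(2) group.coset_join1 group.coset_join2
      monoid.simps(2) subgroup.subset)

lemma quotient_lift:
  assumes G: "comm_group G" and N: "subgroup N G" and K: "group K" and h: "h \<in> hom G K"
    and triv: "\<And>n. n \<in> N \<Longrightarrow> h n = \<one>\<^bsub>K\<^esub>"
  obtains g where "g \<in> hom (G Mod N) K" "\<And>x. x \<in> carrier G \<Longrightarrow> g (N #>\<^bsub>G\<^esub> x) = h x"
proof (rule FactGroup_universal[OF h])
  interpret G: comm_group G by (rule G)
  interpret K: group K by (rule K)
  interpret group_hom G K h using h by unfold_locales
  show "N \<lhd> G" using N by (rule G.subgroup_imp_normal)
  fix x y assume xy: "x \<in> carrier G" "y \<in> carrier G" "N #>\<^bsub>G\<^esub> x = N #>\<^bsub>G\<^esub> y"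
  then have "x \<in> N #>\<^bsub>G\<^esub> y" using G.rcos_self[OF xy(1) N] by simp
  then obtain n where n: "n \<in> N" "x = n \<otimes>\<^bsub>G\<^esub> y" by (auto simp: r_coset_def)
  then have "n \<in> carrier G" using N subgroup.mem_carrier by metis
  then show "h x = h y" using n xy(2) triv[OF n(1)] by simp
qed (use that in blast)

lemma quot_map_coset:
  assumes G: "comm_group G" and N: "subgroup N G" and f: "f \<in> hom G G"
    and fN: "\<And>n. n \<in> N \<Longrightarrow> f n \<in> N" and x: "x \<in> carrier G"
  shows "quot_map G N f (N #>\<^bsub>G\<^esub> x) = N #>\<^bsub>G\<^esub> f x"
proof -
  interpret G: comm_group G by (rule G)
  interpret N: subgroup N G by (rule N)
  have fx: "f x \<in> carrier G" using f x by (rule hom_in_carrier)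
  show ?thesis
  proof
    show "quot_map G N f (N #>\<^bsub>G\<^esub> x) \<subseteq> N #>\<^bsub>G\<^esub> f x"
    proof
      fix y assume "y \<in> quot_map G N f (N #>\<^bsub>G\<^esub> x)"
      then obtain n m where nm: "n \<in> N" "m \<in> N" "y = n \<otimes>\<^bsub>G\<^esub> f (m \<otimes>\<^bsub>G\<^esub> x)"
        by (auto simp: quot_map_def set_mult_def r_coset_def)
      then have "y = (n \<otimes>\<^bsub>G\<^esub> f m) \<otimes>\<^bsub>G\<^esub> f x"
        using x fx fN N.mem_carrier by (simp add: hom_mult[OF f] G.m_assoc)
      moreover have "n \<otimes>\<^bsub>G\<^esub> f m \<in> N" using nm fN by blast
      ultimately show "y \<in> N #>\<^bsub>G\<^esub> f x" unfolding r_coset_def by blast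
    qed
    show "N #>\<^bsub>G\<^esub> f x \<subseteq> quot_map G N f (N #>\<^bsub>G\<^esub> x)"
    proof
      fix y assume "y \<in> N #>\<^bsub>G\<^esub> f x"
      then obtain n where "n \<in> N" "y = n \<otimes>\<^bsub>G\<^esub> f x" unfolding r_coset_def by blast
      then show "y \<in> quot_map G N f (N #>\<^bsub>G\<^esub> x)"
        using G.rcos_self[OF x N] unfolding quot_map_def set_mult_def by blast
    qed
  qed
qed

section \<open>Abelian groups given by generators and relations\<close>

text \<open>
  Exterior powers and tensor products are both quotients of the free Abelian group on a set \<open>S\<close> of
  symbols by the subgroup generated by a set \<open>R\<close> of relations. Their universal properties, and the
  induced endomorphisms, are obtained here once for both.
\<close>

locale abelian_presentation =
  fixes S :: "'a set" and R :: "('a \<Rightarrow>\<^sub>0 int) set"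
  assumes rels: "R \<subseteq> carrier (free_Abelian_group S)"
begin

abbreviation "F \<equiv> free_Abelian_group S"
abbreviation "N \<equiv> generate F R"
abbreviation "Q \<equiv> F Mod N"
abbreviation "cls s \<equiv> N #>\<^bsub>F\<^esub> frag_of s"

lemma comm_F: "comm_group F" by (rule abelian_free_Abelian_group)

lemma subgroup_N: "subgroup N F"
  by (rule group.generate_is_subgroup[OF group_free_Abelian_group rels])

lemma comm_Q: "comm_group Q"
  by (rule comm_group.abelian_FactGroup[OF comm_F subgroup_N])

lemma group_Q: "group Q" using comm_Q by (simp add: comm_group_def)

lemma proj_hom: "(\<lambda>u. N #>\<^bsub>F\<^esub> u) \<in> hom F Q"
  by (rule r_coset_hom[OF comm_F subgroup_N])

lemma cls_closed: "s \<in> S \<Longrightarrow> cls s \<in> carrier Q"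
  by (rule hom_in_carrier[OF proj_hom]) simp

lemma proj_diff:
  assumes "u \<in> carrier F" "v \<in> carrier F"
  shows "N #>\<^bsub>F\<^esub> (u - v) = (N #>\<^bsub>F\<^esub> u) \<otimes>\<^bsub>Q\<^esub> inv\<^bsub>Q\<^esub> (N #>\<^bsub>F\<^esub> v)"
proof -
  interpret group_hom F Q "\<lambda>u. N #>\<^bsub>F\<^esub> u"
    using proj_hom group_Q by (simp add: group_hom_def group_hom_axioms_def)
  have "N #>\<^bsub>F\<^esub> (u \<otimes>\<^bsub>F\<^esub> inv\<^bsub>F\<^esub> v) = (N #>\<^bsub>F\<^esub> u) \<otimes>\<^bsub>Q\<^esub> inv\<^bsub>Q\<^esub> (N #>\<^bsub>F\<^esub> v)"
    using assms hom_mult hom_inv G.inv_closed by presburger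
  then show ?thesis using assms by simp
qed

lemma proj_0: "N #>\<^bsub>F\<^esub> 0 = \<one>\<^bsub>Q\<^esub>"
  using r_coset_eq_one_iff[OF comm_F subgroup_N, of 0] subgroup.one_closed[OF subgroup_N] by simp

lemma relation_holds: "u \<in> R \<Longrightarrow> N #>\<^bsub>F\<^esub> u = \<one>\<^bsub>Q\<^esub>"
  using r_coset_eq_one_iff[OF comm_F subgroup_N] rels generate.incl by (metis subsetD)

lemma cls_eqI:
  assumes "frag_of s - frag_of t \<in> R" "s \<in> S" "t \<in> S"
  shows "cls s = cls t"
proof -
  interpret Q: comm_group Q by (rule comm_Q)
  have "cls s \<otimes>\<^bsub>Q\<^esub> inv\<^bsub>Q\<^esub> cls t = \<one>\<^bsub>Q\<^esub>"
    using relation_holds[OF assms(1)] assms(2,3) by (simp add: proj_diff)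
  then show ?thesis using assms cls_closed by (metis Q.inv_closed Q.inv_equality Q.inv_inv)
qed

lemma cls_multI:
  assumes "frag_of s - frag_of t - frag_of u \<in> R" "s \<in> S" "t \<in> S" "u \<in> S"
  shows "cls s = cls t \<otimes>\<^bsub>Q\<^esub> cls u"
proof -
  interpret Q: comm_group Q by (rule comm_Q)
  have "frag_of s - frag_of t \<in> carrier F"
    using assms keys_diff[of "frag_of s" "frag_of t"] by auto
  then have "(cls s \<otimes>\<^bsub>Q\<^esub> inv\<^bsub>Q\<^esub> cls t) \<otimes>\<^bsub>Q\<^esub> inv\<^bsub>Q\<^esub> cls u = \<one>\<^bsub>Q\<^esub>"
    using relation_holds[OF assms(1)] assms(2-) by (simp add: proj_diff)
  moreover note cl = cls_closed[OF assms(2)] cls_closed[OF assms(3)] cls_closed[OF assms(4)]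
  ultimately have "cls s \<otimes>\<^bsub>Q\<^esub> inv\<^bsub>Q\<^esub> cls t = cls u"
    by (metis Q.inv_closed Q.inv_equality Q.inv_inv Q.m_closed)
  then show ?thesis using cl by (metis Q.inv_solve_right Q.m_comm)
qed

lemma cls_oneI: "frag_of s \<in> R \<Longrightarrow> cls s = \<one>\<^bsub>Q\<^esub>"
  by (rule relation_holds)

lemma lift:
  assumes K: "comm_group K" and f: "\<And>s. s \<in> S \<Longrightarrow> f s \<in> carrier K"
    and triv: "\<And>h r. h \<in> hom F K \<Longrightarrow> (\<And>s. s \<in> S \<Longrightarrow> h (frag_of s) = f s) \<Longrightarrow>
      (\<And>u v. u \<in> carrier F \<Longrightarrow> v \<in> carrier F \<Longrightarrow> h (u - v) = h u \<otimes>\<^bsub>K\<^esub> inv\<^bsub>K\<^esub> h v) \<Longrightarrow>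
      r \<in> R \<Longrightarrow> h r = \<one>\<^bsub>K\<^esub>"
  shows "\<exists>h\<in>hom Q K. \<forall>s\<in>S. h (cls s) = f s"
proof -
  interpret K: comm_group K by (rule K)
  obtain h0 where h0: "h0 \<in> hom F K" "\<And>s. s \<in> S \<Longrightarrow> h0 (frag_of s) = f s"
    using K.free_Abelian_group_universal[of f S] f by blast
  interpret group_hom F K h0
    using h0(1) K.is_group by (simp add: group_hom_def group_hom_axioms_def)
  have diff: "h0 (u - v) = h0 u \<otimes>\<^bsub>K\<^esub> inv\<^bsub>K\<^esub> h0 v" if "u \<in> carrier F" "v \<in> carrier F" for u v
  proof -
    have "h0 (u \<otimes>\<^bsub>F\<^esub> inv\<^bsub>F\<^esub> v) = h0 u \<otimes>\<^bsub>K\<^esub> inv\<^bsub>K\<^esub> h0 v"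
      using that hom_mult hom_inv G.inv_closed by presburger
    then show ?thesis using that by simp
  qed
  have "h0 n = \<one>\<^bsub>K\<^esub>" if "n \<in> N" for n
    by (rule trivial_on_generate[OF h0(1) _ _ rels _ that])
      (use triv[OF h0 diff] K.is_group in auto)
  then obtain h where h: "h \<in> hom Q K" "\<And>x. x \<in> carrier F \<Longrightarrow> h (N #>\<^bsub>F\<^esub> x) = h0 x"
    using quotient_lift[OF comm_F subgroup_N K.is_group h0(1)] by blast
  then have "h (cls s) = f s" if "s \<in> S" for s using that h0 by simp
  with h(1) show ?thesis by blast
qed

lemma induct_subgroup:
  assumes L: "subgroup L Q" and cls: "\<And>s. s \<in> S \<Longrightarrow> cls s \<in> L" and x: "x \<in> carrier Q"
  shows "x \<in> L"
proof -
  obtain u where u: "u \<in> carrier F" "x = N #>\<^bsub>F\<^esub> u"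
    using x by (auto simp: carrier_FactGroup)
  have "Poly_Mapping.keys u \<subseteq> S" using u(1) by simp
  then have "N #>\<^bsub>F\<^esub> u \<in> L"
  proof (rule free_Abelian_group_induct)
    show "N #>\<^bsub>F\<^esub> 0 \<in> L" using subgroup.one_closed[OF L] by (simp add: proj_0)
  next
    fix v w :: "'a \<Rightarrow>\<^sub>0 int"
    assume "Poly_Mapping.keys v \<subseteq> S" "Poly_Mapping.keys w \<subseteq> S" "N #>\<^bsub>F\<^esub> v \<in> L" "N #>\<^bsub>F\<^esub> w \<in> L"
    then show "N #>\<^bsub>F\<^esub> (v - w) \<in> L"
      using subgroup.m_closed[OF L] subgroup.m_inv_closed[OF L] by (simp add: proj_diff)
  qed (rule cls)
  then show ?thesis using u by simp
qed

lemma hom_eqI: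
  assumes h: "h \<in> hom Q K" and h': "h' \<in> hom Q K" and K: "comm_group K"
    and eq: "\<And>s. s \<in> S \<Longrightarrow> h (cls s) = h' (cls s)" and x: "x \<in> carrier Q"
  shows "h x = h' x"
proof -
  interpret Q: comm_group Q by (rule comm_Q)
  interpret K: comm_group K by (rule K)
  interpret h: group_hom Q K h using h by unfold_locales
  interpret h': group_hom Q K h' using h' by unfold_locales
  have "subgroup {x \<in> carrier Q. h x = h' x} Q"
  proof (rule Q.subgroupI)
    show "{x \<in> carrier Q. h x = h' x} \<noteq> {}" using Q.one_closed h.hom_one h'.hom_one by force
  qed auto
  then have "x \<in> {x \<in> carrier Q. h x = h' x}"
    by (rule induct_subgroup) (use x eq cls_closed in auto)
  then show ?thesis by simp
qed

text \<open>
  A map \<open>g\<close> of the symbols that respects the relations induces an endomorphism. The relations must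
  go to zero in the quotient, which is weaker than going to relations; for the multiplication by a
  scalar only the weaker condition holds.
\<close>

lemma endo:
  assumes g: "\<And>s. s \<in> S \<Longrightarrow> g s \<in> S"
    and triv: "\<And>r. r \<in> R \<Longrightarrow> N #>\<^bsub>F\<^esub> frag_extend (\<lambda>s. frag_of (g s)) r = \<one>\<^bsub>Q\<^esub>"
  shows "quot_map F N (frag_extend (\<lambda>s. frag_of (g s))) \<in> hom Q Q"
    and "s \<in> S \<Longrightarrow> quot_map F N (frag_extend (\<lambda>s. frag_of (g s))) (cls s) = cls (g s)"
proof -
  let ?e = "frag_extend (\<lambda>s. frag_of (g s)) :: ('a \<Rightarrow>\<^sub>0 int) \<Rightarrow> 'a \<Rightarrow>\<^sub>0 int"
  have ecl: "?e u \<in> carrier F" if "u \<in> carrier F" for u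
    using keys_frag_extend[of "\<lambda>s. frag_of (g s)" u] that g by auto
  have e: "?e \<in> hom F F"
    using ecl by (intro homI) (auto simp: frag_extend_add)
  interpret Q: comm_group Q by (rule comm_Q)
  have "(\<lambda>u. N #>\<^bsub>F\<^esub> u) \<circ> ?e \<in> hom F Q" by (rule hom_compose[OF e proj_hom])
  then have "((\<lambda>u. N #>\<^bsub>F\<^esub> u) \<circ> ?e) n = \<one>\<^bsub>Q\<^esub>" if "n \<in> N" for n
    by (rule trivial_on_generate[OF _ _ group_Q rels _ that]) (use triv in auto)
  then have eN: "?e n \<in> N" if "n \<in> N" for n
    using r_coset_eq_one_iff[OF comm_F subgroup_N, of "?e n"] ecl that
      subgroup.mem_carrier[OF subgroup_N that] by simp
  have q: "quot_map F N ?e (N #>\<^bsub>F\<^esub> u) = N #>\<^bsub>F\<^esub> ?e u" if "u \<in> carrier F" for u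
    by (rule quot_map_coset[OF comm_F subgroup_N e eN that])
  show "quot_map F N ?e \<in> hom Q Q"
  proof (rule homI)
    fix x y assume "x \<in> carrier Q" "y \<in> carrier Q"
    then obtain u v where u: "u \<in> carrier F" "x = N #>\<^bsub>F\<^esub> u" and v: "v \<in> carrier F" "y = N #>\<^bsub>F\<^esub> v"
      by (auto simp: carrier_FactGroup)
    have uv: "u \<otimes>\<^bsub>F\<^esub> v \<in> carrier F"
      using u v by (meson group.is_monoid group_free_Abelian_group monoid.m_closed)
    show "quot_map F N ?e x \<in> carrier Q"
      using u q ecl hom_in_carrier[OF proj_hom] by auto
    have "quot_map F N ?e (x \<otimes>\<^bsub>Q\<^esub> y) = quot_map F N ?e (N #>\<^bsub>F\<^esub> (u \<otimes>\<^bsub>F\<^esub> v))"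
      using hom_mult[OF proj_hom u(1) v(1)] u v by simp
    also have "\<dots> = N #>\<^bsub>F\<^esub> (?e u \<otimes>\<^bsub>F\<^esub> ?e v)"
      using q[OF uv] hom_mult[OF e u(1) v(1)] by simp
    also have "\<dots> = quot_map F N ?e x \<otimes>\<^bsub>Q\<^esub> quot_map F N ?e y"
      using hom_mult[OF proj_hom ecl[OF u(1)] ecl[OF v(1)]] q u v by simp
    finally show "quot_map F N ?e (x \<otimes>\<^bsub>Q\<^esub> y) = quot_map F N ?e x \<otimes>\<^bsub>Q\<^esub> quot_map F N ?e y" .
  qed
  show "quot_map F N ?e (cls s) = cls (g s)" if "s \<in> S"
    using q[of "frag_of s"] that by simp
qed

end

section \<open>Exterior powers and tensor products\<close>

text \<open>
  The integral and the real case are treated alike: a ring of scalars enters the relations of exterior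
  powers and tensor products only through the additive maps by which its elements act.
\<close>

locale scaled_group = comm_group A for A :: "'a monoid" (structure) and sc :: "'r \<Rightarrow> 'a \<Rightarrow> 'a" +
  assumes sc_hom: "sc r \<in> hom A A"
begin

lemma sc_closed [simp]: "x \<in> carrier A \<Longrightarrow> sc r x \<in> carrier A"
  using sc_hom by (rule hom_in_carrier)

lemma update_in_wedge_lists:
  "xs \<in> wedge_lists k A \<Longrightarrow> x \<in> carrier A \<Longrightarrow> xs[i := x] \<in> wedge_lists k A"
  using set_update_subset_insert[of xs i x] by (auto simp: wedge_lists_def)

lemma nth_in_carrier: "xs \<in> wedge_lists k A \<Longrightarrow> i < k \<Longrightarrow> xs ! i \<in> carrier A"
  by (auto simp: wedge_lists_def)

lemma wedge_relI:
  "xs \<in> wedge_lists k A \<Longrightarrow> i < k \<Longrightarrow> x \<in> carrier A \<Longrightarrow> y \<in> carrier A \<Longrightarrow>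
    frag_of (xs[i := x \<otimes> y]) - frag_of (xs[i := x]) - frag_of (xs[i := y]) \<in> wedge_rels sc k A"
  unfolding wedge_rels_def by blast

lemma wedge_rels_cases:
  assumes "r \<in> wedge_rels sc k A"
  obtains (add) xs i x y where "xs \<in> wedge_lists k A" "i < k" "x \<in> carrier A" "y \<in> carrier A"
        "r = frag_of (xs[i := x \<otimes> y]) - frag_of (xs[i := x]) - frag_of (xs[i := y])"
      | (scale) xs i j s where "xs \<in> wedge_lists k A" "i < k" "j < k"
        "r = frag_of (xs[i := sc s (xs ! i)]) - frag_of (xs[j := sc s (xs ! j)])"
      | (alt) xs i j where "xs \<in> wedge_lists k A" "i < j" "j < k" "xs ! i = xs ! j" "r = frag_of xs"
  using assms unfolding wedge_rels_def by blast

lemma wedge_presentation: "abelian_presentation (wedge_lists k A) (wedge_rels sc k A)"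
proof
  show "wedge_rels sc k A \<subseteq> carrier (free_Abelian_group (wedge_lists k A))"
  proof
    fix r assume "r \<in> wedge_rels sc k A"
    then show "r \<in> carrier (free_Abelian_group (wedge_lists k A))"
      unfolding wedge_rels_def
      using update_in_wedge_lists nth_in_carrier sc_closed m_closed
      by (auto 0 3 dest!: set_mp[OF keys_diff] split: if_splits)
  qed
qed

sublocale wedge: abelian_presentation "wedge_lists k A" "wedge_rels sc k A" for k
  by (rule wedge_presentation)

lemma exterior_power_eq: "exterior_power sc k A = wedge.Q k"
  by (simp add: exterior_power_def wedge_kernel_def)

lemma wedge_eq: "xs \<in> wedge_lists k A \<Longrightarrow> wedge sc A xs = wedge.cls k xs"
  by (simp add: wedge_def wedge_kernel_def wedge_lists_def)

lemma comm_group_exterior_power: "comm_group (exterior_power sc k A)"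
  unfolding exterior_power_eq by (rule wedge.comm_Q)

lemma wedge_closed: "xs \<in> wedge_lists k A \<Longrightarrow> wedge sc A xs \<in> carrier (exterior_power sc k A)"
  unfolding exterior_power_eq by (simp only: wedge_eq wedge.cls_closed)

lemma wedge_mult:
  assumes "xs \<in> wedge_lists k A" "i < k" "x \<in> carrier A" "y \<in> carrier A"
  shows "wedge sc A (xs[i := x \<otimes> y]) =
    wedge sc A (xs[i := x]) \<otimes>\<^bsub>exterior_power sc k A\<^esub> wedge sc A (xs[i := y])"
proof -
  note l = update_in_wedge_lists[OF assms(1)]
  have "frag_of (xs[i := x \<otimes> y]) - frag_of (xs[i := x]) - frag_of (xs[i := y]) \<in> wedge_rels sc k A"
    using assms by (auto simp: wedge_rels_def)
  then show ?thesis
    using l assms unfolding exterior_power_eq by (simp only: wedge_eq[of _ k] m_closed wedge.cls_multI)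
qed

lemma wedge_scale:
  assumes "xs \<in> wedge_lists k A" "i < k" "j < k"
  shows "wedge sc A (xs[i := sc r (xs ! i)]) = wedge sc A (xs[j := sc r (xs ! j)])"
proof -
  note l = update_in_wedge_lists[OF assms(1)]
  have "frag_of (xs[i := sc r (xs ! i)]) - frag_of (xs[j := sc r (xs ! j)]) \<in> wedge_rels sc k A"
    using assms by (auto simp: wedge_rels_def)
  moreover have "xs[i := sc r (xs ! i)] \<in> wedge_lists k A" "xs[j := sc r (xs ! j)] \<in> wedge_lists k A"
    using l assms nth_in_carrier by auto
  ultimately show ?thesis
    using wedge.cls_eqI by (simp only: wedge_eq[of _ k])
qed

lemma wedge_alternating:
  assumes "xs \<in> wedge_lists k A" "i < j" "j < k" "xs ! i = xs ! j"
  shows "wedge sc A xs = \<one>\<^bsub>exterior_power sc k A\<^esub>"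
proof -
  have "frag_of xs \<in> wedge_rels sc k A" using assms by (auto simp: wedge_rels_def)
  then show ?thesis
    using assms unfolding exterior_power_eq by (simp only: wedge_eq[of _ k] wedge.cls_oneI)
qed

lemma exterior_lift:
  assumes K: "comm_group K"
    and f: "\<And>xs. xs \<in> wedge_lists k A \<Longrightarrow> f xs \<in> carrier K"
    and add: "\<And>xs i x y. xs \<in> wedge_lists k A \<Longrightarrow> i < k \<Longrightarrow> x \<in> carrier A \<Longrightarrow> y \<in> carrier A \<Longrightarrow>
      f (xs[i := x \<otimes> y]) = f (xs[i := x]) \<otimes>\<^bsub>K\<^esub> f (xs[i := y])"
    and scale: "\<And>xs i j r. xs \<in> wedge_lists k A \<Longrightarrow> i < k \<Longrightarrow> j < k \<Longrightarrow>
      f (xs[i := sc r (xs ! i)]) = f (xs[j := sc r (xs ! j)])"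
    and alt: "\<And>xs i j. xs \<in> wedge_lists k A \<Longrightarrow> i < j \<Longrightarrow> j < k \<Longrightarrow> xs ! i = xs ! j \<Longrightarrow> f xs = \<one>\<^bsub>K\<^esub>"
  shows "\<exists>h\<in>hom (exterior_power sc k A) K. \<forall>xs\<in>wedge_lists k A. h (wedge sc A xs) = f xs"
proof -
  interpret K: comm_group K by (rule K)
  note l = update_in_wedge_lists
  have "\<exists>h\<in>hom (wedge.Q k) K. \<forall>xs\<in>wedge_lists k A. h (wedge.cls k xs) = f xs"
  proof (rule wedge.lift[OF K f])
    fix h r
    assume h: "\<And>s. s \<in> wedge_lists k A \<Longrightarrow> h (frag_of s) = f s"
      and diff: "\<And>u v. u \<in> carrier (free_Abelian_group (wedge_lists k A)) \<Longrightarrow>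
        v \<in> carrier (free_Abelian_group (wedge_lists k A)) \<Longrightarrow> h (u - v) = h u \<otimes>\<^bsub>K\<^esub> inv\<^bsub>K\<^esub> h v"
    assume "r \<in> wedge_rels sc k A"
    then show "h r = \<one>\<^bsub>K\<^esub>"
    proof (cases rule: wedge_rels_cases)
      case (add xs i x y)
      note l3 = l[OF add(1) m_closed[OF add(3,4)], of i] l[OF add(1,3), of i] l[OF add(1,4), of i]
      have "frag_of (xs[i := x \<otimes> y]) - frag_of (xs[i := x]) \<in> carrier (free_Abelian_group (wedge_lists k A))"
        using l3 keys_diff[of "frag_of (xs[i := x \<otimes> y])" "frag_of (xs[i := x])"] by auto
      then have "h r = f (xs[i := x \<otimes> y]) \<otimes>\<^bsub>K\<^esub> inv\<^bsub>K\<^esub> f (xs[i := x]) \<otimes>\<^bsub>K\<^esub> inv\<^bsub>K\<^esub> f (xs[i := y])"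
        using l3 by (simp add: add(5) diff h)
      also have "\<dots> = \<one>\<^bsub>K\<^esub>"
        using l3 f by (simp only: assms(3)[OF add(1-4)] K.mult_cancel_both)
      finally show ?thesis .
    next
      case (scale xs i j s)
      have l2: "xs[i := sc s (xs ! i)] \<in> wedge_lists k A" "xs[j := sc s (xs ! j)] \<in> wedge_lists k A"
        using l scale nth_in_carrier by auto
      then show ?thesis using f assms(4)[OF scale(1-3)] by (simp add: scale(4) diff h)
    next
      case (alt xs i j)
      then show ?thesis using h assms(5) by simp
    qed
  qed
  then show ?thesis unfolding exterior_power_eq by (simp add: wedge_eq)
qed

lemma exterior_induct:
  assumes "subgroup L (exterior_power sc k A)" "\<And>xs. xs \<in> wedge_lists k A \<Longrightarrow> wedge sc A xs \<in> L"
    and "x \<in> carrier (exterior_power sc k A)"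
  shows "x \<in> L"
  using wedge.induct_subgroup[of L k x] assms unfolding exterior_power_eq by (simp add: wedge_eq)

lemma exterior_hom_eqI:
  assumes "h \<in> hom (exterior_power sc k A) K" "h' \<in> hom (exterior_power sc k A) K" "comm_group K"
    and "\<And>xs. xs \<in> wedge_lists k A \<Longrightarrow> h (wedge sc A xs) = h' (wedge sc A xs)"
    and "x \<in> carrier (exterior_power sc k A)"
  shows "h x = h' x"
  using wedge.hom_eqI[of h k K h' x] assms unfolding exterior_power_eq by (simp add: wedge_eq)

lemma exterior_map:
  assumes f: "f \<in> hom A A" and fsc: "\<And>r x. x \<in> carrier A \<Longrightarrow> f (sc r x) = sc r (f x)"
  shows "exterior_map sc k A f \<in> hom (exterior_power sc k A) (exterior_power sc k A)"
    and "xs \<in> wedge_lists k A \<Longrightarrow> exterior_map sc k A f (wedge sc A xs) = wedge sc A (map f xs)"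
proof -
  have fcl: "f x \<in> carrier A" if "x \<in> carrier A" for x using f that by (rule hom_in_carrier)
  have map: "map f xs \<in> wedge_lists k A" if "xs \<in> wedge_lists k A" for xs
    using that fcl by (auto simp: wedge_lists_def)
  have rel: "wedge.N k #>\<^bsub>free_Abelian_group (wedge_lists k A)\<^esub> frag_extend (\<lambda>xs. frag_of (map f xs)) r = \<one>\<^bsub>wedge.Q k\<^esub>"
    if "r \<in> wedge_rels sc k A" for r
  proof (rule wedge.relation_holds)
    from that show "frag_extend (\<lambda>xs. frag_of (map f xs)) r \<in> wedge_rels sc k A"
    proof (cases rule: wedge_rels_cases)
      case (add xs i x y)
      have "frag_extend (\<lambda>xs. frag_of (map f xs)) r = frag_of ((map f xs)[i := f x \<otimes> f y])
          - frag_of ((map f xs)[i := f x]) - frag_of ((map f xs)[i := f y])"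
        by (simp add: add frag_extend_diff map_update hom_mult[OF f])
      then show ?thesis using map add fcl unfolding wedge_rels_def by blast
    next
      case (scale xs i j s)
      then have len: "i < length xs" "j < length xs" by (auto simp: wedge_lists_def)
      have "frag_extend (\<lambda>xs. frag_of (map f xs)) r = frag_of ((map f xs)[i := sc s (map f xs ! i)])
          - frag_of ((map f xs)[j := sc s (map f xs ! j)])"
        using scale nth_in_carrier len by (simp add: frag_extend_diff map_update fsc)
      then show ?thesis using map scale unfolding wedge_rels_def by blast
    next
      case (alt xs i j)
      then have "i < length xs" "j < length xs" by (auto simp: wedge_lists_def)
      then have "map f xs ! i = map f xs ! j" using alt by simp
      then show ?thesis using map[OF alt(1)] alt unfolding wedge_rels_def by auto
    qed
  qed
  show "exterior_map sc k A f \<in> hom (exterior_power sc k A) (exterior_power sc k A)"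
    unfolding exterior_power_eq exterior_map_def wedge_kernel_def by (rule wedge.endo(1)[OF map rel])
  show "exterior_map sc k A f (wedge sc A xs) = wedge sc A (map f xs)" if "xs \<in> wedge_lists k A"
    using wedge.endo(2)[OF map rel that] that map[OF that]
    by (simp add: exterior_map_def wedge_kernel_def wedge_eq[of _ k])
qed

subsection \<open>Exterior squares\<close>

lemma pair_in_wedge_lists: "[x, y] \<in> wedge_lists 2 A \<longleftrightarrow> x \<in> carrier A \<and> y \<in> carrier A"
  by (simp add: wedge_lists_def)

lemma wedge_lists_2: "xs \<in> wedge_lists 2 A \<Longrightarrow> \<exists>x y. xs = [x, y] \<and> x \<in> carrier A \<and> y \<in> carrier A"
  by (auto simp: wedge_lists_def length_Suc_conv numeral_2_eq_2)

lemma wedge2: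
  assumes "x \<in> carrier A" "x' \<in> carrier A" "y \<in> carrier A"
  shows "wedge sc A [x, y] \<in> carrier (exterior_power sc 2 A)"
    and "wedge sc A [x \<otimes> x', y] = wedge sc A [x, y] \<otimes>\<^bsub>exterior_power sc 2 A\<^esub> wedge sc A [x', y]"
    and "wedge sc A [y, x \<otimes> x'] = wedge sc A [y, x] \<otimes>\<^bsub>exterior_power sc 2 A\<^esub> wedge sc A [y, x']"
    and "wedge sc A [x, x] = \<one>\<^bsub>exterior_power sc 2 A\<^esub>"
    and "wedge sc A [sc r x, y] = wedge sc A [x, sc r y]"
  using assms wedge_closed[of "[x, y]" 2] wedge_mult[of "[x, y]" 2 0 x x'] wedge_mult[of "[y, x]" 2 1 x x']
    wedge_alternating[of "[x, x]" 2 0 1] wedge_scale[of "[x, y]" 2 0 1 r]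
  by (simp_all add: pair_in_wedge_lists)

lemma exterior_lift2:
  assumes K: "comm_group K"
    and f: "\<And>x y. x \<in> carrier A \<Longrightarrow> y \<in> carrier A \<Longrightarrow> f x y \<in> carrier K"
    and add1: "\<And>x x' y. x \<in> carrier A \<Longrightarrow> x' \<in> carrier A \<Longrightarrow> y \<in> carrier A \<Longrightarrow>
      f (x \<otimes> x') y = f x y \<otimes>\<^bsub>K\<^esub> f x' y"
    and add2: "\<And>x x' y. x \<in> carrier A \<Longrightarrow> x' \<in> carrier A \<Longrightarrow> y \<in> carrier A \<Longrightarrow>
      f y (x \<otimes> x') = f y x \<otimes>\<^bsub>K\<^esub> f y x'"
    and scale: "\<And>r x y. x \<in> carrier A \<Longrightarrow> y \<in> carrier A \<Longrightarrow> f (sc r x) y = f x (sc r y)"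
    and alt: "\<And>x. x \<in> carrier A \<Longrightarrow> f x x = \<one>\<^bsub>K\<^esub>"
  shows "\<exists>h\<in>hom (exterior_power sc 2 A) K. \<forall>x\<in>carrier A. \<forall>y\<in>carrier A. h (wedge sc A [x, y]) = f x y"
proof -
  let ?f = "\<lambda>xs. f (xs ! 0) (xs ! 1)"
  have lt: "i = 0 \<or> i = 1" if "i < 2" for i :: nat using that by auto
  have "\<exists>h\<in>hom (exterior_power sc 2 A) K. \<forall>xs\<in>wedge_lists 2 A. h (wedge sc A xs) = ?f xs"
  proof (rule exterior_lift[OF K, of 2 ?f])
    fix xs x y and i :: nat assume "xs \<in> wedge_lists 2 A" "i < 2" "x \<in> carrier A" "y \<in> carrier A"
    then show "?f (xs[i := x \<otimes> y]) = ?f (xs[i := x]) \<otimes>\<^bsub>K\<^esub> ?f (xs[i := y])"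
      using lt[of i] add1 add2 by (auto dest!: wedge_lists_2)
  next
    fix xs r and i j :: nat assume "xs \<in> wedge_lists 2 A" "i < 2" "j < 2"
    then show "?f (xs[i := sc r (xs ! i)]) = ?f (xs[j := sc r (xs ! j)])"
      using lt[of i] lt[of j] scale by (auto dest!: wedge_lists_2)
  next
    fix xs and i j :: nat assume "xs \<in> wedge_lists 2 A" "i < j" "j < 2" "xs ! i = xs ! j"
    moreover from this have "i = 0" "j = 1" by simp_all
    ultimately show "?f xs = \<one>\<^bsub>K\<^esub>" using alt by (auto dest!: wedge_lists_2)
  next
    fix xs assume "xs \<in> wedge_lists 2 A"
    then obtain x y where "xs = [x, y]" "x \<in> carrier A" "y \<in> carrier A" using wedge_lists_2 by blast
    then show "?f xs \<in> carrier K" using f by simp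
  qed
  then obtain h where h: "h \<in> hom (exterior_power sc 2 A) K"
    "\<And>xs. xs \<in> wedge_lists 2 A \<Longrightarrow> h (wedge sc A xs) = ?f xs" by blast
  have "h (wedge sc A [x, y]) = f x y" if "x \<in> carrier A" "y \<in> carrier A" for x y
    using h(2)[of "[x, y]"] that by (simp add: pair_in_wedge_lists)
  with h(1) show ?thesis by blast
qed

lemma wedge2_skew:
  assumes x: "x \<in> carrier A" and y: "y \<in> carrier A"
  shows "wedge sc A [x, y] \<otimes>\<^bsub>exterior_power sc 2 A\<^esub> wedge sc A [y, x] = \<one>\<^bsub>exterior_power sc 2 A\<^esub>"
proof -
  interpret E: comm_group "exterior_power sc 2 A" by (rule comm_group_exterior_power)
  have "wedge sc A [x \<otimes> y, x \<otimes> y] = \<one>\<^bsub>exterior_power sc 2 A\<^esub>" using x y by (simp add: wedge2)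
  moreover have "wedge sc A [x \<otimes> y, x \<otimes> y] = wedge sc A [x, x \<otimes> y] \<otimes>\<^bsub>exterior_power sc 2 A\<^esub> wedge sc A [y, x \<otimes> y]"
    using x y by (intro wedge2(2)) auto
  moreover have "wedge sc A [x, x \<otimes> y] = wedge sc A [x, y]" "wedge sc A [y, x \<otimes> y] = wedge sc A [y, x]"
    using wedge2(3)[OF x y x] wedge2(3)[OF x y y] wedge2(1)[OF x x y] wedge2(1)[OF y y x]
      wedge2(4)[OF x x x] wedge2(4)[OF y y y] by simp_all
  ultimately show ?thesis by simp
qed

text \<open>
  The scalar \<open>r\<close> is halved: both halves of the product agree up to exchange of the factors, hence
  cancel. This is how alternation for equal arguments extends to proportional ones.
\<close>

lemma wedge2_proportional:
  assumes x: "x \<in> carrier A" and half: "\<And>z. z \<in> carrier A \<Longrightarrow> sc r z = sc s z \<otimes> sc s z"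
  shows "wedge sc A [sc r x, x] = \<one>\<^bsub>exterior_power sc 2 A\<^esub>"
proof -
  have "wedge sc A [sc r x, x] = wedge sc A [sc s x, x] \<otimes>\<^bsub>exterior_power sc 2 A\<^esub> wedge sc A [sc s x, x]"
    using x half by (simp add: wedge2)
  also have "\<dots> = wedge sc A [sc s x, x] \<otimes>\<^bsub>exterior_power sc 2 A\<^esub> wedge sc A [x, sc s x]"
    using x by (simp add: wedge2)
  also have "\<dots> = \<one>\<^bsub>exterior_power sc 2 A\<^esub>" using x by (simp add: wedge2_skew)
  finally show ?thesis .
qed

text \<open>
  Scalars act on a wedge through its first factor. On the relation \<open>a \<and> a = 0\<close> this produces
  \<open>r a \<and> a\<close>, which vanishes because scalars can be halved.
\<close>

lemma exterior_scale2:
  assumes half: "\<And>r. \<exists>s. \<forall>x\<in>carrier A. sc r x = sc s x \<otimes> sc s x"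
    and comm: "\<And>r s x. x \<in> carrier A \<Longrightarrow> sc r (sc s x) = sc s (sc r x)"
  shows "exterior_scale sc 2 A r \<in> hom (exterior_power sc 2 A) (exterior_power sc 2 A)"
    and "x \<in> carrier A \<Longrightarrow> y \<in> carrier A \<Longrightarrow>
      exterior_scale sc 2 A r (wedge sc A [x, y]) = wedge sc A [sc r x, y]"
proof -
  interpret E: comm_group "exterior_power sc 2 A" by (rule comm_group_exterior_power)
  let ?g = "\<lambda>xs. xs[0 := sc r (xs ! 0)]"
  let ?p = "\<lambda>u. wedge.N 2 #>\<^bsub>free_Abelian_group (wedge_lists 2 A)\<^esub> u"
  have g: "?g xs \<in> wedge_lists 2 A" if "xs \<in> wedge_lists 2 A" for xs
    using update_in_wedge_lists[OF that] nth_in_carrier[OF that] by simp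
  have lt: "i = 0 \<or> i = 1" if "i < 2" for i :: nat using that by auto
  have W: "?p (frag_of [x, y]) = wedge sc A [x, y]" if "x \<in> carrier A" "y \<in> carrier A" for x y
    using that by (simp add: wedge_eq[of _ 2] pair_in_wedge_lists)
  have pd: "?p (u - v) = ?p u \<otimes>\<^bsub>exterior_power sc 2 A\<^esub> inv\<^bsub>exterior_power sc 2 A\<^esub> ?p v"
    if "Poly_Mapping.keys u \<subseteq> wedge_lists 2 A" "Poly_Mapping.keys v \<subseteq> wedge_lists 2 A" for u v
    using wedge.proj_diff[of u 2 v] that by (simp add: exterior_power_eq)
  have triv: "?p (frag_extend (\<lambda>xs. frag_of (?g xs)) u) = \<one>\<^bsub>wedge.Q 2\<^esub>" if "u \<in> wedge_rels sc 2 A" for u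
  proof -
    from that show ?thesis
      unfolding exterior_power_eq[symmetric]
    proof (cases rule: wedge_rels_cases)
      case (add xs i x y)
      obtain a b where ab: "xs = [a, b]" "a \<in> carrier A" "b \<in> carrier A"
        using wedge_lists_2[OF add(1)] by blast
      have "frag_extend (\<lambda>xs. frag_of (?g xs)) u \<in> wedge_rels sc 2 A"
      proof (cases "i = 0")
        case True
        then have "frag_extend (\<lambda>xs. frag_of (?g xs)) u = frag_of (xs[0 := sc r x \<otimes> sc r y])
            - frag_of (xs[0 := sc r x]) - frag_of (xs[0 := sc r y])"
          using add ab by (simp add: frag_extend_diff hom_mult[OF sc_hom])
        moreover have "sc r x \<in> carrier A" "sc r y \<in> carrier A" using add by auto
        ultimately show ?thesis
          using wedge_relI[OF add(1), of 0 "sc r x" "sc r y"] by simp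
      next
        case False
        then have "i = 1" using add by simp
        then have "frag_extend (\<lambda>xs. frag_of (?g xs)) u = frag_of ((?g xs)[1 := x \<otimes> y])
            - frag_of ((?g xs)[1 := x]) - frag_of ((?g xs)[1 := y])"
          using add ab by (simp add: frag_extend_diff)
        then show ?thesis
          using wedge_relI[OF g[OF add(1)], of 1 x y] add(3,4) by simp
      qed
      then show "?p (frag_extend (\<lambda>xs. frag_of (?g xs)) u) = \<one>\<^bsub>exterior_power sc 2 A\<^esub>"
        using wedge.relation_holds exterior_power_eq by simp
    next
      case (scale xs i j s)
      obtain a b where ab: "xs = [a, b]" "a \<in> carrier A" "b \<in> carrier A"
        using wedge_lists_2[OF scale(1)] by blast
      have *: "wedge sc A [sc r (sc s a), b] = wedge sc A [sc r a, sc s b]"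
        using ab by (simp add: comm[of a r s] wedge2)
      have "wedge sc A [sc r (sc s a), b] \<in> carrier (exterior_power sc 2 A)"
        "wedge sc A [sc r a, sc s b] \<in> carrier (exterior_power sc 2 A)"
        using ab by (simp_all add: wedge2)
      then show "?p (frag_extend (\<lambda>xs. frag_of (?g xs)) u) = \<one>\<^bsub>exterior_power sc 2 A\<^esub>"
        using lt[OF scale(2)] lt[OF scale(3)] ab
        by (auto simp: scale(4) frag_extend_diff pd W pair_in_wedge_lists * wedge.proj_0[of 2, folded exterior_power_eq])
    next
      case (alt xs i j)
      have "i = 0" "j = 1" using alt(2,3) by simp_all
      then obtain a where a: "xs = [a, a]" "a \<in> carrier A"
        using wedge_lists_2[OF alt(1)] alt(4) by auto
      obtain s where "\<forall>x\<in>carrier A. sc r x = sc s x \<otimes> sc s x" using half by blast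
      then show "?p (frag_extend (\<lambda>xs. frag_of (?g xs)) u) = \<one>\<^bsub>exterior_power sc 2 A\<^esub>"
        using a wedge2_proportional[of a r s] by (simp add: alt(5) W)
    qed
  qed
  show "exterior_scale sc 2 A r \<in> hom (exterior_power sc 2 A) (exterior_power sc 2 A)"
    unfolding exterior_power_eq exterior_scale_def wedge_kernel_def by (rule wedge.endo(1)[OF g triv])
  show "exterior_scale sc 2 A r (wedge sc A [x, y]) = wedge sc A [sc r x, y]"
    if "x \<in> carrier A" "y \<in> carrier A"
    using wedge.endo(2)[OF g triv, of "[x, y]"] that W[of x y] W[of "sc r x" y]
    by (simp add: exterior_scale_def wedge_kernel_def pair_in_wedge_lists)
qed

subsection \<open>Exterior cubes\<close>

lemma triple_in_wedge_lists:
  "[x, y, z] \<in> wedge_lists 3 A \<longleftrightarrow> x \<in> carrier A \<and> y \<in> carrier A \<and> z \<in> carrier A"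
  by (simp add: wedge_lists_def)

lemma wedge_lists_3:
  "xs \<in> wedge_lists 3 A \<Longrightarrow> \<exists>x y z. xs = [x, y, z] \<and> x \<in> carrier A \<and> y \<in> carrier A \<and> z \<in> carrier A"
  by (auto simp: wedge_lists_def length_Suc_conv numeral_3_eq_3)

lemma wedge3:
  assumes "x \<in> carrier A" "x' \<in> carrier A" "y \<in> carrier A" "z \<in> carrier A"
  shows "wedge sc A [x, y, z] \<in> carrier (exterior_power sc 3 A)"
    and "wedge sc A [x \<otimes> x', y, z] = wedge sc A [x, y, z] \<otimes>\<^bsub>exterior_power sc 3 A\<^esub> wedge sc A [x', y, z]"
    and "wedge sc A [y, x \<otimes> x', z] = wedge sc A [y, x, z] \<otimes>\<^bsub>exterior_power sc 3 A\<^esub> wedge sc A [y, x', z]"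
    and "wedge sc A [y, z, x \<otimes> x'] = wedge sc A [y, z, x] \<otimes>\<^bsub>exterior_power sc 3 A\<^esub> wedge sc A [y, z, x']"
    and "wedge sc A [x, x, y] = \<one>\<^bsub>exterior_power sc 3 A\<^esub>"
    and "wedge sc A [x, y, x] = \<one>\<^bsub>exterior_power sc 3 A\<^esub>"
    and "wedge sc A [y, x, x] = \<one>\<^bsub>exterior_power sc 3 A\<^esub>"
  using assms wedge_closed[of "[x, y, z]" 3] wedge_mult[of "[x, y, z]" 3 0 x x']
    wedge_mult[of "[y, x, z]" 3 1 x x'] wedge_mult[of "[y, z, x]" 3 2 x x']
    wedge_alternating[of "[x, x, y]" 3 0 1] wedge_alternating[of "[x, y, x]" 3 0 2]
    wedge_alternating[of "[y, x, x]" 3 1 2]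
  by (simp_all add: triple_in_wedge_lists numeral_2_eq_2)

lemma exterior_lift3:
  assumes K: "comm_group K"
    and f: "\<And>x y z. x \<in> carrier A \<Longrightarrow> y \<in> carrier A \<Longrightarrow> z \<in> carrier A \<Longrightarrow> f x y z \<in> carrier K"
    and add1: "\<And>x x' y z. x \<in> carrier A \<Longrightarrow> x' \<in> carrier A \<Longrightarrow> y \<in> carrier A \<Longrightarrow> z \<in> carrier A \<Longrightarrow>
      f (x \<otimes> x') y z = f x y z \<otimes>\<^bsub>K\<^esub> f x' y z"
    and add2: "\<And>x x' y z. x \<in> carrier A \<Longrightarrow> x' \<in> carrier A \<Longrightarrow> y \<in> carrier A \<Longrightarrow> z \<in> carrier A \<Longrightarrow>
      f y (x \<otimes> x') z = f y x z \<otimes>\<^bsub>K\<^esub> f y x' z"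
    and add3: "\<And>x x' y z. x \<in> carrier A \<Longrightarrow> x' \<in> carrier A \<Longrightarrow> y \<in> carrier A \<Longrightarrow> z \<in> carrier A \<Longrightarrow>
      f y z (x \<otimes> x') = f y z x \<otimes>\<^bsub>K\<^esub> f y z x'"
    and scale12: "\<And>r x y z. x \<in> carrier A \<Longrightarrow> y \<in> carrier A \<Longrightarrow> z \<in> carrier A \<Longrightarrow> f (sc r x) y z = f x (sc r y) z"
    and scale23: "\<And>r x y z. x \<in> carrier A \<Longrightarrow> y \<in> carrier A \<Longrightarrow> z \<in> carrier A \<Longrightarrow> f x (sc r y) z = f x y (sc r z)"
    and alt: "\<And>x y. x \<in> carrier A \<Longrightarrow> y \<in> carrier A \<Longrightarrow> f x x y = \<one>\<^bsub>K\<^esub>"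
      "\<And>x y. x \<in> carrier A \<Longrightarrow> y \<in> carrier A \<Longrightarrow> f x y x = \<one>\<^bsub>K\<^esub>"
      "\<And>x y. x \<in> carrier A \<Longrightarrow> y \<in> carrier A \<Longrightarrow> f y x x = \<one>\<^bsub>K\<^esub>"
  shows "\<exists>h\<in>hom (exterior_power sc 3 A) K. \<forall>x\<in>carrier A. \<forall>y\<in>carrier A. \<forall>z\<in>carrier A. h (wedge sc A [x, y, z]) = f x y z"
proof -
  let ?f = "\<lambda>xs. f (xs ! 0) (xs ! 1) (xs ! 2)"
  have lt: "i = 0 \<or> i = 1 \<or> i = 2" if "i < 3" for i :: nat using that by auto
  have "\<exists>h\<in>hom (exterior_power sc 3 A) K. \<forall>xs\<in>wedge_lists 3 A. h (wedge sc A xs) = ?f xs"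
  proof (rule exterior_lift[OF K, of 3 ?f])
    fix xs x y and i :: nat assume "xs \<in> wedge_lists 3 A" "i < 3" "x \<in> carrier A" "y \<in> carrier A"
    then show "?f (xs[i := x \<otimes> y]) = ?f (xs[i := x]) \<otimes>\<^bsub>K\<^esub> ?f (xs[i := y])"
      using lt[of i] add1 add2 add3 by (auto dest!: wedge_lists_3 simp: numeral_2_eq_2)
  next
    fix xs r and i j :: nat assume "xs \<in> wedge_lists 3 A" "i < 3" "j < 3"
    then show "?f (xs[i := sc r (xs ! i)]) = ?f (xs[j := sc r (xs ! j)])"
      using lt[of i] lt[of j] scale12 scale23 by (auto dest!: wedge_lists_3 simp: numeral_2_eq_2)
  next
    fix xs and i j :: nat assume "xs \<in> wedge_lists 3 A" "i < j" "j < 3" "xs ! i = xs ! j"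
    then show "?f xs = \<one>\<^bsub>K\<^esub>"
      using lt[of i] lt[of j] alt by (auto dest!: wedge_lists_3 simp: numeral_2_eq_2)
  next
    fix xs assume "xs \<in> wedge_lists 3 A"
    then obtain x y z where "xs = [x, y, z]" "x \<in> carrier A" "y \<in> carrier A" "z \<in> carrier A" using wedge_lists_3 by blast
    then show "?f xs \<in> carrier K" using f by simp
  qed
  then obtain h where h: "h \<in> hom (exterior_power sc 3 A) K"
    "\<And>xs. xs \<in> wedge_lists 3 A \<Longrightarrow> h (wedge sc A xs) = ?f xs" by blast
  have "h (wedge sc A [x, y, z]) = f x y z" if "x \<in> carrier A" "y \<in> carrier A" "z \<in> carrier A" for x y z
    using h(2)[of "[x, y, z]"] that by (simp add: triple_in_wedge_lists)
  with h(1) show ?thesis by blast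
qed

end

subsection \<open>Tensor products\<close>

locale tensor_factors = A: scaled_group A sc + B: scaled_group B sc'
  for A :: "'a monoid" and sc :: "'r \<Rightarrow> 'a \<Rightarrow> 'a" and B :: "'b monoid" and sc' :: "'r \<Rightarrow> 'b \<Rightarrow> 'b"
begin

sublocale tensor: abelian_presentation "carrier A \<times> carrier B" "tensor_rels sc sc' A B"
proof
  show "tensor_rels sc sc' A B \<subseteq> carrier (free_Abelian_group (carrier A \<times> carrier B))"
  proof
    fix r assume "r \<in> tensor_rels sc sc' A B"
    then show "r \<in> carrier (free_Abelian_group (carrier A \<times> carrier B))"
      unfolding tensor_rels_def by (auto 0 3 dest!: set_mp[OF keys_diff] split: if_splits)
  qed
qed

abbreviation "X \<equiv> tensor_product sc sc' A B"
abbreviation "pt \<equiv> pure_tensor sc sc' A B"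

lemma tensor_product_eq: "X = tensor.Q"
  by (simp add: tensor_product_def tensor_kernel_def)

lemma pure_tensor_eq: "pt x y = tensor.cls (x, y)"
  by (simp add: pure_tensor_def tensor_kernel_def)

lemma comm_group_tensor_product: "comm_group X"
  unfolding tensor_product_eq by (rule tensor.comm_Q)

lemma pure_tensor_closed: "x \<in> carrier A \<Longrightarrow> y \<in> carrier B \<Longrightarrow> pt x y \<in> carrier X"
  unfolding tensor_product_eq pure_tensor_eq by (rule tensor.cls_closed) simp

lemma pure_tensor_mult_left:
  "x \<in> carrier A \<Longrightarrow> x' \<in> carrier A \<Longrightarrow> y \<in> carrier B \<Longrightarrow> pt (x \<otimes>\<^bsub>A\<^esub> x') y = pt x y \<otimes>\<^bsub>X\<^esub> pt x' y"
  unfolding tensor_product_eq pure_tensor_eq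
  by (rule tensor.cls_multI) (auto simp: tensor_rels_def)

lemma pure_tensor_mult_right:
  "x \<in> carrier A \<Longrightarrow> y \<in> carrier B \<Longrightarrow> y' \<in> carrier B \<Longrightarrow> pt x (y \<otimes>\<^bsub>B\<^esub> y') = pt x y \<otimes>\<^bsub>X\<^esub> pt x y'"
  unfolding tensor_product_eq pure_tensor_eq
  by (rule tensor.cls_multI) (auto simp: tensor_rels_def)

lemma pure_tensor_hom_right: "x \<in> carrier A \<Longrightarrow> pt x \<in> hom B X"
  by (rule homI) (auto simp: pure_tensor_closed pure_tensor_mult_right)

lemma tensor_lift:
  assumes K: "comm_group K"
    and f: "\<And>x y. x \<in> carrier A \<Longrightarrow> y \<in> carrier B \<Longrightarrow> f x y \<in> carrier K"
    and add1: "\<And>x x' y. x \<in> carrier A \<Longrightarrow> x' \<in> carrier A \<Longrightarrow> y \<in> carrier B \<Longrightarrow>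
      f (x \<otimes>\<^bsub>A\<^esub> x') y = f x y \<otimes>\<^bsub>K\<^esub> f x' y"
    and add2: "\<And>x y y'. x \<in> carrier A \<Longrightarrow> y \<in> carrier B \<Longrightarrow> y' \<in> carrier B \<Longrightarrow>
      f x (y \<otimes>\<^bsub>B\<^esub> y') = f x y \<otimes>\<^bsub>K\<^esub> f x y'"
    and scale: "\<And>r x y. x \<in> carrier A \<Longrightarrow> y \<in> carrier B \<Longrightarrow> f (sc r x) y = f x (sc' r y)"
  shows "\<exists>h\<in>hom X K. \<forall>x\<in>carrier A. \<forall>y\<in>carrier B. h (pt x y) = f x y"
proof -
  interpret K: comm_group K by (rule K)
  have "\<exists>h\<in>hom tensor.Q K. \<forall>s\<in>carrier A \<times> carrier B. h (tensor.cls s) = case_prod f s"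
  proof (rule tensor.lift[OF K, of "case_prod f"])
    fix h r
    assume h: "\<And>s. s \<in> carrier A \<times> carrier B \<Longrightarrow> h (frag_of s) = case_prod f s"
      and diff: "\<And>u v. u \<in> carrier tensor.F \<Longrightarrow> v \<in> carrier tensor.F \<Longrightarrow> h (u - v) = h u \<otimes>\<^bsub>K\<^esub> inv\<^bsub>K\<^esub> h v"
    have three: "h (frag_of s - frag_of t - frag_of u) = \<one>\<^bsub>K\<^esub>"
      if "s \<in> carrier A \<times> carrier B" "t \<in> carrier A \<times> carrier B" "u \<in> carrier A \<times> carrier B"
        "case_prod f s = case_prod f t \<otimes>\<^bsub>K\<^esub> case_prod f u" for s t u
    proof -
      have "frag_of s - frag_of t \<in> carrier tensor.F"
        using that keys_diff[of "frag_of s" "frag_of t"] by auto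
      then have "h (frag_of s - frag_of t - frag_of u) =
          (case_prod f t \<otimes>\<^bsub>K\<^esub> case_prod f u) \<otimes>\<^bsub>K\<^esub> inv\<^bsub>K\<^esub> case_prod f t \<otimes>\<^bsub>K\<^esub> inv\<^bsub>K\<^esub> case_prod f u"
        using that by (simp add: diff h)
      moreover have "case_prod f t \<in> carrier K" "case_prod f u \<in> carrier K" using that f by auto
      ultimately show ?thesis by (simp add: K.mult_cancel_both)
    qed
    assume "r \<in> tensor_rels sc sc' A B"
    then show "h r = \<one>\<^bsub>K\<^esub>"
      unfolding tensor_rels_def
      using f by (auto simp: add1 add2 scale diff h intro!: three)
  qed (use f in auto)
  then show ?thesis unfolding tensor_product_eq pure_tensor_eq by (simp add: split_paired_Ball_Sigma)
qed

end

section \<open>Flows and their dual\<close>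

lemma flows_add: "c \<in> flows G \<Longrightarrow> d \<in> flows G \<Longrightarrow> (\<lambda>e. c e + d e) \<in> flows G"
  by (simp add: flows_def sum.distrib)

lemma flows_scale: "c \<in> flows G \<Longrightarrow> (\<lambda>e. r * c e) \<in> flows G"
  by (simp add: flows_def flip: sum_distrib_left)

lemma flows_0: "(\<lambda>e. 0) \<in> flows G"
  by (simp add: flows_def)

lemma flows_diff: "c \<in> flows G \<Longrightarrow> d \<in> flows G \<Longrightarrow> (\<lambda>e. c e - d e) \<in> flows G"
  by (simp add: flows_def sum_subtractf)

lemma flows_sum: "(\<And>j. j \<in> J \<Longrightarrow> u j \<in> flows G) \<Longrightarrow> (\<lambda>e. \<Sum>j\<in>J. r j * u j e) \<in> flows G"
  by (induction J rule: infinite_finite_induct) (simp_all add: flows_0 flows_add flows_scale)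

lemma flows_real_cycle: "c \<in> flows G \<Longrightarrow> real_cycle c \<in> flows G"
  by (simp add: flows_def flip: of_int_sum)

lemma comm_group_cycle_group:
  fixes G :: "('v, 'e) pre_digraph"
  shows "comm_group (cycle_group G :: ('e \<Rightarrow> 'r::comm_ring_1) monoid)"
proof (rule comm_groupI)
  fix x :: "'e \<Rightarrow> 'r::comm_ring_1" assume "x \<in> carrier (cycle_group G)"
  then show "\<exists>y\<in>carrier (cycle_group G). y \<otimes>\<^bsub>cycle_group G\<^esub> x = \<one>\<^bsub>cycle_group G\<^esub>"
    using flows_scale[of x G "-1"] by (intro bexI[of _ "\<lambda>e. -1 * x e"]) (auto simp: cycle_group_def)
qed (auto simp: cycle_group_def flows_add flows_0 algebra_simps)

lemma scaled_group_cycle_group: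
  fixes G :: "('v, 'e) pre_digraph"
  shows "scaled_group (cycle_group G) cycle_scale"
proof -
  interpret comm_group "cycle_group G :: ('e \<Rightarrow> real) monoid" by (rule comm_group_cycle_group)
  show ?thesis
    by unfold_locales (auto intro!: homI simp: cycle_group_def cycle_scale_def flows_scale algebra_simps)
qed

lemma forms_dual_add:
  "\<phi> \<in> carrier (forms_dual G) \<Longrightarrow> \<omega> \<in> flows G \<Longrightarrow> \<eta> \<in> flows G \<Longrightarrow> \<phi> (\<lambda>e. \<omega> e + \<eta> e) = \<phi> \<omega> + \<phi> \<eta>"
  by (simp add: forms_dual_def)

lemma forms_dual_scaleR:
  "\<phi> \<in> carrier (forms_dual G) \<Longrightarrow> \<omega> \<in> flows G \<Longrightarrow> \<phi> (\<lambda>e. r * \<omega> e) = r * \<phi> \<omega>"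
  by (simp add: forms_dual_def)

lemma forms_dual_zero:
  assumes "\<phi> \<in> carrier (forms_dual G)" shows "\<phi> (\<lambda>e. 0) = 0"
  using forms_dual_scaleR[OF assms flows_0, of 0] by simp

lemma forms_dual_sum:
  assumes "\<phi> \<in> carrier (forms_dual G)" "\<And>j. j \<in> J \<Longrightarrow> u j \<in> flows G"
  shows "\<phi> (\<lambda>e. \<Sum>j\<in>J. r j * u j e) = (\<Sum>j\<in>J. r j * \<phi> (u j))"
  using assms(2)
proof (induction J rule: infinite_finite_induct)
  case (insert j J)
  then have "\<phi> (\<lambda>e. r j * u j e + (\<Sum>j\<in>J. r j * u j e)) = r j * \<phi> (u j) + (\<Sum>j\<in>J. r j * \<phi> (u j))"
    by (simp add: forms_dual_add[OF assms(1)] forms_dual_scaleR[OF assms(1)] flows_scale flows_sum)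
  with insert show ?case by simp
qed (simp_all add: forms_dual_zero[OF assms(1)])

lemma forms_dualI:
  assumes "\<And>\<omega> \<eta>. \<omega> \<in> flows G \<Longrightarrow> \<eta> \<in> flows G \<Longrightarrow> f (\<lambda>e. \<omega> e + \<eta> e) = f \<omega> + f \<eta>"
    and "\<And>r \<omega>. \<omega> \<in> flows G \<Longrightarrow> f (\<lambda>e. r * \<omega> e) = r * f \<omega>"
  shows "(\<lambda>\<omega>\<in>flows G. f \<omega>) \<in> carrier (forms_dual G)"
  using assms by (simp add: forms_dual_def flows_add flows_scale)

lemma forms_dual_eqI:
  assumes "\<phi> \<in> carrier (forms_dual G)" "\<psi> \<in> carrier (forms_dual G)"
    and "\<And>\<omega>. \<omega> \<in> flows G \<Longrightarrow> \<phi> \<omega> = \<psi> \<omega>"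
  shows "\<phi> = \<psi>"
  using assms by (intro extensionalityI[of _ "flows G"]) (auto simp: forms_dual_def)

lemma forms_dual_mult:
  "\<omega> \<in> flows G \<Longrightarrow> (\<phi> \<otimes>\<^bsub>forms_dual G\<^esub> \<psi>) \<omega> = \<phi> \<omega> + \<psi> \<omega>"
  "\<omega> \<in> flows G \<Longrightarrow> \<one>\<^bsub>forms_dual G\<^esub> \<omega> = 0"
  by (simp_all add: forms_dual_def)

lemma forms_dual_closed:
  assumes "\<phi> \<in> carrier (forms_dual G)" "\<psi> \<in> carrier (forms_dual G)"
  shows "\<phi> \<otimes>\<^bsub>forms_dual G\<^esub> \<psi> \<in> carrier (forms_dual G)"
    and "forms_dual_scale G r \<phi> \<in> carrier (forms_dual G)"
proof -
  have "(\<lambda>\<omega>\<in>flows G. \<phi> \<omega> + \<psi> \<omega>) \<in> carrier (forms_dual G)"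
    by (rule forms_dualI) (simp_all add: forms_dual_add[OF assms(1)] forms_dual_add[OF assms(2)]
        forms_dual_scaleR[OF assms(1)] forms_dual_scaleR[OF assms(2)] algebra_simps)
  then show "\<phi> \<otimes>\<^bsub>forms_dual G\<^esub> \<psi> \<in> carrier (forms_dual G)" by (simp add: forms_dual_def)
  show "forms_dual_scale G r \<phi> \<in> carrier (forms_dual G)"
    unfolding forms_dual_scale_def
    by (rule forms_dualI) (simp_all add: forms_dual_add[OF assms(1)] forms_dual_add[OF assms(2)]
        forms_dual_scaleR[OF assms(1)] forms_dual_scaleR[OF assms(2)] algebra_simps)
qed

lemma comm_group_forms_dual: "comm_group (forms_dual G)"
proof (rule comm_groupI)
  show one: "\<one>\<^bsub>forms_dual G\<^esub> \<in> carrier (forms_dual G)"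
    using forms_dualI[of G "\<lambda>\<omega>. 0"] by (simp add: forms_dual_def)
  fix x y z assume xyz: "x \<in> carrier (forms_dual G)" "y \<in> carrier (forms_dual G)" "z \<in> carrier (forms_dual G)"
  show "x \<otimes>\<^bsub>forms_dual G\<^esub> y \<otimes>\<^bsub>forms_dual G\<^esub> z = x \<otimes>\<^bsub>forms_dual G\<^esub> (y \<otimes>\<^bsub>forms_dual G\<^esub> z)"
    by (rule forms_dual_eqI[of _ G]) (use xyz in \<open>simp_all add: forms_dual_closed forms_dual_mult\<close>)
next
  fix x y assume xyz: "x \<in> carrier (forms_dual G)" "y \<in> carrier (forms_dual G)"
  show "x \<otimes>\<^bsub>forms_dual G\<^esub> y = y \<otimes>\<^bsub>forms_dual G\<^esub> x"
    by (rule forms_dual_eqI[of _ G]) (use xyz in \<open>simp_all add: forms_dual_closed forms_dual_mult\<close>)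
next
  fix x assume x: "x \<in> carrier (forms_dual G)"
  have one: "\<one>\<^bsub>forms_dual G\<^esub> \<in> carrier (forms_dual G)"
    using forms_dualI[of G "\<lambda>\<omega>. 0"] by (simp add: forms_dual_def)
  show "\<one>\<^bsub>forms_dual G\<^esub> \<otimes>\<^bsub>forms_dual G\<^esub> x = x"
    by (rule forms_dual_eqI[of _ G]) (use x one in \<open>simp_all add: forms_dual_closed forms_dual_mult\<close>)
  have "forms_dual_scale G (-1) x \<otimes>\<^bsub>forms_dual G\<^esub> x = \<one>\<^bsub>forms_dual G\<^esub>"
  proof (rule forms_dual_eqI[of _ G])
    show "forms_dual_scale G (-1) x \<otimes>\<^bsub>forms_dual G\<^esub> x \<in> carrier (forms_dual G)"
      using x by (intro forms_dual_closed)
  qed (simp_all add: one forms_dual_mult forms_dual_scale_def)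
  then show "\<exists>y\<in>carrier (forms_dual G). y \<otimes>\<^bsub>forms_dual G\<^esub> x = \<one>\<^bsub>forms_dual G\<^esub>"
    using forms_dual_closed(2)[OF x x] by blast
qed (rule forms_dual_closed)

lemma scaled_group_forms_dual:
  fixes G :: "('v, 'e) pre_digraph"
  shows "scaled_group (forms_dual G) (forms_dual_scale G)"
proof -
  interpret comm_group "forms_dual G" by (rule comm_group_forms_dual)
  show ?thesis
  proof
    fix r show "forms_dual_scale G r \<in> hom (forms_dual G) (forms_dual G)"
    proof (rule homI)
      fix x y assume xy: "x \<in> carrier (forms_dual G)" "y \<in> carrier (forms_dual G)"
      show "forms_dual_scale G r (x \<otimes>\<^bsub>forms_dual G\<^esub> y) =
          forms_dual_scale G r x \<otimes>\<^bsub>forms_dual G\<^esub> forms_dual_scale G r y"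
      proof (rule forms_dual_eqI[of _ G])
        fix \<omega> :: "'e \<Rightarrow> real" assume "\<omega> \<in> flows G"
        then show "forms_dual_scale G r (x \<otimes>\<^bsub>forms_dual G\<^esub> y) \<omega> =
          (forms_dual_scale G r x \<otimes>\<^bsub>forms_dual G\<^esub> forms_dual_scale G r y) \<omega>"
          by (simp add: forms_dual_mult forms_dual_scale_def algebra_simps)
      qed (use xy in \<open>simp_all add: forms_dual_closed\<close>)
    qed (rule forms_dual_closed)
  qed
qed

lemma edge_form_in_forms_dual: "edge_form G e \<in> carrier (forms_dual G)"
  unfolding edge_form_def by (rule forms_dualI) simp_all

lemma integration_in_forms_dual: "integration G \<l> c \<in> carrier (forms_dual G)"
  unfolding integration_def
  by (rule forms_dualI) (simp_all add: algebra_simps sum.distrib sum_distrib_left)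

definition real_group :: "real monoid" where
  "real_group = \<lparr>carrier = UNIV, monoid.mult = (+), one = 0\<rparr>"

lemma real_group_simps [simp]:
  "carrier real_group = UNIV" "x \<otimes>\<^bsub>real_group\<^esub> y = x + y" "\<one>\<^bsub>real_group\<^esub> = 0"
  by (simp_all add: real_group_def)

lemma comm_group_real_group: "comm_group real_group"
proof (rule comm_groupI)
  fix x :: real show "\<exists>y\<in>carrier real_group. y \<otimes>\<^bsub>real_group\<^esub> x = \<one>\<^bsub>real_group\<^esub>"
    by (intro bexI[of _ "- x"]) auto
qed auto

lemma finprod_real_group: "finprod real_group f J = sum f J"
proof -
  interpret comm_group real_group by (rule comm_group_real_group)
  show ?thesis by (induction J rule: infinite_finite_induct) auto
qed

section \<open>The tropical homology group of degree (2,1)\<close>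

lemma comm_group_dual_wedge2: "comm_group (dual_wedge2 G)"
  unfolding dual_wedge2_def
  by (rule scaled_group.comm_group_exterior_power[OF scaled_group_forms_dual])

lemma forms_dual_scale_half:
  "\<exists>s. \<forall>x\<in>carrier (forms_dual G). forms_dual_scale G r x =
     forms_dual_scale G s x \<otimes>\<^bsub>forms_dual G\<^esub> forms_dual_scale G s x"
  by (rule exI[of _ "r / 2"]) (auto simp: forms_dual_scale_def forms_dual_def)

lemma forms_dual_scale_commute:
  "forms_dual_scale G r (forms_dual_scale G s x) = forms_dual_scale G s (forms_dual_scale G r x)"
  by (auto simp: forms_dual_scale_def)

lemmas dual_wedge2_scale =
  scaled_group.exterior_scale2[OF scaled_group_forms_dual forms_dual_scale_half forms_dual_scale_commute,
    folded dual_wedge2_def]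

lemma jac_homology21_factors:
  fixes G :: "('v, 'e) pre_digraph"
  shows "tensor_factors (cycle_group G) cycle_scale (dual_wedge2 G)
     (exterior_scale (forms_dual_scale G) 2 (forms_dual G))"
proof -
  interpret A: scaled_group "cycle_group G :: ('e \<Rightarrow> real) monoid" cycle_scale
    by (rule scaled_group_cycle_group)
  interpret B: comm_group "dual_wedge2 G" by (rule comm_group_dual_wedge2)
  show ?thesis by unfold_locales (rule dual_wedge2_scale(1))
qed

lemma comm_group_jac_homology21: "comm_group (jac_homology21 G)"
  unfolding jac_homology21_def
  by (rule tensor_factors.comm_group_tensor_product[OF jac_homology21_factors])

context
  fixes G :: "('v, 'e) pre_digraph"
begin

interpretation tensor_factors "cycle_group G" cycle_scale "dual_wedge2 G"
    "exterior_scale (forms_dual_scale G) 2 (forms_dual G)"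
  by (rule jac_homology21_factors)

lemma real_cycle_in_cycle_group: "c \<in> flows G \<Longrightarrow> real_cycle c \<in> carrier (cycle_group G)"
  by (simp add: cycle_group_def flows_real_cycle)

lemma wedge_in_dual_wedge2:
  "v \<in> carrier (forms_dual G) \<Longrightarrow> w \<in> carrier (forms_dual G) \<Longrightarrow>
    wedge (forms_dual_scale G) (forms_dual G) [v, w] \<in> carrier (dual_wedge2 G)"
  unfolding dual_wedge2_def by (rule scaled_group.wedge2(1)[OF scaled_group_forms_dual])

lemma bracket_closed:
  assumes "c \<in> flows G" "v \<in> carrier (forms_dual G)" "w \<in> carrier (forms_dual G)"
  shows "bracket G c v w \<in> carrier (jac_homology21 G)"
  unfolding bracket_def jac_homology21_def
  using assms by (intro pure_tensor_closed real_cycle_in_cycle_group wedge_in_dual_wedge2)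

lemma bracket_add1:
  assumes "c \<in> flows G" "d \<in> flows G" "v \<in> carrier (forms_dual G)" "w \<in> carrier (forms_dual G)"
  shows "bracket G (\<lambda>e. c e + d e) v w = bracket G c v w \<otimes>\<^bsub>jac_homology21 G\<^esub> bracket G d v w"
proof -
  have eq: "real_cycle (\<lambda>e. c e + d e) = real_cycle c \<otimes>\<^bsub>cycle_group G\<^esub> real_cycle d"
    by (simp add: cycle_group_def)
  show ?thesis
    unfolding bracket_def jac_homology21_def eq
    using assms by (intro pure_tensor_mult_left real_cycle_in_cycle_group wedge_in_dual_wedge2)
qed

lemma bracket_mult2:
  assumes "c \<in> flows G" "v \<in> carrier (forms_dual G)" "v' \<in> carrier (forms_dual G)" "w \<in> carrier (forms_dual G)"
  shows "bracket G c (v \<otimes>\<^bsub>forms_dual G\<^esub> v') w = bracket G c v w \<otimes>\<^bsub>jac_homology21 G\<^esub> bracket G c v' w"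
  unfolding bracket_def jac_homology21_def scaled_group.wedge2(2)[OF scaled_group_forms_dual assms(2-4)]
  unfolding dual_wedge2_def[symmetric]
  using assms by (intro pure_tensor_mult_right real_cycle_in_cycle_group wedge_in_dual_wedge2)

lemma bracket_mult3:
  assumes "c \<in> flows G" "v \<in> carrier (forms_dual G)" "v' \<in> carrier (forms_dual G)" "w \<in> carrier (forms_dual G)"
  shows "bracket G c w (v \<otimes>\<^bsub>forms_dual G\<^esub> v') = bracket G c w v \<otimes>\<^bsub>jac_homology21 G\<^esub> bracket G c w v'"
  unfolding bracket_def jac_homology21_def scaled_group.wedge2(3)[OF scaled_group_forms_dual assms(2-4)]
  unfolding dual_wedge2_def[symmetric]
  using assms by (intro pure_tensor_mult_right real_cycle_in_cycle_group wedge_in_dual_wedge2)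

lemma bracket_zero:
  assumes "v \<in> carrier (forms_dual G)" "w \<in> carrier (forms_dual G)"
  shows "bracket G (\<lambda>e. 0) v w = \<one>\<^bsub>jac_homology21 G\<^esub>"
proof -
  interpret JH: comm_group "jac_homology21 G" by (rule comm_group_jac_homology21)
  have "bracket G (\<lambda>e. 0) v w = bracket G (\<lambda>e. 0) v w \<otimes>\<^bsub>jac_homology21 G\<^esub> bracket G (\<lambda>e. 0) v w"
    using bracket_add1[OF flows_0 flows_0 assms] by simp
  then show ?thesis using bracket_closed[OF flows_0 assms] by (metis JH.l_cancel_one)
qed

lemma bracket_same:
  assumes "c \<in> flows G" "v \<in> carrier (forms_dual G)"
  shows "bracket G c v v = \<one>\<^bsub>jac_homology21 G\<^esub>"
proof -
  interpret JH: comm_group "jac_homology21 G" by (rule comm_group_jac_homology21)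
  have "pt (real_cycle c) \<in> hom (dual_wedge2 G) (jac_homology21 G)"
    unfolding jac_homology21_def
    by (rule pure_tensor_hom_right) (use assms flows_real_cycle in \<open>auto simp: cycle_group_def\<close>)
  then show ?thesis
    using hom_one[of _ "dual_wedge2 G" "jac_homology21 G"] JH.is_group B.is_group
    by (simp add: bracket_def scaled_group.wedge2(4)[OF scaled_group_forms_dual assms(2) assms(2) assms(2)]
        flip: dual_wedge2_def)
qed

lemma bracket_skew:
  assumes c: "c \<in> flows G" and v: "v \<in> carrier (forms_dual G)" and w: "w \<in> carrier (forms_dual G)"
  shows "bracket G c v w \<otimes>\<^bsub>jac_homology21 G\<^esub> bracket G c w v = \<one>\<^bsub>jac_homology21 G\<^esub>"
proof -
  interpret JH: comm_group "jac_homology21 G" by (rule comm_group_jac_homology21)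
  have vw: "v \<otimes>\<^bsub>forms_dual G\<^esub> w \<in> carrier (forms_dual G)" using v w by (rule forms_dual_closed)
  show ?thesis
    using bracket_same[OF c vw] assms
    by (simp add: bracket_mult2[OF c v w vw] bracket_mult3[OF c v w] bracket_same bracket_closed)
qed

text \<open>
  Evaluating the cycle at the edge \<open>\<epsilon>\<close> and pairing the bivector with the forms \<open>u\<close>, \<open>u'\<close> is
  compatible with all relations. Taking fundamental cycles for \<open>u\<close> and \<open>u'\<close>, one obtains coordinates
  without a basis of the tropical homology.
\<close>

lemma jac_coordinate_exists:
  assumes u: "u \<in> flows G" and u': "u' \<in> flows G"
  obtains \<theta> where "\<theta> \<in> hom (jac_homology21 G) real_group"
    "\<And>c v w. c \<in> flows G \<Longrightarrow> v \<in> carrier (forms_dual G) \<Longrightarrow> w \<in> carrier (forms_dual G) \<Longrightarrow>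
       \<theta> (bracket G c v w) = real_of_int (c \<epsilon>) * (v u * w u' - v u' * w u)"
proof -
  interpret V: scaled_group "forms_dual G" "forms_dual_scale G" by (rule scaled_group_forms_dual)
  have "\<exists>D\<in>hom (dual_wedge2 G) real_group. \<forall>v\<in>carrier (forms_dual G). \<forall>w\<in>carrier (forms_dual G).
      D (wedge (forms_dual_scale G) (forms_dual G) [v, w]) = v u * w u' - v u' * w u"
    unfolding dual_wedge2_def
    by (rule V.exterior_lift2[OF comm_group_real_group, of "\<lambda>v w. v u * w u' - v u' * w u"])
      (use u u' in \<open>auto simp: forms_dual_mult forms_dual_scale_def algebra_simps\<close>)
  then obtain D where D: "D \<in> hom (dual_wedge2 G) real_group"
    "\<And>v w. v \<in> carrier (forms_dual G) \<Longrightarrow> w \<in> carrier (forms_dual G) \<Longrightarrow>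
      D (wedge (forms_dual_scale G) (forms_dual G) [v, w]) = v u * w u' - v u' * w u"
    by blast
  have scale: "D (exterior_scale (forms_dual_scale G) 2 (forms_dual G) r y) = r * D y"
    if y: "y \<in> carrier (dual_wedge2 G)" for r y
  proof -
    note sc = dual_wedge2_scale
    have "(D \<circ> exterior_scale (forms_dual_scale G) 2 (forms_dual G) r) y = (\<lambda>y. r * D y) y"
    proof (rule V.exterior_hom_eqI[of _ 2 real_group])
      show "D \<circ> exterior_scale (forms_dual_scale G) 2 (forms_dual G) r
          \<in> hom (exterior_power (forms_dual_scale G) 2 (forms_dual G)) real_group"
        using hom_compose[OF sc(1) D(1)] by (simp add: dual_wedge2_def)
      show "(\<lambda>y. r * D y) \<in> hom (exterior_power (forms_dual_scale G) 2 (forms_dual G)) real_group"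
        using D(1) by (auto simp: hom_def dual_wedge2_def algebra_simps)
      fix xs assume "xs \<in> wedge_lists 2 (forms_dual G)"
      then obtain v w where "xs = [v, w]" "v \<in> carrier (forms_dual G)" "w \<in> carrier (forms_dual G)"
        using V.wedge_lists_2 by blast
      moreover have "forms_dual_scale G r v u = r * v u" "forms_dual_scale G r v u' = r * v u'" for v
        using u u' by (simp_all add: forms_dual_scale_def)
      ultimately show "(D \<circ> exterior_scale (forms_dual_scale G) 2 (forms_dual G) r)
          (wedge (forms_dual_scale G) (forms_dual G) xs) =
          r * D (wedge (forms_dual_scale G) (forms_dual G) xs)"
        by (simp add: sc(2) D(2) algebra_simps)
    qed (use y comm_group_real_group in \<open>auto simp: dual_wedge2_def\<close>)
    then show ?thesis by simp
  qed
  have "\<exists>\<theta>\<in>hom X real_group. \<forall>c\<in>carrier (cycle_group G). \<forall>y\<in>carrier (dual_wedge2 G). \<theta> (pt c y) = c \<epsilon> * D y"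
    by (rule tensor_lift[OF comm_group_real_group, of "\<lambda>c y. c \<epsilon> * D y"])
      (auto simp: scale cycle_scale_def hom_mult[OF D(1)] algebra_simps, simp add: cycle_group_def algebra_simps)
  then obtain \<theta> where \<theta>: "\<theta> \<in> hom X real_group"
    "\<And>c y. c \<in> carrier (cycle_group G) \<Longrightarrow> y \<in> carrier (dual_wedge2 G) \<Longrightarrow> \<theta> (pt c y) = c \<epsilon> * D y"
    by blast
  show thesis
  proof (rule that)
    show "\<theta> \<in> hom (jac_homology21 G) real_group" using \<theta>(1) by (simp add: jac_homology21_def)
    fix c :: "'e \<Rightarrow> int" and v w assume "c \<in> flows G" "v \<in> carrier (forms_dual G)" "w \<in> carrier (forms_dual G)"
    then show "\<theta> (bracket G c v w) = real_of_int (c \<epsilon>) * (v u * w u' - v u' * w u)"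
      unfolding bracket_def
      using \<theta>(2)[of "real_cycle c"] flows_real_cycle[of c G] V.wedge2(1)[of v v w] D(2)
      by (simp add: cycle_group_def dual_wedge2_def)
  qed
qed

end

lemma (in comm_group) finprod_in_subgroup:
  assumes "subgroup L G" "\<And>j. j \<in> J \<Longrightarrow> f j \<in> L"
  shows "finprod G f J \<in> L"
  using assms(2)
proof (induction J rule: infinite_finite_induct)
  case (insert j J)
  then have "f j \<in> carrier G" "f \<in> J \<rightarrow> carrier G"
    using subgroup.mem_carrier[OF assms(1)] by auto
  with insert show ?case using subgroup.m_closed[OF assms(1)] by simp
qed (use subgroup.one_closed[OF assms(1)] in auto)

lemma subgroup_preimage:
  assumes h: "h \<in> hom G K" and G: "group G" and K: "group K" and L: "subgroup L K"
  shows "subgroup {x \<in> carrier G. h x \<in> L} G"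
proof -
  interpret group_hom G K h using h G K by (simp add: group_hom_def group_hom_axioms_def)
  show ?thesis
  proof (rule G.subgroupI)
    show "{x \<in> carrier G. h x \<in> L} \<noteq> {}"
      using subgroup.one_closed[OF L] hom_one by force
  qed (auto simp: subgroup.m_closed[OF L] subgroup.m_inv_closed[OF L])
qed

lemma finprod_integer_group: "finprod integer_group f J = sum f J"
proof -
  interpret comm_group integer_group by (rule abelian_integer_group)
  show ?thesis by (induction J rule: infinite_finite_induct) auto
qed

section \<open>The two sides of the comparison\<close>

text \<open>
  All that the comparison uses of the surface: a pairing with a symplectic basis, and Kirchhoff's
  law for the intersection numbers with the curves. Here \<open>J\<close> is the complement of the tree.
\<close>

locale jacobian_comparison =
  fixes G T :: "('v, 'e) pre_digraph" and \<l> :: "'e \<Rightarrow> nat"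
    and H :: "'h monoid" and I :: "'h \<Rightarrow> 'h \<Rightarrow> int" and \<alpha> \<beta> :: "'e \<Rightarrow> 'h" and J :: "'e set"
  assumes fin: "fin_digraph G" and tree: "undirected_spanning_tree T G"
    and J_def: "J = arcs G - arcs T"
    and H_comm: "comm_group H"
    and I_left: "\<And>x y z. x \<in> carrier H \<Longrightarrow> y \<in> carrier H \<Longrightarrow> z \<in> carrier H \<Longrightarrow>
      I (x \<otimes>\<^bsub>H\<^esub> y) z = I x z + I y z"
    and I_right: "\<And>x y z. x \<in> carrier H \<Longrightarrow> y \<in> carrier H \<Longrightarrow> z \<in> carrier H \<Longrightarrow>
      I z (x \<otimes>\<^bsub>H\<^esub> y) = I z x + I z y"
    and I_self: "\<And>x. x \<in> carrier H \<Longrightarrow> I x x = 0"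
    and \<beta>_closed: "\<And>e. e \<in> arcs G \<Longrightarrow> \<beta> e \<in> carrier H"
    and kirchhoff: "\<And>x. x \<in> carrier H \<Longrightarrow> (\<lambda>e. if e \<in> arcs G then I x (\<beta> e) else 0) \<in> flows G"
    and basis: "symplectic_basis H I J \<alpha> \<beta>"
begin

sublocale H: comm_group H by (rule H_comm)

lemma J_arcs: "J \<subseteq> arcs G" and finite_J: "finite J" and finite_arcs: "finite (arcs G)"
proof -
  show "finite (arcs G)" using fin by (rule fin_digraph.finite_arcs)
  then show "J \<subseteq> arcs G" "finite J" by (auto simp: J_def)
qed

lemma \<alpha>_closed: "j \<in> J \<Longrightarrow> \<alpha> j \<in> carrier H"
  using basis by (force simp: symplectic_basis_def abelian_basis_def Pi_iff)

lemma \<beta>_closed_J: "j \<in> J \<Longrightarrow> \<beta> j \<in> carrier H"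
  using \<beta>_closed J_arcs by blast

lemma pairing_basis:
  assumes "i \<in> J" "j \<in> J"
  shows "I (\<alpha> i) (\<beta> j) = (if i = j then 1 else 0)" "I (\<alpha> i) (\<alpha> j) = 0" "I (\<beta> i) (\<beta> j) = 0"
  using basis assms by (simp_all add: symplectic_basis_def)

lemma hom_I_left: "z \<in> carrier H \<Longrightarrow> (\<lambda>x. I x z) \<in> hom H integer_group"
  by (rule homI) (simp_all add: I_left integer_group_def)

lemma hom_I_right: "z \<in> carrier H \<Longrightarrow> I z \<in> hom H integer_group"
  by (rule homI) (simp_all add: I_right integer_group_def)

lemma I_skew: "x \<in> carrier H \<Longrightarrow> y \<in> carrier H \<Longrightarrow> I x y = - I y x"
  using I_self[of "x \<otimes>\<^bsub>H\<^esub> y"] I_self[of x] I_self[of y]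
  by (simp add: I_left I_right)

lemma I_pow_left: "x \<in> carrier H \<Longrightarrow> z \<in> carrier H \<Longrightarrow> I (x [^]\<^bsub>H\<^esub> (n::int)) z = n * I x z"
  using hom_int_pow[OF hom_I_left, of z x n] H.is_group by simp

lemma I_pow_right: "x \<in> carrier H \<Longrightarrow> z \<in> carrier H \<Longrightarrow> I z (x [^]\<^bsub>H\<^esub> (n::int)) = n * I z x"
  using hom_int_pow[OF hom_I_right, of z x n] H.is_group by simp

lemma I_finprod_left:
  "z \<in> carrier H \<Longrightarrow> f \<in> A \<rightarrow> carrier H \<Longrightarrow> I (finprod H f A) z = (\<Sum>a\<in>A. I (f a) z)"
  using hom_finprod[OF hom_I_left H_comm abelian_integer_group] by (simp add: finprod_integer_group)

lemma I_finprod_right: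
  "z \<in> carrier H \<Longrightarrow> f \<in> A \<rightarrow> carrier H \<Longrightarrow> I z (finprod H f A) = (\<Sum>a\<in>A. I z (f a))"
  using hom_finprod[OF hom_I_right H_comm abelian_integer_group] by (simp add: finprod_integer_group)

text \<open>
  Expansion in the basis, in the form in which it is used: what holds on the basis and is preserved by the
  group operations holds everywhere.
\<close>

lemma H_induct:
  assumes L: "subgroup L H" and "\<And>j. j \<in> J \<Longrightarrow> \<alpha> j \<in> L" "\<And>j. j \<in> J \<Longrightarrow> \<beta> j \<in> L" and x: "x \<in> carrier H"
  shows "x \<in> L"
proof -
  have "bij_betw (\<lambda>n. finprod H (\<lambda>j. case_sum \<alpha> \<beta> j [^]\<^bsub>H\<^esub> (n j :: int)) (J <+> J)) ((J <+> J) \<rightarrow>\<^sub>E UNIV) (carrier H)"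
    using basis by (simp add: symplectic_basis_def abelian_basis_def)
  then obtain n :: "'e + 'e \<Rightarrow> int" where
    xn: "x = finprod H (\<lambda>j. case_sum \<alpha> \<beta> j [^]\<^bsub>H\<^esub> n j) (J <+> J)"
    using x unfolding bij_betw_def by blast
  have L_mem: "case_sum \<alpha> \<beta> s [^]\<^bsub>H\<^esub> n s \<in> L" if "s \<in> J <+> J" for s
    using that assms by (auto intro!: H.subgroup_int_pow_closed[OF L])
  have "finprod H (\<lambda>j. case_sum \<alpha> \<beta> j [^]\<^bsub>H\<^esub> n j) (J <+> J) \<in> L"
    by (rule H.finprod_in_subgroup[OF L L_mem])
  then show ?thesis using xn by simp
qed

definition A_comb :: "('e \<Rightarrow> int) \<Rightarrow> 'h" where
  "A_comb m = finprod H (\<lambda>j. \<alpha> j [^]\<^bsub>H\<^esub> m j) J"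

definition B_comb :: "('e \<Rightarrow> int) \<Rightarrow> 'h" where
  "B_comb m = finprod H (\<lambda>j. \<beta> j [^]\<^bsub>H\<^esub> m j) J"

lemma comb_closed: "A_comb m \<in> carrier H" "B_comb m \<in> carrier H"
  using \<alpha>_closed \<beta>_closed_J by (auto simp: A_comb_def B_comb_def intro!: H.finprod_closed)

lemma pairing_comb:
  assumes k: "k \<in> J"
  shows "I (A_comb m) (\<beta> k) = m k" "I (\<alpha> k) (B_comb m) = m k"
    "I (\<alpha> k) (A_comb m) = 0" "I (B_comb m) (\<beta> k) = 0"
proof -
  note c = \<alpha>_closed \<beta>_closed_J k
  have "I (A_comb m) (\<beta> k) = (\<Sum>j\<in>J. if j = k then m k else 0)"
    unfolding A_comb_def using c
    by (subst I_finprod_left) (auto simp: I_pow_left pairing_basis intro!: sum.cong)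
  then show "I (A_comb m) (\<beta> k) = m k" using k finite_J by simp
  have "I (\<alpha> k) (B_comb m) = (\<Sum>j\<in>J. if j = k then m k else 0)"
    unfolding B_comb_def using c
    by (subst I_finprod_right) (auto simp: I_pow_right pairing_basis intro!: sum.cong)
  then show "I (\<alpha> k) (B_comb m) = m k" using k finite_J by simp
  show "I (\<alpha> k) (A_comb m) = 0"
    unfolding A_comb_def using c
    by (subst I_finprod_right) (auto simp: I_pow_right pairing_basis intro!: sum.neutral)
  show "I (B_comb m) (\<beta> k) = 0"
    unfolding B_comb_def using c
    by (subst I_finprod_left) (auto simp: I_pow_left pairing_basis intro!: sum.neutral)
qed

lemma comb_hom:
  "A_comb (\<lambda>j. m j + n j) = A_comb m \<otimes>\<^bsub>H\<^esub> A_comb n"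
  "B_comb (\<lambda>j. m j + n j) = B_comb m \<otimes>\<^bsub>H\<^esub> B_comb n"
proof -
  have "A_comb (\<lambda>j. m j + n j) = finprod H (\<lambda>j. \<alpha> j [^]\<^bsub>H\<^esub> m j \<otimes>\<^bsub>H\<^esub> \<alpha> j [^]\<^bsub>H\<^esub> n j) J"
    unfolding A_comb_def using \<alpha>_closed by (intro H.finprod_cong') (auto simp: H.int_pow_mult)
  then show "A_comb (\<lambda>j. m j + n j) = A_comb m \<otimes>\<^bsub>H\<^esub> A_comb n"
    unfolding A_comb_def using \<alpha>_closed by (simp add: H.finprod_multf Pi_iff)
  have "B_comb (\<lambda>j. m j + n j) = finprod H (\<lambda>j. \<beta> j [^]\<^bsub>H\<^esub> m j \<otimes>\<^bsub>H\<^esub> \<beta> j [^]\<^bsub>H\<^esub> n j) J"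
    unfolding B_comb_def using \<beta>_closed_J by (intro H.finprod_cong') (auto simp: H.int_pow_mult)
  then show "B_comb (\<lambda>j. m j + n j) = B_comb m \<otimes>\<^bsub>H\<^esub> B_comb n"
    unfolding B_comb_def using \<beta>_closed_J by (simp add: H.finprod_multf Pi_iff)
qed

lemma comb_zero: "A_comb (\<lambda>j. 0) = \<one>\<^bsub>H\<^esub>" "B_comb (\<lambda>j. 0) = \<one>\<^bsub>H\<^esub>"
  by (simp_all add: A_comb_def B_comb_def)

lemma comb_cong:
  assumes "\<And>j. j \<in> J \<Longrightarrow> m j = n j"
  shows "A_comb m = A_comb n" "B_comb m = B_comb n"
  unfolding A_comb_def B_comb_def using assms \<alpha>_closed \<beta>_closed_J by (auto intro!: H.finprod_cong')

lemma comb_delta: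
  assumes k: "k \<in> J"
  shows "A_comb (\<lambda>j. if j = k then 1 else 0) = \<alpha> k" "B_comb (\<lambda>j. if j = k then 1 else 0) = \<beta> k"
proof -
  have "A_comb (\<lambda>j. if j = k then 1 else 0) = finprod H (\<lambda>j. if k = j then \<alpha> j else \<one>\<^bsub>H\<^esub>) J"
    unfolding A_comb_def using \<alpha>_closed by (intro H.finprod_cong') auto
  also have "\<dots> = \<alpha> k" using k finite_J \<alpha>_closed by (intro H.finprod_singleton) auto
  finally show "A_comb (\<lambda>j. if j = k then 1 else 0) = \<alpha> k" .
  have "B_comb (\<lambda>j. if j = k then 1 else 0) = finprod H (\<lambda>j. if k = j then \<beta> j else \<one>\<^bsub>H\<^esub>) J"
    unfolding B_comb_def using \<beta>_closed_J by (intro H.finprod_cong') auto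
  also have "\<dots> = \<beta> k" using k finite_J \<beta>_closed_J by (intro H.finprod_singleton) auto
  finally show "B_comb (\<lambda>j. if j = k then 1 else 0) = \<beta> k" .
qed

lemma decomposition:
  assumes x: "x \<in> carrier H"
  shows "x = A_comb (\<lambda>j. I x (\<beta> j)) \<otimes>\<^bsub>H\<^esub> B_comb (\<lambda>j. I (\<alpha> j) x)"
proof -
  define D where "D x = A_comb (\<lambda>j. I x (\<beta> j)) \<otimes>\<^bsub>H\<^esub> B_comb (\<lambda>j. I (\<alpha> j) x)" for x
  have hom: "D \<in> hom H H"
  proof (rule homI)
    fix x y assume xy: "x \<in> carrier H" "y \<in> carrier H"
    have "D (x \<otimes>\<^bsub>H\<^esub> y) = A_comb (\<lambda>j. I x (\<beta> j) + I y (\<beta> j)) \<otimes>\<^bsub>H\<^esub> B_comb (\<lambda>j. I (\<alpha> j) x + I (\<alpha> j) y)"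
      unfolding D_def using xy \<alpha>_closed \<beta>_closed_J
      by (intro arg_cong2[of _ _ _ _ "(\<otimes>\<^bsub>H\<^esub>)"] comb_cong) (simp_all add: I_left I_right)
    also have "\<dots> = D x \<otimes>\<^bsub>H\<^esub> D y"
      unfolding D_def comb_hom using comb_closed by (simp add: H.m_ac)
    finally show "D (x \<otimes>\<^bsub>H\<^esub> y) = D x \<otimes>\<^bsub>H\<^esub> D y" .
  qed (simp add: D_def comb_closed)
  interpret D: group_hom H H D using hom by unfold_locales
  have sub: "subgroup {x \<in> carrier H. D x = x} H"
  proof (rule H.subgroupI)
    show "{x \<in> carrier H. D x = x} \<noteq> {}" using D.hom_one by force
  qed auto
  have D\<alpha>: "D (\<alpha> k) = \<alpha> k" if k: "k \<in> J" for k
  proof -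
    have "D (\<alpha> k) = A_comb (\<lambda>j. if j = k then 1 else 0) \<otimes>\<^bsub>H\<^esub> B_comb (\<lambda>j. 0)"
      unfolding D_def using k by (intro arg_cong2[of _ _ _ _ "(\<otimes>\<^bsub>H\<^esub>)"] comb_cong) (simp_all add: pairing_basis)
    then show ?thesis using k \<alpha>_closed by (simp add: comb_delta comb_zero)
  qed
  have D\<beta>: "D (\<beta> k) = \<beta> k" if k: "k \<in> J" for k
  proof -
    have "D (\<beta> k) = A_comb (\<lambda>j. 0) \<otimes>\<^bsub>H\<^esub> B_comb (\<lambda>j. if j = k then 1 else 0)"
      unfolding D_def using k by (intro arg_cong2[of _ _ _ _ "(\<otimes>\<^bsub>H\<^esub>)"] comb_cong) (simp_all add: pairing_basis)
    then show ?thesis using k \<beta>_closed_J by (simp add: comb_delta comb_zero)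
  qed
  have "x \<in> {x \<in> carrier H. D x = x}"
    by (rule H_induct[OF sub _ _ x]) (use D\<alpha> D\<beta> \<alpha>_closed \<beta>_closed_J in auto)
  then show ?thesis by (simp add: D_def)
qed

subsection \<open>Cycles\<close>

text \<open>
  The projection of the homology of the surface to that of the graph, with kernel \<open>Y\<close>; it maps
  \<open>\<alpha> \<epsilon>\<close> to the fundamental cycle of \<open>\<epsilon>\<close>.
\<close>

definition cyc :: "'h \<Rightarrow> 'e \<Rightarrow> int" where
  "cyc x = (\<lambda>e. if e \<in> arcs G then I x (\<beta> e) else 0)"

lemma cyc_flow: "x \<in> carrier H \<Longrightarrow> cyc x \<in> flows G"
  unfolding cyc_def by (rule kirchhoff)

lemma cyc_mult: "x \<in> carrier H \<Longrightarrow> y \<in> carrier H \<Longrightarrow> cyc (x \<otimes>\<^bsub>H\<^esub> y) = (\<lambda>e. cyc x e + cyc y e)"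
  using \<beta>_closed by (auto simp: cyc_def I_left)

lemma flow_eqI:
  fixes c d :: "'e \<Rightarrow> 'r::comm_ring_1"
  assumes "c \<in> flows G" "d \<in> flows G" "\<And>j. j \<in> J \<Longrightarrow> c j = d j"
  shows "c = d"
proof
  fix e
  have "c e = 0" "d e = 0" if "e \<notin> arcs G" for e using assms(1,2) that by (auto simp: flows_def)
  then have "c e - d e = 0" if "e \<notin> arcs T" for e
    using that assms(3) by (cases "e \<in> arcs G") (auto simp: J_def)
  then have "c e - d e = 0"
    using flow_on_forest_eq_0[OF fin tree flows_diff[OF assms(1,2)], of e] by blast
  then show "c e = d e" by simp
qed

lemma cyc_J: "j \<in> J \<Longrightarrow> cyc x j = I x (\<beta> j)"
  using J_arcs by (auto simp: cyc_def)

lemma cyc_surj: "c \<in> flows G \<Longrightarrow> cyc (A_comb c) = c"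
  by (rule flow_eqI) (auto simp: cyc_flow comb_closed cyc_J pairing_comb)

text \<open>
  Uniqueness of the fundamental cycle holds because a tree carries no flow; existence is supplied by
  the surface, as the intersection numbers with \<open>\<alpha> \<epsilon>\<close> form a flow.
\<close>

lemma fundamental_cycle_eq:
  assumes \<epsilon>: "\<epsilon> \<in> J"
  shows "fundamental_cycle G T \<epsilon> = cyc (\<alpha> \<epsilon>)"
  unfolding fundamental_cycle_def
proof (rule the_equality)
  have *: "cyc (\<alpha> \<epsilon>) j = (if \<epsilon> = j then 1 else 0)" if "j \<in> J" for j
    using that \<epsilon> by (simp add: cyc_J pairing_basis)
  show "cyc (\<alpha> \<epsilon>) \<in> flows G \<and> cyc (\<alpha> \<epsilon>) \<epsilon> = 1 \<and> (\<forall>e. e \<notin> insert \<epsilon> (arcs T) \<longrightarrow> cyc (\<alpha> \<epsilon>) e = 0)"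
  proof (intro conjI allI impI)
    fix e assume "e \<notin> insert \<epsilon> (arcs T)"
    then show "cyc (\<alpha> \<epsilon>) e = 0" using * by (cases "e \<in> arcs G") (auto simp: J_def cyc_def)
  qed (use * \<epsilon> \<alpha>_closed cyc_flow in auto)
  fix c :: "'e \<Rightarrow> int" assume c: "c \<in> flows G \<and> c \<epsilon> = 1 \<and> (\<forall>e. e \<notin> insert \<epsilon> (arcs T) \<longrightarrow> c e = 0)"
  show "c = cyc (\<alpha> \<epsilon>)"
  proof (rule flow_eqI)
    fix j assume "j \<in> J"
    then show "c j = cyc (\<alpha> \<epsilon>) j" using * c by (cases "j = \<epsilon>") (auto simp: J_def)
  qed (use c \<epsilon> \<alpha>_closed cyc_flow in auto)
qed

lemma flow_expansion:
  fixes \<omega> :: "'e \<Rightarrow> real"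
  assumes "\<omega> \<in> flows G"
  shows "\<omega> = (\<lambda>e. \<Sum>j\<in>J. \<omega> j * real_cycle (cyc (\<alpha> j)) e)"
proof (rule flow_eqI[OF assms])
  show "(\<lambda>e. \<Sum>j\<in>J. \<omega> j * real_cycle (cyc (\<alpha> j)) e) \<in> flows G"
    by (rule flows_sum) (simp add: flows_real_cycle cyc_flow \<alpha>_closed)
  fix k assume k: "k \<in> J"
  have "(\<Sum>j\<in>J. \<omega> j * real_cycle (cyc (\<alpha> j)) k) = (\<Sum>j\<in>J. if j = k then \<omega> k else 0)"
    using k by (intro sum.cong refl) (auto simp: cyc_J pairing_basis)
  then show "\<omega> k = (\<Sum>j\<in>J. \<omega> j * real_cycle (cyc (\<alpha> j)) k)" using k finite_J by simp
qed

text \<open>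
  The flow of \<open>\<beta> j\<close>, for a basis element, vanishes off the tree, hence everywhere. By
  skew symmetry the flow of every \<open>\<beta> e\<close> vanishes off the tree.
\<close>

lemma cyc_\<beta>:
  assumes e: "e \<in> arcs G" shows "cyc (\<beta> e) = (\<lambda>e. 0)"
proof -
  have J0: "cyc (\<beta> j) = (\<lambda>e. 0)" if j: "j \<in> J" for j
    by (rule flow_eqI) (use j \<beta>_closed_J flows_0 in \<open>auto simp: cyc_flow cyc_J pairing_basis\<close>)
  show ?thesis
  proof (rule flow_eqI)
    fix j assume j: "j \<in> J"
    have "I (\<beta> j) (\<beta> e) = 0" using fun_cong[OF J0[OF j], of e] e by (simp add: cyc_def)
    then show "cyc (\<beta> e) j = 0" using I_skew[of "\<beta> e" "\<beta> j"] j e \<beta>_closed \<beta>_closed_J by (simp add: cyc_J)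
  qed (use e \<beta>_closed cyc_flow flows_0 in auto)
qed

definition Y :: "'h set" where "Y = generate H (\<beta> ` arcs G)"

lemma subgroup_Y: "subgroup Y H"
  unfolding Y_def using \<beta>_closed by (intro H.generate_is_subgroup) auto

lemma Y_closed: "y \<in> Y \<Longrightarrow> y \<in> carrier H"
  using subgroup.mem_carrier[OF subgroup_Y] .

lemma \<beta>_in_Y: "e \<in> arcs G \<Longrightarrow> \<beta> e \<in> Y"
  unfolding Y_def by (rule generate.incl) simp

lemma B_comb_in_Y: "B_comb m \<in> Y"
  unfolding B_comb_def
  by (rule H.finprod_in_subgroup[OF subgroup_Y]) (use J_arcs \<beta>_in_Y H.subgroup_int_pow_closed[OF subgroup_Y] in blast)

lemma cyc_Y:
  assumes "y \<in> Y" shows "cyc y = (\<lambda>e. 0)"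
proof -
  have "I y (\<beta> e) = 0" if e: "e \<in> arcs G" for e
  proof -
    have "I y (\<beta> e) = \<one>\<^bsub>integer_group\<^esub>"
    proof (rule trivial_on_generate[OF hom_I_left[OF \<beta>_closed[OF e]]])
      fix a assume "a \<in> \<beta> ` arcs G"
      then show "I a (\<beta> e) = \<one>\<^bsub>integer_group\<^esub>" using fun_cong[OF cyc_\<beta>, of _ e] e by (auto simp: cyc_def)
    qed (use assms \<beta>_closed in \<open>auto simp: Y_def\<close>)
    then show ?thesis by simp
  qed
  then show ?thesis by (auto simp: cyc_def)
qed

lemma Y_eq_B_comb:
  assumes x: "x \<in> carrier H" and 0: "\<And>j. j \<in> J \<Longrightarrow> I x (\<beta> j) = 0"
  shows "x = B_comb (\<lambda>j. I (\<alpha> j) x)"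
proof -
  have "A_comb (\<lambda>j. I x (\<beta> j)) = \<one>\<^bsub>H\<^esub>" using comb_cong(1)[of "\<lambda>j. I x (\<beta> j)" "\<lambda>j. 0"] 0 comb_zero by simp
  then show ?thesis using decomposition[OF x] comb_closed by simp
qed

lemma in_Y_iff: "x \<in> carrier H \<Longrightarrow> x \<in> Y \<longleftrightarrow> (\<forall>j\<in>J. I x (\<beta> j) = 0)"
  using Y_eq_B_comb B_comb_in_Y cyc_Y cyc_J by metis

lemma Y_induct:
  assumes L: "subgroup L H" and "\<And>j. j \<in> J \<Longrightarrow> \<beta> j \<in> L" and y: "y \<in> Y"
  shows "y \<in> L"
proof -
  have "y = B_comb (\<lambda>j. I (\<alpha> j) y)" using y in_Y_iff Y_closed Y_eq_B_comb by blast
  also have "\<dots> \<in> L"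
    unfolding B_comb_def by (rule H.finprod_in_subgroup[OF L]) (use assms H.subgroup_int_pow_closed[OF L] in blast)
  finally show ?thesis .
qed

subsection \<open>The dual of the forms\<close>

text \<open>
  The second projection, to the dual of the forms: it kills each \<open>\<alpha> j\<close> and extends the map
  \<open>\<beta> e \<mapsto> b\<^sub>e\<close> on \<open>Y\<close>.
\<close>

definition form :: "'h \<Rightarrow> ('e \<Rightarrow> real) \<Rightarrow> real" where
  "form y = (\<lambda>\<omega>\<in>flows G. \<Sum>j\<in>J. real_of_int (I (\<alpha> j) y) * \<omega> j)"

lemma form_closed: "form y \<in> carrier (forms_dual G)"
  unfolding form_def by (rule forms_dualI) (simp_all add: algebra_simps sum.distrib sum_distrib_left)

lemma form_apply: "\<omega> \<in> flows G \<Longrightarrow> form y \<omega> = (\<Sum>j\<in>J. real_of_int (I (\<alpha> j) y) * \<omega> j)"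
  by (simp add: form_def)

lemma form_mult:
  assumes "x \<in> carrier H" "y \<in> carrier H"
  shows "form (x \<otimes>\<^bsub>H\<^esub> y) = form x \<otimes>\<^bsub>forms_dual G\<^esub> form y"
proof (rule forms_dual_eqI[of _ G])
  fix \<omega> :: "'e \<Rightarrow> real" assume \<omega>: "\<omega> \<in> flows G"
  have "form (x \<otimes>\<^bsub>H\<^esub> y) \<omega> = (\<Sum>j\<in>J. real_of_int (I (\<alpha> j) x) * \<omega> j + real_of_int (I (\<alpha> j) y) * \<omega> j)"
    unfolding form_apply[OF \<omega>] using assms \<alpha>_closed by (intro sum.cong refl) (simp add: I_right algebra_simps)
  then show "form (x \<otimes>\<^bsub>H\<^esub> y) \<omega> = (form x \<otimes>\<^bsub>forms_dual G\<^esub> form y) \<omega>"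
    using \<omega> by (simp add: forms_dual_mult form_apply sum.distrib)
qed (simp_all add: form_closed forms_dual_closed)

text \<open>
  Evaluated at a form, this is the expansion of the form in the fundamental cycles, read at \<open>e\<close>.
\<close>

lemma form_\<beta>:
  assumes e: "e \<in> arcs G" shows "form (\<beta> e) = edge_form G e"
proof (rule forms_dual_eqI[of _ G])
  fix \<omega> :: "'e \<Rightarrow> real" assume \<omega>: "\<omega> \<in> flows G"
  have "\<omega> e = (\<Sum>j\<in>J. \<omega> j * real_of_int (cyc (\<alpha> j) e))"
    using fun_cong[OF flow_expansion[OF \<omega>], of e] by simp
  then show "form (\<beta> e) \<omega> = edge_form G e \<omega>"
    using \<omega> e by (simp add: form_apply edge_form_def cyc_def mult.commute)
qed (simp_all add: form_closed edge_form_in_forms_dual)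

lemma form_\<alpha>:
  assumes k: "k \<in> J" shows "form (\<alpha> k) = \<one>\<^bsub>forms_dual G\<^esub>"
proof -
  interpret V: comm_group "forms_dual G" by (rule comm_group_forms_dual)
  show ?thesis
    by (rule forms_dual_eqI[of _ G])
      (use k in \<open>simp_all add: form_closed forms_dual_mult form_apply pairing_basis\<close>)
qed

lemma form_B_comb: "\<omega> \<in> flows G \<Longrightarrow> form (B_comb m) \<omega> = (\<Sum>j\<in>J. real_of_int (m j) * \<omega> j)"
  by (simp add: form_apply pairing_comb)

lemma forms_dual_expansion:
  assumes \<phi>: "\<phi> \<in> carrier (forms_dual G)" and \<omega>: "\<omega> \<in> flows G"
  shows "\<phi> \<omega> = (\<Sum>j\<in>J. \<omega> j * \<phi> (real_cycle (cyc (\<alpha> j))))"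
proof -
  have "\<phi> \<omega> = \<phi> (\<lambda>e. \<Sum>j\<in>J. \<omega> j * real_cycle (cyc (\<alpha> j)) e)"
    using flow_expansion[OF \<omega>] by simp
  also have "\<dots> = (\<Sum>j\<in>J. \<omega> j * \<phi> (real_cycle (cyc (\<alpha> j))))"
    by (rule forms_dual_sum[OF \<phi>]) (simp add: flows_real_cycle cyc_flow \<alpha>_closed)
  finally show ?thesis .
qed

lemma form_surj:
  assumes b: "b \<in> integral_forms_dual G"
  obtains y where "y \<in> Y" "form y = b"
proof -
  define m where "m j = \<lfloor>b (real_cycle (cyc (\<alpha> j)))\<rfloor>" for j
  have bV: "b \<in> carrier (forms_dual G)" using b by (simp add: integral_forms_dual_def)
  have m: "real_of_int (m j) = b (real_cycle (cyc (\<alpha> j)))" if "j \<in> J" for j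
    using b cyc_flow[OF \<alpha>_closed[OF that]] by (auto simp: m_def integral_forms_dual_def elim!: Ints_cases)
  have "form (B_comb m) = b"
  proof (rule forms_dual_eqI[of _ G])
    fix \<omega> :: "'e \<Rightarrow> real" assume \<omega>: "\<omega> \<in> flows G"
    show "form (B_comb m) \<omega> = b \<omega>"
      unfolding form_B_comb[OF \<omega>] forms_dual_expansion[OF bV \<omega>] by (intro sum.cong refl) (simp add: m)
  qed (simp_all add: form_closed bV)
  then show thesis using B_comb_in_Y that by blast
qed

lemma form_integral:
  assumes "y \<in> carrier H" shows "form y \<in> integral_forms_dual G"
  unfolding integral_forms_dual_def
  by (auto simp: form_closed form_apply flows_real_cycle)

end

context jacobian_comparison
begin

subsection \<open>The third exterior power of the homology of the surface\<close>

sublocale Hs: scaled_group H "int_scale H"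
proof
  fix n :: int show "(\<lambda>x. x [^]\<^bsub>H\<^esub> n) \<in> hom H H"
    by (rule homI) (simp_all add: H.int_pow_distrib)
qed

abbreviation "E \<equiv> ext3 H"
abbreviation "JH \<equiv> jac_homology21 G"
abbreviation "V \<equiv> forms_dual G"
abbreviation "w3 \<equiv> wedge3 H"
abbreviation "br x v w \<equiv> bracket G (cyc x) v w"

sublocale E: comm_group E
  unfolding ext3_def by (rule Hs.comm_group_exterior_power)

sublocale JH: comm_group JH
  by (rule comm_group_jac_homology21)

sublocale V: comm_group V
  by (rule comm_group_forms_dual)

lemmas w3_mult = Hs.wedge3(2-4)[folded wedge3_def ext3_def]
lemmas w3_alt = Hs.wedge3(5-7)[folded wedge3_def ext3_def]

lemma w3_in: "x \<in> carrier H \<Longrightarrow> y \<in> carrier H \<Longrightarrow> z \<in> carrier H \<Longrightarrow> w3 x y z \<in> carrier E"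
  by (rule Hs.wedge3(1)[folded wedge3_def ext3_def])

lemma w3_hom1: "y \<in> carrier H \<Longrightarrow> z \<in> carrier H \<Longrightarrow> (\<lambda>x. w3 x y z) \<in> hom H E"
  by (rule homI) (simp_all add: w3_in w3_mult)

lemma w3_hom2: "x \<in> carrier H \<Longrightarrow> z \<in> carrier H \<Longrightarrow> (\<lambda>y. w3 x y z) \<in> hom H E"
  by (rule homI) (simp_all add: w3_in w3_mult)

lemma w3_hom3: "x \<in> carrier H \<Longrightarrow> y \<in> carrier H \<Longrightarrow> w3 x y \<in> hom H E"
  by (rule homI) (simp_all add: w3_in w3_mult)

lemma w3_alt': "x \<in> carrier H \<Longrightarrow> y \<in> carrier H \<Longrightarrow> w3 x x y = \<one>\<^bsub>E\<^esub>"
  "x \<in> carrier H \<Longrightarrow> y \<in> carrier H \<Longrightarrow> w3 x y x = \<one>\<^bsub>E\<^esub>"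
  "x \<in> carrier H \<Longrightarrow> y \<in> carrier H \<Longrightarrow> w3 y x x = \<one>\<^bsub>E\<^esub>"
  by (simp_all add: w3_alt)

lemma w3_skew12:
  assumes "x \<in> carrier H" "y \<in> carrier H" "z \<in> carrier H"
  shows "w3 x y z = inv\<^bsub>E\<^esub> w3 y x z"
proof -
  have "w3 (x \<otimes>\<^bsub>H\<^esub> y) (x \<otimes>\<^bsub>H\<^esub> y) z = w3 x (x \<otimes>\<^bsub>H\<^esub> y) z \<otimes>\<^bsub>E\<^esub> w3 y (x \<otimes>\<^bsub>H\<^esub> y) z"
    using assms by (intro w3_mult) auto
  also have "\<dots> = w3 x y z \<otimes>\<^bsub>E\<^esub> w3 y x z"
    using assms by (simp add: w3_mult w3_alt' w3_in)
  finally have "w3 (x \<otimes>\<^bsub>H\<^esub> y) (x \<otimes>\<^bsub>H\<^esub> y) z = w3 x y z \<otimes>\<^bsub>E\<^esub> w3 y x z" .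
  then have "w3 x y z \<otimes>\<^bsub>E\<^esub> w3 y x z = \<one>\<^bsub>E\<^esub>" using assms by (simp add: w3_alt')
  then show ?thesis using assms by (simp add: E.inv_equality w3_in)
qed

lemma w3_skew23:
  assumes "x \<in> carrier H" "y \<in> carrier H" "z \<in> carrier H"
  shows "w3 z x y = inv\<^bsub>E\<^esub> w3 z y x"
proof -
  have "w3 z (x \<otimes>\<^bsub>H\<^esub> y) (x \<otimes>\<^bsub>H\<^esub> y) = w3 z x (x \<otimes>\<^bsub>H\<^esub> y) \<otimes>\<^bsub>E\<^esub> w3 z y (x \<otimes>\<^bsub>H\<^esub> y)"
    using assms by (intro w3_mult) auto
  also have "\<dots> = w3 z x y \<otimes>\<^bsub>E\<^esub> w3 z y x"
    using assms by (simp add: w3_mult w3_alt' w3_in)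
  finally have "w3 z (x \<otimes>\<^bsub>H\<^esub> y) (x \<otimes>\<^bsub>H\<^esub> y) = w3 z x y \<otimes>\<^bsub>E\<^esub> w3 z y x" .
  then have "w3 z x y \<otimes>\<^bsub>E\<^esub> w3 z y x = \<one>\<^bsub>E\<^esub>" using assms by (simp add: w3_alt')
  then show ?thesis using assms by (simp add: E.inv_equality w3_in)
qed

lemma E_induct:
  assumes "subgroup L E" "\<And>x y z. x \<in> carrier H \<Longrightarrow> y \<in> carrier H \<Longrightarrow> z \<in> carrier H \<Longrightarrow> w3 x y z \<in> L"
    and "x \<in> carrier E"
  shows "x \<in> L"
proof (rule Hs.exterior_induct[of L 3])
  fix xs assume "xs \<in> wedge_lists 3 H"
  then show "wedge (int_scale H) H xs \<in> L"
    using Hs.wedge_lists_3[of xs] assms(2) by (auto simp: wedge3_def)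
qed (use assms in \<open>simp_all add: ext3_def\<close>)

subsection \<open>The comparison homomorphism\<close>

lemma br_closed: "x \<in> carrier H \<Longrightarrow> v \<in> carrier V \<Longrightarrow> w \<in> carrier V \<Longrightarrow> br x v w \<in> carrier JH"
  by (rule bracket_closed[OF cyc_flow])

lemma br_mult1:
  "x \<in> carrier H \<Longrightarrow> y \<in> carrier H \<Longrightarrow> v \<in> carrier V \<Longrightarrow> w \<in> carrier V \<Longrightarrow>
    br (x \<otimes>\<^bsub>H\<^esub> y) v w = br x v w \<otimes>\<^bsub>JH\<^esub> br y v w"
  by (simp add: cyc_mult bracket_add1 cyc_flow)

lemmas br_mult2 = bracket_mult2[OF cyc_flow]
lemmas br_mult3 = bracket_mult3[OF cyc_flow]

lemma br_Y: "y \<in> Y \<Longrightarrow> v \<in> carrier V \<Longrightarrow> w \<in> carrier V \<Longrightarrow> br y v w = \<one>\<^bsub>JH\<^esub>"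
  by (simp add: cyc_Y bracket_zero)

lemma br_same: "x \<in> carrier H \<Longrightarrow> v \<in> carrier V \<Longrightarrow> br x v v = \<one>\<^bsub>JH\<^esub>"
  by (rule bracket_same[OF cyc_flow])

lemma br_one2:
  assumes "x \<in> carrier H" "w \<in> carrier V" shows "br x \<one>\<^bsub>V\<^esub> w = \<one>\<^bsub>JH\<^esub>"
proof -
  have "br x \<one>\<^bsub>V\<^esub> w = br x \<one>\<^bsub>V\<^esub> w \<otimes>\<^bsub>JH\<^esub> br x \<one>\<^bsub>V\<^esub> w"
    using br_mult2[OF assms(1) V.one_closed V.one_closed assms(2)] by simp
  then show ?thesis using br_closed[OF assms(1) V.one_closed assms(2)] by (metis JH.l_cancel_one)
qed

lemma br_skew:
  assumes "x \<in> carrier H" "v \<in> carrier V" "w \<in> carrier V"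
  shows "br x v w = inv\<^bsub>JH\<^esub> br x w v"
  using bracket_skew[OF cyc_flow[OF assms(1)] assms(2,3)] assms
  by (simp add: JH.inv_equality br_closed)

text \<open>
  Apply \<open>cyc\<close> to one factor and \<open>form\<close> to the other two, in the three possible cyclic orders. Being
  trilinear and alternating on all of \<open>H\<close>, this defines a homomorphism on the whole third exterior
  power, by its universal property, and no presentation of \<open>H \<and> Y \<and> Y\<close> has to be found.
\<close>

definition contraction :: "'h \<Rightarrow> 'h \<Rightarrow> 'h \<Rightarrow> (('e \<Rightarrow> real) \<times> ((('e \<Rightarrow> real) \<Rightarrow> real) list \<Rightarrow>\<^sub>0 int) set \<Rightarrow>\<^sub>0 int) set" where
  "contraction x y z = br x (form y) (form z) \<otimes>\<^bsub>JH\<^esub> br y (form z) (form x) \<otimes>\<^bsub>JH\<^esub> br z (form x) (form y)"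

lemma contraction_hom:
  assumes "y \<in> carrier H" "z \<in> carrier H"
  shows "(\<lambda>x. contraction x y z) \<in> hom H JH" "(\<lambda>x. contraction y x z) \<in> hom H JH" "contraction y z \<in> hom H JH"
  using assms
  by (auto intro!: homI simp: contraction_def br_closed br_mult1 br_mult2 br_mult3 form_mult form_closed JH.m_ac)

lemma contraction_pow:
  assumes "x \<in> carrier H" "y \<in> carrier H" "z \<in> carrier H"
  shows "contraction (x [^]\<^bsub>H\<^esub> (n::int)) y z = contraction x y z [^]\<^bsub>JH\<^esub> n"
    "contraction y (x [^]\<^bsub>H\<^esub> (n::int)) z = contraction y x z [^]\<^bsub>JH\<^esub> n"
    "contraction y z (x [^]\<^bsub>H\<^esub> (n::int)) = contraction y z x [^]\<^bsub>JH\<^esub> n"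
  using hom_int_pow[OF contraction_hom(1)[OF assms(2,3)] assms(1)]
    hom_int_pow[OF contraction_hom(2)[OF assms(2,3)] assms(1)]
    hom_int_pow[OF contraction_hom(3)[OF assms(2,3)] assms(1)] H.is_group JH.is_group by simp_all

definition Psi where
  "Psi = (SOME h. h \<in> hom E JH \<and>
     (\<forall>x\<in>carrier H. \<forall>y\<in>carrier H. \<forall>z\<in>carrier H. h (w3 x y z) = contraction x y z))"

lemma Psi: "Psi \<in> hom E JH"
  and Psi_w3: "x \<in> carrier H \<Longrightarrow> y \<in> carrier H \<Longrightarrow> z \<in> carrier H \<Longrightarrow> Psi (w3 x y z) = contraction x y z"
proof -
  have alt: "contraction x x y = \<one>\<^bsub>JH\<^esub>" "contraction x y x = \<one>\<^bsub>JH\<^esub>" "contraction y x x = \<one>\<^bsub>JH\<^esub>"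
    if "x \<in> carrier H" "y \<in> carrier H" for x y
    using that br_skew[of x "form x" "form y"]
    by (simp_all add: contraction_def br_same br_closed form_closed)
  have "\<exists>h\<in>hom E JH. \<forall>x\<in>carrier H. \<forall>y\<in>carrier H. \<forall>z\<in>carrier H. h (w3 x y z) = contraction x y z"
    unfolding ext3_def wedge3_def
    by (rule Hs.exterior_lift3[OF JH.comm_group_axioms])
      (simp_all add: hom_in_carrier[OF contraction_hom(1)] hom_mult[OF contraction_hom(1)]
        hom_mult[OF contraction_hom(2)] hom_mult[OF contraction_hom(3)] contraction_pow alt)
  then have "\<exists>h. h \<in> hom E JH \<and> (\<forall>x\<in>carrier H. \<forall>y\<in>carrier H. \<forall>z\<in>carrier H. h (w3 x y z) = contraction x y z)"
    by blast
  from someI_ex[OF this] have "Psi \<in> hom E JH \<and>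
      (\<forall>x\<in>carrier H. \<forall>y\<in>carrier H. \<forall>z\<in>carrier H. Psi (w3 x y z) = contraction x y z)"
    unfolding Psi_def .
  then show "Psi \<in> hom E JH"
    "x \<in> carrier H \<Longrightarrow> y \<in> carrier H \<Longrightarrow> z \<in> carrier H \<Longrightarrow> Psi (w3 x y z) = contraction x y z" by blast+
qed

sublocale Psi: group_hom E JH Psi
  using Psi by unfold_locales

lemma contraction_HYY:
  assumes "x \<in> carrier H" "y \<in> Y" "z \<in> Y"
  shows "contraction x y z = br x (form y) (form z)"
  using assms by (simp add: contraction_def br_Y form_closed br_closed)

lemma contraction_HHY:
  assumes "x \<in> carrier H" "y \<in> carrier H" "z \<in> Y"
  shows "contraction x y z = br x (form y) (form z) \<otimes>\<^bsub>JH\<^esub> br y (form z) (form x)"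
  using assms by (simp add: contraction_def br_Y form_closed br_closed)

lemma contraction_YYY:
  assumes "x \<in> Y" "y \<in> Y" "z \<in> Y" shows "contraction x y z = \<one>\<^bsub>JH\<^esub>"
  using assms Y_closed by (simp add: contraction_HYY br_Y form_closed)

subsection \<open>The products with the symplectic form and with the polarization\<close>

definition omega_top :: "'h \<Rightarrow> ('h list \<Rightarrow>\<^sub>0 int) set" where
  "omega_top h = finprod E (\<lambda>j. w3 (\<alpha> j) (\<beta> j) h) J"

definition omega_jac :: "(('e \<Rightarrow> real) \<Rightarrow> real) \<Rightarrow> (('e \<Rightarrow> real) \<times> ((('e \<Rightarrow> real) \<Rightarrow> real) list \<Rightarrow>\<^sub>0 int) set \<Rightarrow>\<^sub>0 int) set" where
  "omega_jac v = finprod JH (\<lambda>j. br (\<alpha> j) (form (\<beta> j)) v) J"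

lemma omega_top_hom: "omega_top \<in> hom H E"
proof (rule homI)
  fix x y assume xy: "x \<in> carrier H" "y \<in> carrier H"
  note c = \<alpha>_closed \<beta>_closed_J xy
  have "omega_top (x \<otimes>\<^bsub>H\<^esub> y) = finprod E (\<lambda>j. w3 (\<alpha> j) (\<beta> j) x \<otimes>\<^bsub>E\<^esub> w3 (\<alpha> j) (\<beta> j) y) J"
    unfolding omega_top_def using c by (intro E.finprod_cong') (auto simp: w3_mult w3_in)
  then show "omega_top (x \<otimes>\<^bsub>H\<^esub> y) = omega_top x \<otimes>\<^bsub>E\<^esub> omega_top y"
    unfolding omega_top_def using c by (simp add: E.finprod_multf Pi_iff w3_in)
qed (auto simp: omega_top_def w3_in \<alpha>_closed \<beta>_closed_J)

lemma omega_jac_hom: "omega_jac \<in> hom V JH"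
proof (rule homI)
  fix x y assume xy: "x \<in> carrier V" "y \<in> carrier V"
  note c = \<alpha>_closed form_closed xy
  have "omega_jac (x \<otimes>\<^bsub>V\<^esub> y) = finprod JH (\<lambda>j. br (\<alpha> j) (form (\<beta> j)) x \<otimes>\<^bsub>JH\<^esub> br (\<alpha> j) (form (\<beta> j)) y) J"
    unfolding omega_jac_def using c by (intro JH.finprod_cong') (auto simp: br_mult3 br_closed)
  then show "omega_jac (x \<otimes>\<^bsub>V\<^esub> y) = omega_jac x \<otimes>\<^bsub>JH\<^esub> omega_jac y"
    unfolding omega_jac_def using c by (simp add: JH.finprod_multf Pi_iff br_closed)
qed (auto simp: omega_jac_def br_closed \<alpha>_closed form_closed)

text \<open>
  Since \<open>cyc\<close> kills each \<open>\<beta> j\<close> and \<open>form\<close> kills each \<open>\<alpha> j\<close>, the class \<open>h\<close> only contributes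
  through its form. This holds also for \<open>h\<close> outside \<open>Y\<close>, which spares the computation of the
  intersection of \<open>\<omega> \<and> H\<close> with \<open>H \<and> Y \<and> Y\<close>.
\<close>

lemma Psi_omega:
  assumes h: "h \<in> carrier H" shows "Psi (omega_top h) = omega_jac (form h)"
proof -
  note c = \<alpha>_closed \<beta>_closed_J h
  have "Psi (omega_top h) = finprod JH (\<lambda>j. Psi (w3 (\<alpha> j) (\<beta> j) h)) J"
    unfolding omega_top_def using c
    by (intro hom_finprod[OF Psi E.comm_group_axioms JH.comm_group_axioms]) (auto simp: w3_in)
  also have "\<dots> = omega_jac (form h)"
    unfolding omega_jac_def
  proof (rule JH.finprod_cong')
    fix j assume j: "j \<in> J"
    then have bY: "\<beta> j \<in> Y" using \<beta>_in_Y J_arcs by blast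
    show "Psi (w3 (\<alpha> j) (\<beta> j) h) = br (\<alpha> j) (form (\<beta> j)) (form h)"
      using j c bY by (simp add: Psi_w3 contraction_def br_Y form_closed br_closed form_\<alpha> br_one2)
  qed (use c form_closed in \<open>auto simp: br_closed\<close>)
  finally show ?thesis .
qed

lemma omega_wedge_eq: "omega_wedge H J \<alpha> \<beta> = omega_top ` carrier H"
  by (auto simp: omega_wedge_def omega_top_def)

lemma omega_wedge_dual_eq: "omega_wedge_dual G T = omega_jac ` carrier V"
proof -
  have "finprod JH (\<lambda>\<epsilon>. bracket G (fundamental_cycle G T \<epsilon>) (edge_form G \<epsilon>) v) J = omega_jac v"
    if "v \<in> carrier V" for v
    unfolding omega_jac_def
    using that J_arcs
    by (intro JH.finprod_cong') (auto simp: fundamental_cycle_eq form_\<beta> br_closed \<alpha>_closed edge_form_in_forms_dual)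
  then show ?thesis by (auto simp: omega_wedge_dual_def J_def[symmetric])
qed

subsection \<open>Coordinates\<close>

abbreviation "real_cyc j \<equiv> real_cycle (cyc (\<alpha> j))"

definition coord :: "'e \<Rightarrow> 'e \<Rightarrow> 'e \<Rightarrow> (('e \<Rightarrow> real) \<times> ((('e \<Rightarrow> real) \<Rightarrow> real) list \<Rightarrow>\<^sub>0 int) set \<Rightarrow>\<^sub>0 int) set \<Rightarrow> real" where
  "coord i j k = (SOME \<theta>. \<theta> \<in> hom JH real_group \<and> (\<forall>c\<in>flows G. \<forall>v\<in>carrier V. \<forall>w\<in>carrier V.
     \<theta> (bracket G c v w) = real_of_int (c i) *
       (v (real_cyc j) * w (real_cyc k) - v (real_cyc k) * w (real_cyc j))))"

lemma real_cyc_flow: "j \<in> J \<Longrightarrow> real_cyc j \<in> flows G"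
  by (simp add: flows_real_cycle cyc_flow \<alpha>_closed)

lemma coord:
  assumes "j \<in> J" "k \<in> J"
  shows coord_hom: "coord i j k \<in> hom JH real_group"
    and coord_bracket: "c \<in> flows G \<Longrightarrow> v \<in> carrier V \<Longrightarrow> w \<in> carrier V \<Longrightarrow>
      coord i j k (bracket G c v w) = real_of_int (c i) *
       (v (real_cyc j) * w (real_cyc k) - v (real_cyc k) * w (real_cyc j))"
proof -
  obtain \<theta> where \<theta>: "\<theta> \<in> hom JH real_group"
    "\<And>c v w. c \<in> flows G \<Longrightarrow> v \<in> carrier V \<Longrightarrow> w \<in> carrier V \<Longrightarrow>
       \<theta> (bracket G c v w) = real_of_int (c i) *
       (v (real_cyc j) * w (real_cyc k) - v (real_cyc k) * w (real_cyc j))"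
    using jac_coordinate_exists[OF real_cyc_flow[OF assms(1)] real_cyc_flow[OF assms(2)], of i] by blast
  then have "\<exists>\<theta>. \<theta> \<in> hom JH real_group \<and> (\<forall>c\<in>flows G. \<forall>v\<in>carrier V. \<forall>w\<in>carrier V.
     \<theta> (bracket G c v w) = real_of_int (c i) *
       (v (real_cyc j) * w (real_cyc k) - v (real_cyc k) * w (real_cyc j)))" by blast
  from someI_ex[OF this] have c: "coord i j k \<in> hom JH real_group \<and> (\<forall>c\<in>flows G. \<forall>v\<in>carrier V. \<forall>w\<in>carrier V.
     coord i j k (bracket G c v w) = real_of_int (c i) *
       (v (real_cyc j) * w (real_cyc k) - v (real_cyc k) * w (real_cyc j)))"
    unfolding coord_def .
  then show "coord i j k \<in> hom JH real_group" by blast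
  show "c \<in> flows G \<Longrightarrow> v \<in> carrier V \<Longrightarrow> w \<in> carrier V \<Longrightarrow>
      coord i j k (bracket G c v w) = real_of_int (c i) *
       (v (real_cyc j) * w (real_cyc k) - v (real_cyc k) * w (real_cyc j))" using c by blast
qed

lemma form_real_cyc:
  assumes k: "k \<in> J" shows "form y (real_cyc k) = real_of_int (I (\<alpha> k) y)"
proof -
  have "form y (real_cyc k) = (\<Sum>j\<in>J. if j = k then real_of_int (I (\<alpha> k) y) else 0)"
    unfolding form_apply[OF real_cyc_flow[OF k]]
    using k by (intro sum.cong refl) (auto simp: cyc_J pairing_basis)
  then show ?thesis using k finite_J by simp
qed

lemma coord_br:
  assumes "i \<in> J" "j \<in> J" "k \<in> J" "x \<in> carrier H"
  shows "coord i j k (br x (form y) (form z)) = real_of_int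
    (I x (\<beta> i) * (I (\<alpha> j) y * I (\<alpha> k) z - I (\<alpha> k) y * I (\<alpha> j) z))"
  using assms by (simp add: coord_bracket cyc_flow form_closed form_real_cyc cyc_J)

lemma coord_mult:
  assumes "j \<in> J" "k \<in> J" "x \<in> carrier JH" "y \<in> carrier JH"
  shows "coord i j k (x \<otimes>\<^bsub>JH\<^esub> y) = coord i j k x + coord i j k y"
  using hom_mult[OF coord_hom[OF assms(1,2)] assms(3,4)] by simp

lemma coord_inv:
  assumes "j \<in> J" "k \<in> J" "x \<in> carrier JH"
  shows "coord i j k (inv\<^bsub>JH\<^esub> x) = - coord i j k x"
proof -
  have "coord i j k (x \<otimes>\<^bsub>JH\<^esub> inv\<^bsub>JH\<^esub> x) = 0"
    using hom_one[OF coord_hom[OF assms(1,2)] JH.is_group] comm_group_real_group assms(3)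
    by (simp add: comm_group_def)
  then show ?thesis using coord_mult[OF assms JH.inv_closed[OF assms(3)], of i] by linarith
qed

lemma coord_Psi_integral:
  assumes ijk: "i \<in> J" "j \<in> J" "k \<in> J" and x: "x \<in> carrier E"
  shows "coord i j k (Psi x) \<in> \<int>"
proof -
  have "subgroup {x \<in> carrier E. coord i j k (Psi x) \<in> \<int>} E"
  proof (rule E.subgroupI)
    have "coord i j k (Psi \<one>\<^bsub>E\<^esub>) = 0"
      using hom_one[OF coord_hom[OF ijk(2,3)] JH.is_group] comm_group_real_group by (simp add: comm_group_def)
    then show "{x \<in> carrier E. coord i j k (Psi x) \<in> \<int>} \<noteq> {}"
      by (metis (mono_tags, lifting) E.one_closed Ints_0 empty_iff mem_Collect_eq)
  qed (auto simp: coord_mult coord_inv ijk)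
  then have "x \<in> {x \<in> carrier E. coord i j k (Psi x) \<in> \<int>}"
    by (rule E_induct)
      (use x ijk in \<open>auto simp: w3_in Psi_w3 contraction_def br_closed form_closed coord_mult coord_br\<close>)
  then show ?thesis by simp
qed

lemma coord_omega:
  assumes ijk: "i \<in> J" "j \<in> J" "k \<in> J" and v: "v \<in> carrier V"
  shows "coord i j k (omega_jac v) =
    (if i = j then v (real_cyc k) else 0) - (if i = k then v (real_cyc j) else 0)"
proof -
  have "coord i j k (omega_jac v) = (\<Sum>l\<in>J. coord i j k (br (\<alpha> l) (form (\<beta> l)) v))"
    unfolding omega_jac_def
    using hom_finprod[OF coord_hom[OF ijk(2,3)] JH.comm_group_axioms comm_group_real_group,
        of "\<lambda>l. br (\<alpha> l) (form (\<beta> l)) v" J i] v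
    by (simp add: finprod_real_group br_closed \<alpha>_closed form_closed)
  also have "\<dots> = (\<Sum>l\<in>J. if l = i then (if i = j then v (real_cyc k) else 0) - (if i = k then v (real_cyc j) else 0) else 0)"
    using ijk v
    by (intro sum.cong refl)
      (auto simp: coord_bracket cyc_flow \<alpha>_closed form_closed form_real_cyc cyc_J pairing_basis)
  finally show ?thesis using ijk finite_J by simp
qed

end

lemma inv_real_group: "inv\<^bsub>real_group\<^esub> x = - x"
  by (rule group.inv_equality) (use comm_group_real_group in \<open>auto simp: comm_group_def\<close>)

lemma int_pow_real_group: "x [^]\<^bsub>real_group\<^esub> (n::int) = of_int n * x"
proof -
  have "x [^]\<^bsub>real_group\<^esub> (m::nat) = of_nat m * x" for m
    by (induction m) (simp_all add: monoid.nat_pow_0 nat_pow_def algebra_simps)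
  then show ?thesis by (simp add: int_pow_def2 inv_real_group)
qed

context jacobian_comparison
begin

section \<open>Dehn twists\<close>

lemma ext_map:
  assumes f: "f \<in> hom H H"
  shows ext_map_hom: "exterior_map (int_scale H) 3 H f \<in> hom E E"
    and ext_map_w3: "x \<in> carrier H \<Longrightarrow> y \<in> carrier H \<Longrightarrow> z \<in> carrier H \<Longrightarrow>
      exterior_map (int_scale H) 3 H f (w3 x y z) = w3 (f x) (f y) (f z)"
proof -
  have fsc: "f (x [^]\<^bsub>H\<^esub> r) = f x [^]\<^bsub>H\<^esub> r" if "x \<in> carrier H" for r :: int and x
    by (rule hom_int_pow[OF f that H.is_group H.is_group])
  show "exterior_map (int_scale H) 3 H f \<in> hom E E"
    unfolding ext3_def by (rule Hs.exterior_map(1)[OF f fsc])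
  show "x \<in> carrier H \<Longrightarrow> y \<in> carrier H \<Longrightarrow> z \<in> carrier H \<Longrightarrow>
      exterior_map (int_scale H) 3 H f (w3 x y z) = w3 (f x) (f y) (f z)"
    using Hs.exterior_map(2)[OF f fsc, of "[x, y, z]" 3] by (simp add: wedge3_def Hs.triple_in_wedge_lists)
qed

lemma coordinates_eqI:
  assumes "x \<in> carrier H" "y \<in> carrier H"
    and "\<And>j. j \<in> J \<Longrightarrow> I x (\<beta> j) = I y (\<beta> j)" "\<And>j. j \<in> J \<Longrightarrow> I (\<alpha> j) x = I (\<alpha> j) y"
  shows "x = y"
  using decomposition[OF assms(1)] decomposition[OF assms(2)]
    comb_cong(1)[of "\<lambda>j. I x (\<beta> j)" "\<lambda>j. I y (\<beta> j)"] comb_cong(2)[of "\<lambda>j. I (\<alpha> j) x" "\<lambda>j. I (\<alpha> j) y"]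
    assms(3,4) by metis

text \<open>
  The effect of a product of twists on the coordinates and on the symplectic form, where the twist
  along the curve of \<open>e\<close> occurs \<open>n e\<close> times. As the curves are orthogonal for the intersection
  pairing, the coordinates change additively under composition.
\<close>

definition twist_like :: "('h \<Rightarrow> 'h) \<Rightarrow> ('e \<Rightarrow> int) \<Rightarrow> bool" where
  "twist_like f n \<longleftrightarrow> f \<in> hom H H \<and>
     (\<forall>x\<in>carrier H. \<forall>e\<in>arcs G. I (f x) (\<beta> e) = I x (\<beta> e)) \<and>
     (\<forall>x\<in>carrier H. \<forall>j\<in>J. I (\<alpha> j) (f x) = I (\<alpha> j) x + (\<Sum>e\<in>arcs G. n e * I x (\<beta> e) * I (\<alpha> j) (\<beta> e))) \<and>
     (\<forall>h\<in>carrier H. finprod E (\<lambda>j. w3 (f (\<alpha> j)) (f (\<beta> j)) (f h)) J = omega_top (f h))"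

lemma twist_like_id: "twist_like id (\<lambda>e. 0)"
  by (simp add: twist_like_def omega_top_def hom_def)

lemma twist_like_comp:
  assumes f: "twist_like f n" and f': "twist_like f' n'"
  shows "twist_like (f \<circ> f') (\<lambda>e. n e + n' e)"
proof -
  have hom: "f \<in> hom H H" "f' \<in> hom H H" using f f' by (auto simp: twist_like_def)
  note cl = hom_in_carrier[OF hom(1)] hom_in_carrier[OF hom(2)]
  have "finprod E (\<lambda>j. w3 (f (f' (\<alpha> j))) (f (f' (\<beta> j))) (f (f' h))) J = omega_top (f (f' h))"
    if h: "h \<in> carrier H" for h
  proof -
    let ?F = "exterior_map (int_scale H) 3 H f"
    note c = \<alpha>_closed \<beta>_closed_J h cl
    have Ffin: "?F (finprod E (\<lambda>j. w3 (a j) (b j) x) J) = finprod E (\<lambda>j. w3 (f (a j)) (f (b j)) (f x)) J"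
      if "x \<in> carrier H" "\<And>j. j \<in> J \<Longrightarrow> a j \<in> carrier H" "\<And>j. j \<in> J \<Longrightarrow> b j \<in> carrier H" for a b x
    proof -
      have "?F (finprod E (\<lambda>j. w3 (a j) (b j) x) J) = finprod E (\<lambda>j. ?F (w3 (a j) (b j) x)) J"
        using that by (intro hom_finprod[OF ext_map_hom[OF hom(1)] E.comm_group_axioms E.comm_group_axioms]) (auto simp: w3_in)
      also have "\<dots> = finprod E (\<lambda>j. w3 (f (a j)) (f (b j)) (f x)) J"
        using that cl by (intro E.finprod_cong') (auto simp: ext_map_w3[OF hom(1)] w3_in)
      finally show ?thesis .
    qed
    have "finprod E (\<lambda>j. w3 (f (f' (\<alpha> j))) (f (f' (\<beta> j))) (f (f' h))) J =
        ?F (finprod E (\<lambda>j. w3 (f' (\<alpha> j)) (f' (\<beta> j)) (f' h)) J)"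
      using c by (intro Ffin[symmetric]) auto
    also have "\<dots> = ?F (finprod E (\<lambda>j. w3 (\<alpha> j) (\<beta> j) (f' h)) J)"
      using f' h by (simp add: twist_like_def omega_top_def)
    also have "\<dots> = finprod E (\<lambda>j. w3 (f (\<alpha> j)) (f (\<beta> j)) (f (f' h))) J"
      using c by (intro Ffin) auto
    also have "\<dots> = omega_top (f (f' h))"
      using f h cl by (simp add: twist_like_def)
    finally show ?thesis .
  qed
  moreover have "I (\<alpha> j) (f (f' x)) = I (\<alpha> j) x + (\<Sum>e\<in>arcs G. (n e + n' e) * I x (\<beta> e) * I (\<alpha> j) (\<beta> e))"
    if "x \<in> carrier H" "j \<in> J" for x j
    using f f' that cl by (simp add: twist_like_def algebra_simps sum.distrib cong: sum.cong)
  moreover have "f \<circ> f' \<in> hom H H" by (rule hom_compose[OF hom(2,1)])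
  ultimately show ?thesis using f f' cl by (simp add: twist_like_def)
qed

lemma I_\<beta>_\<beta>: "e \<in> arcs G \<Longrightarrow> e' \<in> arcs G \<Longrightarrow> I (\<beta> e) (\<beta> e') = 0"
  using fun_cong[OF cyc_\<beta>, of e e'] by (simp add: cyc_def)

text \<open>
  The change of the symplectic form under a twist along \<open>b\<close> is
  \<open>\<Sum>j. \<langle>\<alpha> j, b\<rangle> b \<and> \<beta> j = b \<and> b = 0\<close>, since \<open>b\<close> belongs to \<open>Y\<close>.
\<close>

lemma twist_like_twist:
  assumes e: "e \<in> arcs G"
  shows "twist_like (twist_action H I (\<beta> e)) (\<lambda>e'. if e' = e then 1 else 0)"
proof -
  let ?b = "\<beta> e" and ?t = "twist_action H I (\<beta> e)"
  have b: "?b \<in> carrier H" using e by (rule \<beta>_closed)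
  have hom: "?t \<in> hom H H"
    by (rule homI) (use b in \<open>simp_all add: twist_action_def I_left H.int_pow_mult H.m_ac\<close>)
  have "finprod E (\<lambda>j. w3 (?t (\<alpha> j)) (?t (\<beta> j)) h) J = omega_top h" if h: "h \<in> carrier H" for h
  proof -
    note c = \<alpha>_closed \<beta>_closed_J h b
    have "w3 (?t (\<alpha> j)) (?t (\<beta> j)) h = w3 (\<alpha> j) (\<beta> j) h \<otimes>\<^bsub>E\<^esub> w3 ?b (\<beta> j [^]\<^bsub>H\<^esub> I (\<alpha> j) ?b) h"
      if j: "j \<in> J" for j
    proof -
      have "w3 (?b [^]\<^bsub>H\<^esub> I (\<alpha> j) ?b) (\<beta> j) h = w3 ?b (\<beta> j) h [^]\<^bsub>E\<^esub> I (\<alpha> j) ?b"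
        using j c by (intro hom_int_pow[OF w3_hom1]) (auto simp: H.is_group E.is_group)
      also have "\<dots> = w3 ?b (\<beta> j [^]\<^bsub>H\<^esub> I (\<alpha> j) ?b) h"
        using j c by (intro hom_int_pow[OF w3_hom2, symmetric]) (auto simp: H.is_group E.is_group)
      finally show ?thesis
        using j c J_arcs e I_\<beta>_\<beta>[of j e] by (simp add: twist_action_def w3_mult subset_eq)
    qed
    then have "finprod E (\<lambda>j. w3 (?t (\<alpha> j)) (?t (\<beta> j)) h) J =
        finprod E (\<lambda>j. w3 (\<alpha> j) (\<beta> j) h \<otimes>\<^bsub>E\<^esub> w3 ?b (\<beta> j [^]\<^bsub>H\<^esub> I (\<alpha> j) ?b) h) J"
      using c by (intro E.finprod_cong') (auto simp: w3_in)
    also have "\<dots> = omega_top h \<otimes>\<^bsub>E\<^esub> finprod E (\<lambda>j. w3 ?b (\<beta> j [^]\<^bsub>H\<^esub> I (\<alpha> j) ?b) h) J"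
      unfolding omega_top_def using c by (intro E.finprod_multf) (auto simp: w3_in)
    also have "finprod E (\<lambda>j. w3 ?b (\<beta> j [^]\<^bsub>H\<^esub> I (\<alpha> j) ?b) h) J = w3 ?b (B_comb (\<lambda>j. I (\<alpha> j) ?b)) h"
      unfolding B_comb_def using c
      by (intro hom_finprod[OF w3_hom2 H_comm E.comm_group_axioms, symmetric]) auto
    also have "B_comb (\<lambda>j. I (\<alpha> j) ?b) = ?b"
    proof (rule Y_eq_B_comb[OF b, symmetric])
      show "I ?b (\<beta> j) = 0" if "j \<in> J" for j using I_\<beta>_\<beta>[OF e, of j] J_arcs that by blast
    qed
    finally show ?thesis
      using c hom_in_carrier[OF omega_top_hom h] by (simp add: w3_alt')
  qed
  moreover have "I (?t x) (\<beta> e') = I x (\<beta> e')" if "x \<in> carrier H" "e' \<in> arcs G" for x e'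
    using that b e \<beta>_closed by (simp add: twist_action_def I_left I_pow_left I_\<beta>_\<beta>)
  moreover have "I (\<alpha> j) (?t x) = I (\<alpha> j) x +
      (\<Sum>e'\<in>arcs G. (if e' = e then 1 else 0) * I x (\<beta> e') * I (\<alpha> j) (\<beta> e'))"
    if "x \<in> carrier H" "j \<in> J" for x j
  proof -
    have "(\<Sum>e'\<in>arcs G. (if e' = e then 1 else 0) * I x (\<beta> e') * I (\<alpha> j) (\<beta> e')) =
        (\<Sum>e'\<in>arcs G. if e' = e then I x ?b * I (\<alpha> j) ?b else 0)"
      by (intro sum.cong) auto
    then show ?thesis
      using that b e finite_arcs \<alpha>_closed by (simp add: twist_action_def I_right I_pow_right)
  qed
  ultimately show ?thesis using hom hom_in_carrier[OF hom] by (simp add: twist_like_def)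
qed

lemma twist_like_pow:
  assumes f: "twist_like f n" shows "twist_like (f ^^ k) (\<lambda>e. int k * n e)"
proof (induction k)
  case 0
  then show ?case using twist_like_id by (simp add: id_def)
next
  case (Suc k)
  then show ?case using twist_like_comp[OF f Suc] by (simp add: algebra_simps comp_def)
qed

lemma twist_like_multitwist:
  assumes "distinct es" "set es \<subseteq> arcs G"
  shows "twist_like (multitwist_action H I \<beta> \<l> es) (\<lambda>e. if e \<in> set es then int (\<l> e) else 0)"
  using assms
proof (induction es)
  case Nil
  then show ?case using twist_like_id by (simp add: multitwist_action_def id_def)
next
  case (Cons e es)
  have "twist_like ((twist_action H I (\<beta> e) ^^ \<l> e) \<circ> multitwist_action H I \<beta> \<l> es)
      (\<lambda>e'. int (\<l> e) * (if e' = e then 1 else 0) + (if e' \<in> set es then int (\<l> e') else 0))"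
    using Cons by (intro twist_like_comp twist_like_pow twist_like_twist) auto
  also have "(\<lambda>e'. int (\<l> e) * (if e' = e then 1 else 0) + (if e' \<in> set es then int (\<l> e') else 0)) =
      (\<lambda>e'. if e' \<in> set (e # es) then int (\<l> e') else 0)"
    using Cons.prems by auto
  finally show ?case by (simp add: multitwist_action_def)
qed

end

locale multitwist = jacobian_comparison G T \<l> H I \<alpha> \<beta> J
  for G T :: "('v, 'e) pre_digraph" and \<l> :: "'e \<Rightarrow> nat" and H :: "'h monoid"
    and I :: "'h \<Rightarrow> 'h \<Rightarrow> int" and \<alpha> \<beta> :: "'e \<Rightarrow> 'h" and J :: "'e set" +
  fixes es :: "'e list" and \<delta> :: "'h \<Rightarrow> 'h"
  assumes es: "distinct es" "set es = arcs G"
    and \<delta>_def: "\<delta> = multitwist_action H I \<beta> \<l> es"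
begin

lemma \<delta>_hom: "\<delta> \<in> hom H H"
  and \<delta>_left: "x \<in> carrier H \<Longrightarrow> e \<in> arcs G \<Longrightarrow> I (\<delta> x) (\<beta> e) = I x (\<beta> e)"
  and \<delta>_right: "x \<in> carrier H \<Longrightarrow> j \<in> J \<Longrightarrow>
    I (\<alpha> j) (\<delta> x) = I (\<alpha> j) x + (\<Sum>e\<in>arcs G. int (\<l> e) * I x (\<beta> e) * I (\<alpha> j) (\<beta> e))"
  and \<delta>_omega: "h \<in> carrier H \<Longrightarrow> finprod E (\<lambda>j. w3 (\<delta> (\<alpha> j)) (\<delta> (\<beta> j)) (\<delta> h)) J = omega_top (\<delta> h)"
  using twist_like_multitwist[OF es(1)] es(2)
  by (simp_all add: \<delta>_def twist_like_def cong: sum.cong)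

lemma \<delta>_closed: "x \<in> carrier H \<Longrightarrow> \<delta> x \<in> carrier H"
  using \<delta>_hom by (rule hom_in_carrier)

lemma \<delta>_Y:
  assumes y: "y \<in> Y" shows "\<delta> y = y"
proof (rule coordinates_eqI)
  have yH: "y \<in> carrier H" using y by (rule Y_closed)
  have "I y (\<beta> e) = 0" if "e \<in> arcs G" for e
    using fun_cong[OF cyc_Y[OF y], of e] that by (simp add: cyc_def)
  then show "I (\<alpha> j) (\<delta> y) = I (\<alpha> j) y" if "j \<in> J" for j
    using yH that by (simp add: \<delta>_right)
  show "I (\<delta> y) (\<beta> j) = I y (\<beta> j)" if "j \<in> J" for j
    using yH that J_arcs by (auto simp: \<delta>_left)
  show "\<delta> y \<in> carrier H" "y \<in> carrier H" using yH \<delta>_closed by auto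
qed

text \<open>
  The nilpotent part of the multitwist: it maps \<open>H\<close> to \<open>Y\<close> and \<open>Y\<close> to zero.
\<close>

definition shear :: "'h \<Rightarrow> 'h" where "shear x = inv\<^bsub>H\<^esub> x \<otimes>\<^bsub>H\<^esub> \<delta> x"

lemma shear_closed: "x \<in> carrier H \<Longrightarrow> shear x \<in> carrier H"
  by (simp add: shear_def \<delta>_closed)

lemma \<delta>_shear: "x \<in> carrier H \<Longrightarrow> \<delta> x = x \<otimes>\<^bsub>H\<^esub> shear x"
  by (simp add: shear_def \<delta>_closed flip: H.m_assoc)

lemma shear_in_Y:
  assumes x: "x \<in> carrier H" shows "shear x \<in> Y"
proof -
  have "I (shear x) (\<beta> j) = 0" if j: "j \<in> J" for j
    using \<delta>_left[OF x, of j] I_left[OF x shear_closed[OF x] \<beta>_closed_J[OF j]] J_arcs j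
    by (auto simp: \<delta>_shear[OF x, symmetric])
  then show ?thesis using in_Y_iff[OF shear_closed[OF x]] by blast
qed

text \<open>
  The point of contact between the two sides: the matrix of the shear is the matrix of the
  length pairing, because both are given by the intersection numbers with the curves.
\<close>

lemma form_shear:
  assumes x: "x \<in> carrier H" shows "form (shear x) = integration G \<l> (cyc x)"
proof (rule forms_dual_eqI[of _ G])
  fix \<omega> :: "'e \<Rightarrow> real" assume \<omega>: "\<omega> \<in> flows G"
  have coef: "I (\<alpha> j) (shear x) = (\<Sum>e\<in>arcs G. int (\<l> e) * I x (\<beta> e) * I (\<alpha> j) (\<beta> e))" if j: "j \<in> J" for j
    using \<delta>_right[OF x j] I_right[OF x shear_closed[OF x] \<alpha>_closed[OF j]] by (simp add: \<delta>_shear[OF x, symmetric])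
  have "form (shear x) \<omega> = (\<Sum>j\<in>J. \<Sum>e\<in>arcs G. real (\<l> e) * real_of_int (I x (\<beta> e)) * (real_of_int (I (\<alpha> j) (\<beta> e)) * \<omega> j))"
    unfolding form_apply[OF \<omega>]
    by (intro sum.cong refl) (simp add: coef sum_distrib_right mult.assoc)
  also have "\<dots> = (\<Sum>e\<in>arcs G. real (\<l> e) * real_of_int (I x (\<beta> e)) * (\<Sum>j\<in>J. real_of_int (I (\<alpha> j) (\<beta> e)) * \<omega> j))"
    by (subst sum.swap) (simp add: sum_distrib_left)
  also have "\<dots> = (\<Sum>e\<in>arcs G. real (\<l> e) * real_of_int (cyc x e) * \<omega> e)"
  proof (intro sum.cong refl)
    fix e assume e: "e \<in> arcs G"
    have "\<omega> e = (\<Sum>j\<in>J. \<omega> j * real_of_int (cyc (\<alpha> j) e))"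
      using fun_cong[OF flow_expansion[OF \<omega>], of e] by simp
    then have "\<omega> e = (\<Sum>j\<in>J. real_of_int (I (\<alpha> j) (\<beta> e)) * \<omega> j)"
      using e by (simp add: cyc_def mult.commute)
    then show "real (\<l> e) * real_of_int (I x (\<beta> e)) * (\<Sum>j\<in>J. real_of_int (I (\<alpha> j) (\<beta> e)) * \<omega> j) =
        real (\<l> e) * real_of_int (cyc x e) * \<omega> e" using e by (simp add: cyc_def)
  qed
  finally show "form (shear x) \<omega> = integration G \<l> (cyc x) \<omega>"
    using \<omega> by (simp add: integration_def)
qed (simp_all add: form_closed integration_in_forms_dual)

section \<open>The kernel of the comparison\<close>

definition span :: "'h set \<Rightarrow> 'h set \<Rightarrow> 'h set \<Rightarrow> ('h list \<Rightarrow>\<^sub>0 int) set set" where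
  "span X1 X2 X3 = generate E {w3 x y z | x y z. x \<in> X1 \<and> y \<in> X2 \<and> z \<in> X3}"

abbreviation "HHY \<equiv> span (carrier H) (carrier H) Y"
abbreviation "HYY \<equiv> span (carrier H) Y Y"
abbreviation "YYY \<equiv> span Y Y Y"

lemma Y_subset: "Y \<subseteq> carrier H"
  using Y_closed by blast

lemma gens_closed:
  assumes "X1 \<subseteq> carrier H" "X2 \<subseteq> carrier H" "X3 \<subseteq> carrier H"
  shows "{w3 x y z | x y z. x \<in> X1 \<and> y \<in> X2 \<and> z \<in> X3} \<subseteq> carrier E"
  using assms by (auto intro!: w3_in)

lemma subgroup_span:
  assumes "X1 \<subseteq> carrier H" "X2 \<subseteq> carrier H" "X3 \<subseteq> carrier H"
  shows "subgroup (span X1 X2 X3) E"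
  unfolding span_def by (rule E.generate_is_subgroup[OF gens_closed[OF assms]])

lemmas subgroup_HHY = subgroup_span[OF subset_refl subset_refl Y_subset]
lemmas subgroup_HYY = subgroup_span[OF subset_refl Y_subset Y_subset]
lemmas subgroup_YYY = subgroup_span[OF Y_subset Y_subset Y_subset]

lemma w3_in_span: "x \<in> X1 \<Longrightarrow> y \<in> X2 \<Longrightarrow> z \<in> X3 \<Longrightarrow> w3 x y z \<in> span X1 X2 X3"
  unfolding span_def by (rule generate.incl) blast

lemma YYY_HYY: "YYY \<subseteq> HYY"
  unfolding span_def by (rule E.mono_generate) (use Y_subset in blast)

definition variation :: "('h list \<Rightarrow>\<^sub>0 int) set \<Rightarrow> ('h list \<Rightarrow>\<^sub>0 int) set" where
  "variation u = exterior_map (int_scale H) 3 H \<delta> u \<otimes>\<^bsub>E\<^esub> inv\<^bsub>E\<^esub> u"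

lemma variation_hom: "variation \<in> hom E E"
proof (rule homI)
  note c = hom_in_carrier[OF ext_map_hom[OF \<delta>_hom]]
  fix x y assume "x \<in> carrier E" "y \<in> carrier E"
  then show "variation (x \<otimes>\<^bsub>E\<^esub> y) = variation x \<otimes>\<^bsub>E\<^esub> variation y"
    using c by (simp add: variation_def hom_mult[OF ext_map_hom[OF \<delta>_hom]] E.inv_mult E.m_ac)
qed (simp add: variation_def hom_in_carrier[OF ext_map_hom[OF \<delta>_hom]])

lemma variation_closed: "u \<in> carrier E \<Longrightarrow> variation u \<in> carrier E"
  using variation_hom by (rule hom_in_carrier)

lemma variation_w3:
  assumes x: "x \<in> carrier H" and y: "y \<in> carrier H" and z: "z \<in> Y"
  shows "variation (w3 x y z) = w3 x (shear y) z \<otimes>\<^bsub>E\<^esub> w3 (shear x) y z \<otimes>\<^bsub>E\<^esub> w3 (shear x) (shear y) z"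
proof -
  have zH: "z \<in> carrier H" using z by (rule Y_closed)
  note c = x y zH shear_closed[OF x] shear_closed[OF y]
  have "exterior_map (int_scale H) 3 H \<delta> (w3 x y z) = w3 (x \<otimes>\<^bsub>H\<^esub> shear x) (y \<otimes>\<^bsub>H\<^esub> shear y) z"
    using c by (simp add: ext_map_w3[OF \<delta>_hom] \<delta>_Y[OF z] \<delta>_shear[OF x] \<delta>_shear[OF y])
  also have "\<dots> = w3 x y z \<otimes>\<^bsub>E\<^esub> (w3 x (shear y) z \<otimes>\<^bsub>E\<^esub> w3 (shear x) y z \<otimes>\<^bsub>E\<^esub> w3 (shear x) (shear y) z)"
    using c by (simp add: w3_mult w3_in E.m_ac)
  finally have eq: "exterior_map (int_scale H) 3 H \<delta> (w3 x y z) =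
    w3 x y z \<otimes>\<^bsub>E\<^esub> (w3 x (shear y) z \<otimes>\<^bsub>E\<^esub> w3 (shear x) y z \<otimes>\<^bsub>E\<^esub> w3 (shear x) (shear y) z)" .
  have "a \<otimes>\<^bsub>E\<^esub> b \<otimes>\<^bsub>E\<^esub> inv\<^bsub>E\<^esub> a = b" if "a \<in> carrier E" "b \<in> carrier E" for a b
    using that by (metis E.inv_closed E.inv_solve_right E.m_closed E.m_comm)
  then show ?thesis unfolding variation_def eq using c by (simp add: w3_in)
qed

lemma variation_HHY: 
  assumes u: "u \<in> HHY" shows "variation u \<in> HYY"
proof (rule hom_generate_into[OF variation_hom E.is_group subgroup_HYY E.is_group])
  show "u \<in> generate E {w3 x y z | x y z. x \<in> carrier H \<and> y \<in> carrier H \<and> z \<in> Y}"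
    using u by (simp add: span_def)
  fix a assume "a \<in> {w3 x y z | x y z. x \<in> carrier H \<and> y \<in> carrier H \<and> z \<in> Y}"
  then obtain x y z where a: "a = w3 x y z" and xyz: "x \<in> carrier H" "y \<in> carrier H" "z \<in> Y" by blast
  have "w3 (shear x) y z = inv\<^bsub>E\<^esub> w3 y (shear x) z"
    using xyz shear_closed Y_closed by (intro w3_skew12) auto
  then show "variation a \<in> HYY"
    unfolding a variation_w3[OF xyz]
    using xyz shear_in_Y shear_closed
    by (auto intro!: subgroup.m_closed[OF subgroup_HYY] subgroup.m_inv_closed[OF subgroup_HYY] w3_in_span)
qed (rule gens_closed[OF subset_refl subset_refl Y_subset])

definition lattice_gen where
  "lattice_gen a a' b = bracket G a (integration G \<l> a') b \<otimes>\<^bsub>JH\<^esub> inv\<^bsub>JH\<^esub> bracket G a' (integration G \<l> a) b"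

lemma monodromy_lattice_eq: "monodromy_lattice G \<l> = generate JH
  {lattice_gen a a' b | a a' b. a \<in> flows G \<and> a' \<in> flows G \<and> b \<in> integral_forms_dual G}"
  by (simp add: monodromy_lattice_def lattice_gen_def)

lemma lattice_gen_closed:
  assumes "a \<in> flows G" "a' \<in> flows G" "b \<in> integral_forms_dual G"
  shows "lattice_gen a a' b \<in> carrier JH"
proof -
  have "b \<in> carrier V" using assms by (simp add: integral_forms_dual_def)
  then show ?thesis unfolding lattice_gen_def using assms integration_in_forms_dual
    by (intro JH.m_closed JH.inv_closed bracket_closed) auto
qed

lemma subgroup_lattice: "subgroup (monodromy_lattice G \<l>) JH"
  unfolding monodromy_lattice_eq by (rule JH.generate_is_subgroup) (auto intro!: lattice_gen_closed)

text \<open>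
  Of the variation only the terms with a single shear survive, one for each order of \<open>x\<close> and \<open>y\<close>, and
  \<open>form_shear\<close> turns the shears into integrations. The sign in the generator of the monodromy lattice
  comes from the cyclic order of the factors in the second term.
\<close>

lemma Psi_variation_w3:
  assumes x: "x \<in> carrier H" and y: "y \<in> carrier H" and z: "z \<in> Y"
  shows "Psi (variation (w3 x y z)) = lattice_gen (cyc x) (cyc y) (form z)"
proof -
  have zH: "z \<in> carrier H" using z by (rule Y_closed)
  note c = x y zH shear_closed[OF x] shear_closed[OF y]
  have "Psi (variation (w3 x y z)) = contraction x (shear y) z \<otimes>\<^bsub>JH\<^esub> contraction (shear x) y z \<otimes>\<^bsub>JH\<^esub> contraction (shear x) (shear y) z"
    unfolding variation_w3[OF assms] using c by (simp add: w3_in Psi_w3)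
  also have "\<dots> = br x (form (shear y)) (form z) \<otimes>\<^bsub>JH\<^esub> br y (form z) (form (shear x))"
    using c z shear_in_Y[OF x] shear_in_Y[OF y]
    by (simp add: contraction_YYY contraction_HYY contraction_HHY[of "shear x"] br_Y form_closed br_closed)
  also have "br y (form z) (form (shear x)) = inv\<^bsub>JH\<^esub> br y (form (shear x)) (form z)"
    using c by (intro br_skew) (auto simp: form_closed)
  finally show ?thesis by (simp add: lattice_gen_def form_shear x y)
qed

lemma Psi_variation_in_lattice:
  assumes u: "u \<in> HHY" shows "Psi (variation u) \<in> monodromy_lattice G \<l>"
proof -
  have "(Psi \<circ> variation) u \<in> monodromy_lattice G \<l>"
  proof (rule hom_generate_into[OF hom_compose[OF variation_hom Psi] E.is_group subgroup_lattice JH.is_group])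
    show "u \<in> generate E {w3 x y z | x y z. x \<in> carrier H \<and> y \<in> carrier H \<and> z \<in> Y}"
      using u by (simp add: span_def)
    fix a assume "a \<in> {w3 x y z | x y z. x \<in> carrier H \<and> y \<in> carrier H \<and> z \<in> Y}"
    then obtain x y z where a: "a = w3 x y z" and xyz: "x \<in> carrier H" "y \<in> carrier H" "z \<in> Y" by blast
    have "lattice_gen (cyc x) (cyc y) (form z) \<in> monodromy_lattice G \<l>"
      unfolding monodromy_lattice_eq
      using xyz cyc_flow form_integral Y_closed by (intro generate.incl) blast
    then show "(Psi \<circ> variation) a \<in> monodromy_lattice G \<l>" by (simp add: a Psi_variation_w3 xyz)
  qed (rule gens_closed[OF subset_refl subset_refl Y_subset])
  then show ?thesis by simp
qed

lemma lattice_lift: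
  assumes l: "l \<in> monodromy_lattice G \<l>"
  obtains u where "u \<in> HHY" "l = Psi (variation u)"
proof -
  interpret PD: group_hom E JH "Psi \<circ> variation"
    using hom_compose[OF variation_hom Psi] by unfold_locales
  have "subgroup ((Psi \<circ> variation) ` HHY) JH"
    by (rule PD.subgroup_img_is_subgroup[OF subgroup_HHY])
  moreover have "{lattice_gen a a' b | a a' b. a \<in> flows G \<and> a' \<in> flows G \<and> b \<in> integral_forms_dual G}
      \<subseteq> (Psi \<circ> variation) ` HHY"
  proof
    fix t assume "t \<in> {lattice_gen a a' b | a a' b. a \<in> flows G \<and> a' \<in> flows G \<and> b \<in> integral_forms_dual G}"
    then obtain a a' b where t: "t = lattice_gen a a' b" and ab: "a \<in> flows G" "a' \<in> flows G"
      and b: "b \<in> integral_forms_dual G" by blast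
    obtain z where z: "z \<in> Y" "form z = b" using form_surj[OF b] .
    have "Psi (variation (w3 (A_comb a) (A_comb a') z)) = t"
      using z ab by (simp add: Psi_variation_w3 comb_closed cyc_surj t)
    moreover have "w3 (A_comb a) (A_comb a') z \<in> HHY" using z comb_closed by (intro w3_in_span)
    ultimately show "t \<in> (Psi \<circ> variation) ` HHY" by force
  qed
  ultimately have "monodromy_lattice G \<l> \<subseteq> (Psi \<circ> variation) ` HHY"
    unfolding monodromy_lattice_eq by (intro JH.generate_subgroup_incl)
  then show thesis using l that by auto
qed

lemma Psi_YYY:
  assumes "s \<in> YYY" shows "Psi s = \<one>\<^bsub>JH\<^esub>"
proof (rule trivial_on_generate[OF Psi E.is_group JH.is_group])
  show "s \<in> generate E {w3 x y z | x y z. x \<in> Y \<and> y \<in> Y \<and> z \<in> Y}" using assms by (simp add: span_def)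
  fix a assume "a \<in> {w3 x y z | x y z. x \<in> Y \<and> y \<in> Y \<and> z \<in> Y}"
  then show "Psi a = \<one>\<^bsub>JH\<^esub>" using Y_closed by (auto simp: Psi_w3 contraction_YYY)
qed (rule gens_closed[OF Y_subset Y_subset Y_subset])

text \<open>
  Modulo \<open>Y \<and> Y \<and> Y\<close>, an element of \<open>H \<and> Y \<and> Y\<close> is a combination of the
  \<open>\<alpha> i \<and> \<beta> j \<and> \<beta> k\<close> with \<open>j\<close> before \<open>k\<close> in some fixed order, and the coefficients of such a
  combination are coordinates of its image.
\<close>

lemma HYY_coordinates:
  assumes x: "x \<in> HYY"
    and 0: "\<And>i j k. i \<in> J \<Longrightarrow> j \<in> J \<Longrightarrow> k \<in> J \<Longrightarrow> j \<noteq> k \<Longrightarrow> coord i j k (Psi x) = 0"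
  shows "x \<in> YYY"
proof -
  obtain f :: "'e \<Rightarrow> nat" where f: "inj_on f J"
    using finite_imp_inj_to_nat_seg[OF finite_J] by blast
  define idx where "idx = {(i, j, k). i \<in> J \<and> j \<in> J \<and> k \<in> J \<and> f j < f k}"
  have fin_idx: "finite idx"
    by (rule finite_subset[of _ "J \<times> J \<times> J"]) (auto simp: idx_def finite_J)
  define t where "t = (\<lambda>(i, j, k). w3 (\<alpha> i) (\<beta> j) (\<beta> k))"
  define ex where "ex m = finprod E (\<lambda>p. t p [^]\<^bsub>E\<^esub> (m p :: int)) idx" for m
  have t_closed: "t p \<in> carrier E" if "p \<in> idx" for p
    using that by (auto simp: t_def idx_def w3_in \<alpha>_closed \<beta>_closed_J)
  have ex_closed: "ex m \<in> carrier E" for m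
    unfolding ex_def using t_closed by (intro E.finprod_closed) auto
  have ex_add: "ex (\<lambda>p. m p + n p) = ex m \<otimes>\<^bsub>E\<^esub> ex n" for m n
  proof -
    have "ex (\<lambda>p. m p + n p) = finprod E (\<lambda>p. t p [^]\<^bsub>E\<^esub> m p \<otimes>\<^bsub>E\<^esub> t p [^]\<^bsub>E\<^esub> n p) idx"
      unfolding ex_def using t_closed by (intro E.finprod_cong') (auto simp: E.int_pow_mult)
    then show ?thesis unfolding ex_def using t_closed by (simp add: E.finprod_multf Pi_iff)
  qed
  have ex_0: "ex (\<lambda>p. 0) = \<one>\<^bsub>E\<^esub>" by (simp add: ex_def)
  have ex_cong: "ex m = ex n" if "\<And>p. p \<in> idx \<Longrightarrow> m p = n p" for m n
    unfolding ex_def using that t_closed by (intro E.finprod_cong') auto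
  have ex_inv: "inv\<^bsub>E\<^esub> ex m = ex (\<lambda>p. - m p)" for m
    using ex_add[of "\<lambda>p. - m p" m] ex_0 ex_closed by (simp add: E.inv_equality)
  have ex_delta: "ex (\<lambda>p. if p = q then 1 else 0) = t q" if q: "q \<in> idx" for q
  proof -
    have "ex (\<lambda>p. if p = q then 1 else 0) = finprod E (\<lambda>p. if q = p then t p else \<one>\<^bsub>E\<^esub>) idx"
      unfolding ex_def using t_closed by (intro E.finprod_cong') auto
    also have "\<dots> = t q" using q fin_idx t_closed by (intro E.finprod_singleton) auto
    finally show ?thesis .
  qed
  define L where "L = {w \<in> carrier E. \<exists>m. \<exists>s\<in>YYY. w = ex m \<otimes>\<^bsub>E\<^esub> s}"
  have sE: "s \<in> carrier E" if "s \<in> YYY" for s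
    using subgroup.mem_carrier[OF subgroup_YYY that] .
  have L: "subgroup L E"
  proof (rule E.subgroupI)
    have "\<one>\<^bsub>E\<^esub> = ex (\<lambda>p. 0) \<otimes>\<^bsub>E\<^esub> \<one>\<^bsub>E\<^esub>" by (simp add: ex_0)
    then show "L \<noteq> {}" using subgroup.one_closed[OF subgroup_YYY] E.one_closed unfolding L_def by blast
    fix a assume "a \<in> L"
    then obtain m s where a: "a = ex m \<otimes>\<^bsub>E\<^esub> s" "s \<in> YYY" by (auto simp: L_def)
    have "inv\<^bsub>E\<^esub> a = ex (\<lambda>p. - m p) \<otimes>\<^bsub>E\<^esub> inv\<^bsub>E\<^esub> s"
      using a sE ex_closed by (simp add: E.inv_mult ex_inv)
    then show "inv\<^bsub>E\<^esub> a \<in> L"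
      using subgroup.m_inv_closed[OF subgroup_YYY a(2)] a sE ex_closed unfolding L_def by fastforce
    fix b assume "b \<in> L"
    then obtain n s' where b: "b = ex n \<otimes>\<^bsub>E\<^esub> s'" "s' \<in> YYY" by (auto simp: L_def)
    have "a \<otimes>\<^bsub>E\<^esub> b = ex (\<lambda>p. m p + n p) \<otimes>\<^bsub>E\<^esub> (s \<otimes>\<^bsub>E\<^esub> s')"
      using a b sE ex_closed by (simp add: ex_add E.m_ac)
    moreover have "s \<otimes>\<^bsub>E\<^esub> s' \<in> YYY" using subgroup.m_closed[OF subgroup_YYY] a b by blast
    ultimately show "a \<otimes>\<^bsub>E\<^esub> b \<in> L"
      using sE ex_closed unfolding L_def by fastforce
  qed (auto simp: L_def)
  have YL: "s \<in> L" if "s \<in> YYY" for s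
    using that sE ex_0 unfolding L_def by (intro CollectI conjI exI[of _ "\<lambda>p. 0"] bexI[of _ s]) auto
  have tL: "t q \<in> L" if "q \<in> idx" for q
    using ex_delta[OF that] t_closed[OF that] subgroup.one_closed[OF subgroup_YYY] unfolding L_def
    by (intro CollectI conjI exI[of _ "\<lambda>p. if p = q then 1 else 0"] bexI[of _ "\<one>\<^bsub>E\<^esub>"]) auto
  have pre: "subgroup {y \<in> carrier H. h y \<in> L} H" if "h \<in> hom H E" for h
    by (rule subgroup_preimage[OF that H.is_group E.is_group L])
  have abb: "w3 (\<alpha> i) (\<beta> j) (\<beta> k) \<in> L" if "i \<in> J" "j \<in> J" "k \<in> J" for i j k
  proof -
    have "f j = f k \<Longrightarrow> j = k" using inj_onD[OF f, of j k] that by simp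
    then consider "f j < f k" | "j = k" | "f k < f j"
      using linorder_less_linear[of "f j" "f k"] by fast
    then show ?thesis
    proof cases
      case 1
      then show ?thesis using tL[of "(i, j, k)"] that by (simp add: idx_def t_def)
    next
      case 2
      then show ?thesis using subgroup.one_closed[OF L] that by (simp add: w3_alt' \<alpha>_closed \<beta>_closed_J)
    next
      case 3
      then have "w3 (\<alpha> i) (\<beta> k) (\<beta> j) \<in> L" using tL[of "(i, k, j)"] that by (simp add: idx_def t_def)
      then show ?thesis
        using subgroup.m_inv_closed[OF L] w3_skew23[of "\<beta> j" "\<beta> k" "\<alpha> i"] that by (simp add: \<alpha>_closed \<beta>_closed_J)
    qed
  qed
  have aby: "w3 (\<alpha> i) (\<beta> j) z \<in> L" if ij: "i \<in> J" "j \<in> J" and z: "z \<in> Y" for i j z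
    using Y_induct[OF pre[OF w3_hom3], of "\<alpha> i" "\<beta> j" z] that abb \<alpha>_closed \<beta>_closed_J by auto
  have ayy: "w3 (\<alpha> i) y z \<in> L" if "i \<in> J" "y \<in> Y" "z \<in> Y" for i y z
    using Y_induct[OF pre[OF w3_hom2], of "\<alpha> i" z y] that aby \<alpha>_closed \<beta>_closed_J Y_closed by auto
  have byy: "w3 (\<beta> i) y z \<in> L" if "i \<in> J" "y \<in> Y" "z \<in> Y" for i y z
    using that \<beta>_in_Y J_arcs by (intro YL w3_in_span) auto
  have hyy: "w3 h y z \<in> L" if "h \<in> carrier H" "y \<in> Y" "z \<in> Y" for h y z
    using H_induct[OF pre[OF w3_hom1], of y z h] that ayy byy \<alpha>_closed \<beta>_closed_J Y_closed by auto
  have "HYY \<subseteq> L"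
    unfolding span_def by (rule E.generate_subgroup_incl[OF _ L]) (use hyy in auto)
  then obtain m s where xm: "x = ex m \<otimes>\<^bsub>E\<^esub> s" and s: "s \<in> YYY" using x by (auto simp: L_def)
  have "m q = 0" if q: "q \<in> idx" for q
  proof -
    obtain i j k where ijk: "q = (i, j, k)" "i \<in> J" "j \<in> J" "k \<in> J" "f j < f k"
      using q by (auto simp: idx_def)
    have hom: "coord i j k \<circ> Psi \<in> hom E real_group"
      by (rule hom_compose[OF Psi coord_hom[OF ijk(3,4)]])
    have "(coord i j k \<circ> Psi) (ex m) = (\<Sum>p\<in>idx. (coord i j k \<circ> Psi) (t p [^]\<^bsub>E\<^esub> m p))"
      unfolding ex_def finprod_real_group[symmetric]
      using t_closed by (intro hom_finprod[OF hom E.comm_group_axioms comm_group_real_group]) auto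
    also have "\<dots> = (\<Sum>p\<in>idx. if p = q then real_of_int (m q) else 0)"
    proof (intro sum.cong refl)
      fix p assume p: "p \<in> idx"
      then obtain i' j' k' where p': "p = (i', j', k')" "i' \<in> J" "j' \<in> J" "k' \<in> J" "f j' < f k'"
        by (auto simp: idx_def)
      have "(coord i j k \<circ> Psi) (t p [^]\<^bsub>E\<^esub> m p) = of_int (m p) * (coord i j k \<circ> Psi) (t p)"
        using hom_int_pow[OF hom t_closed[OF p] E.is_group] comm_group_real_group
        by (simp add: comm_group_def int_pow_real_group)
      also have "(coord i j k \<circ> Psi) (t p) = coord i j k (br (\<alpha> i') (form (\<beta> j')) (form (\<beta> k')))"
        using p' \<beta>_in_Y J_arcs
        by (simp add: t_def Psi_w3 \<alpha>_closed \<beta>_closed_J contraction_HYY subset_eq)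
      also have "\<dots> = (if p = q then 1 else 0)"
      proof -
        have "\<not> (j = k' \<and> k = j')" using ijk(5) p'(5) by auto
        then show ?thesis using p' ijk by (auto simp: coord_br \<alpha>_closed pairing_basis)
      qed
      finally show "(coord i j k \<circ> Psi) (t p [^]\<^bsub>E\<^esub> m p) = (if p = q then real_of_int (m q) else 0)" by simp
    qed
    also have "\<dots> = real_of_int (m q)" using q fin_idx by simp
    finally have "coord i j k (Psi (ex m)) = real_of_int (m q)" by simp
    moreover have "Psi x = Psi (ex m)" using xm s sE ex_closed Psi_YYY by simp
    ultimately show ?thesis using 0[OF ijk(2-4)] ijk(5) by auto
  qed
  then have "ex m = \<one>\<^bsub>E\<^esub>" using ex_cong[of m "\<lambda>p. 0"] ex_0 by simp
  then show ?thesis using xm s sE by simp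
qed

lemma omega_top_HYY: "h \<in> Y \<Longrightarrow> omega_top h \<in> HYY"
  unfolding omega_top_def
  by (rule E.finprod_in_subgroup[OF subgroup_HYY]) (use J_arcs \<beta>_in_Y \<alpha>_closed in \<open>auto intro!: w3_in_span\<close>)

lemma jh21_kernel_eq: "jh21_kernel G \<l> T = omega_jac ` carrier V <#>\<^bsub>JH\<^esub> monodromy_lattice G \<l>"
  by (simp add: jh21_kernel_def omega_wedge_dual_eq)

text \<open>
  Subtracting a variation, the image of \<open>x\<close> becomes \<open>\<omega> \<and> v\<close>, with \<open>v\<close> real, while its coordinates
  are integers because it comes from the integral side. For \<open>p \<noteq> q\<close> the coordinate of
  \<open>\<omega> \<and> v\<close> with indices \<open>p, p, q\<close> is the value of \<open>v\<close> at the cycle of \<open>q\<close>. Hence \<open>v\<close> agrees with the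
  form of an element of \<open>Y\<close> as far as it affects the coordinates.
\<close>

theorem comparison_kernel:
  assumes x: "x \<in> HYY" and K: "Psi x \<in> jh21_kernel G \<l> T"
  obtains h u s where "h \<in> carrier H" "u \<in> HHY" "s \<in> YYY" "x = omega_top h \<otimes>\<^bsub>E\<^esub> (variation u \<otimes>\<^bsub>E\<^esub> s)"
proof -
  from K obtain v l where v: "v \<in> carrier V" and l: "l \<in> monodromy_lattice G \<l>" and xvl: "Psi x = omega_jac v \<otimes>\<^bsub>JH\<^esub> l"
    unfolding jh21_kernel_eq set_mult_def by blast
  obtain u where u: "u \<in> HHY" and lu: "l = Psi (variation u)" using lattice_lift[OF l] .
  have xE: "x \<in> carrier E" using subgroup.mem_carrier[OF subgroup_HYY x] .
  have DuE: "variation u \<in> carrier E" using variation_closed subgroup.mem_carrier[OF subgroup_HHY u] .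
  (* A value of v is known to be an integer if J has a second element. Otherwise this value does not
     occur in any coordinate, and rounding it does no harm. *)
  define h where "h = B_comb (\<lambda>k. \<lfloor>v (real_cyc k)\<rfloor>)"
  have hY: "h \<in> Y" and hH: "h \<in> carrier H" by (simp_all add: h_def B_comb_in_Y comb_closed)
  have oE: "omega_top h \<in> carrier E" using hom_in_carrier[OF omega_top_hom hH] .
  have vJ: "omega_jac v \<in> carrier JH" using hom_in_carrier[OF omega_jac_hom v] .
  have P1: "Psi (x \<otimes>\<^bsub>E\<^esub> inv\<^bsub>E\<^esub> variation u) = omega_jac v"
    using xE DuE vJ by (simp add: xvl lu JH.m_assoc)
  define s where "s = x \<otimes>\<^bsub>E\<^esub> inv\<^bsub>E\<^esub> variation u \<otimes>\<^bsub>E\<^esub> inv\<^bsub>E\<^esub> omega_top h"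
  have "s \<in> YYY"
  proof (rule HYY_coordinates)
    show "s \<in> HYY"
      unfolding s_def using x variation_HHY[OF u] omega_top_HYY[OF hY]
      by (intro subgroup.m_closed[OF subgroup_HYY] subgroup.m_inv_closed[OF subgroup_HYY])
    fix i j k assume ijk: "i \<in> J" "j \<in> J" "k \<in> J" "j \<noteq> k"
    have int: "v (real_cyc q) \<in> \<int>" if "p \<in> J" "q \<in> J" "p \<noteq> q" for p q
    proof -
      have "coord p p q (omega_jac v) \<in> \<int>"
        unfolding P1[symmetric] using that xE DuE by (intro coord_Psi_integral) auto
      then show ?thesis using that v by (simp add: coord_omega)
    qed
    have fl: "form h (real_cyc q) = v (real_cyc q)" if "p \<in> J" "q \<in> J" "p \<noteq> q" for p q
      using int[OF that] that by (auto simp: form_real_cyc h_def pairing_comb elim!: Ints_cases)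
    have "Psi s = omega_jac v \<otimes>\<^bsub>JH\<^esub> inv\<^bsub>JH\<^esub> omega_jac (form h)"
      unfolding s_def using P1 xE DuE oE by (simp add: Psi_omega[OF hH, symmetric])
    then have "coord i j k (Psi s) = coord i j k (omega_jac v) - coord i j k (omega_jac (form h))"
      using ijk vJ hom_in_carrier[OF omega_jac_hom form_closed] by (simp add: coord_mult coord_inv)
    also have "\<dots> = 0"
      using ijk v fl[of j k] fl[of k j] by (simp add: coord_omega form_closed)
    finally show "coord i j k (Psi s) = 0" .
  qed
  moreover have "x = omega_top h \<otimes>\<^bsub>E\<^esub> (variation u \<otimes>\<^bsub>E\<^esub> s)"
  proof -
    have "omega_top h \<otimes>\<^bsub>E\<^esub> (variation u \<otimes>\<^bsub>E\<^esub> s) =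
        x \<otimes>\<^bsub>E\<^esub> (inv\<^bsub>E\<^esub> variation u \<otimes>\<^bsub>E\<^esub> variation u) \<otimes>\<^bsub>E\<^esub> (inv\<^bsub>E\<^esub> omega_top h \<otimes>\<^bsub>E\<^esub> omega_top h)"
      unfolding s_def using xE DuE oE by (simp only: E.m_ac E.m_closed E.inv_closed)
    then show ?thesis using xE DuE oE by simp
  qed
  ultimately show thesis using that hH u by blast
qed

end

section \<open>The embedding\<close>

context multitwist
begin

text \<open>
  The homomorphism is obtained by descending twice, from the third exterior power to its quotient by
  \<open>\<omega> \<and> H\<close> and, after restriction to the image of \<open>H \<and> Y \<and> Y\<close>, to the quotient by the variations
  and \<open>Y \<and> Y \<and> Y\<close>. That both subgroups go to zero was seen above, and \<open>comparison_kernel\<close> is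
  the injectivity.
\<close>

theorem comparison_embedding:
  assumes U: "U = omega_wedge H J \<alpha> \<beta>"
  shows "\<exists>\<Phi>. \<Phi> \<in> hom (B_quot H U Y \<delta>) (jh21 G \<l> T) \<and> inj_on \<Phi> (carrier (B_quot H U Y \<delta>)) \<and>
    (\<forall>\<epsilon>\<^sub>1\<in>J. \<forall>\<epsilon>\<^sub>2\<in>J. \<forall>\<epsilon>\<^sub>3\<in>J.
       \<Phi> (B_kernel H U Y \<delta> #>\<^bsub>ext3_quot H U\<^esub> wedge3_quot H U (\<alpha> \<epsilon>\<^sub>1) (\<beta> \<epsilon>\<^sub>2) (\<beta> \<epsilon>\<^sub>3)) =
       jh21_kernel G \<l> T #>\<^bsub>JH\<^esub>
         bracket G (fundamental_cycle G T \<epsilon>\<^sub>1) (edge_form G \<epsilon>\<^sub>2) (edge_form G \<epsilon>\<^sub>3))"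
proof -
  define c where "c = (\<lambda>x. U #>\<^bsub>E\<^esub> x)"
  define EU where "EU = ext3_quot H U"
  define K where "K = jh21_kernel G \<l> T"
  define JK where "JK = jh21 G \<l> T"
  define k where "k = (\<lambda>x. K #>\<^bsub>JH\<^esub> x)"
  interpret omega_top: group_hom H E omega_top using omega_top_hom by unfold_locales
  interpret omega_jac: group_hom V JH omega_jac using omega_jac_hom by unfold_locales
  have Ueq: "U = omega_top ` carrier H" unfolding U by (rule omega_wedge_eq)
  have subU: "subgroup U E" unfolding Ueq by (rule omega_top.img_is_subgroup)
  have subK: "subgroup K JH"
    unfolding K_def jh21_kernel_eq
    by (rule JH.mult_subgroups[OF omega_jac.img_is_subgroup subgroup_lattice])
  have EUeq: "EU = E Mod U" by (simp add: EU_def ext3_quot_def)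
  have JKeq: "JK = JH Mod K" by (simp add: JK_def jh21_def K_def)
  interpret EU: comm_group EU unfolding EUeq by (rule E.abelian_FactGroup[OF subU])
  interpret JK: comm_group JK unfolding JKeq by (rule JH.abelian_FactGroup[OF subK])
  have c: "c \<in> hom E EU" unfolding c_def EUeq by (rule r_coset_hom[OF E.comm_group_axioms subU])
  have k: "k \<in> hom JH JK" unfolding k_def JKeq by (rule r_coset_hom[OF JH.comm_group_axioms subK])
  interpret c: group_hom E EU c using c by unfold_locales
  interpret k: group_hom JH JK k using k by unfold_locales
  have c_one: "c x = \<one>\<^bsub>EU\<^esub> \<longleftrightarrow> x \<in> U" if "x \<in> carrier E" for x
    unfolding c_def EUeq by (rule r_coset_eq_one_iff[OF E.comm_group_axioms subU that])
  have k_one: "k x = \<one>\<^bsub>JK\<^esub> \<longleftrightarrow> x \<in> K" if "x \<in> carrier JH" for x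
    unfolding k_def JKeq by (rule r_coset_eq_one_iff[OF JH.comm_group_axioms subK that])
  let ?D = "exterior_map (int_scale H) 3 H \<delta>"
  note D_closed = hom_in_carrier[OF ext_map_hom[OF \<delta>_hom]]
  have D_omega: "?D (omega_top h) = omega_top (\<delta> h)" if h: "h \<in> carrier H" for h
  proof -
    have "?D (omega_top h) = finprod E (\<lambda>j. ?D (w3 (\<alpha> j) (\<beta> j) h)) J"
      unfolding omega_top_def using h \<alpha>_closed \<beta>_closed_J
      by (intro hom_finprod[OF ext_map_hom[OF \<delta>_hom] E.comm_group_axioms E.comm_group_axioms]) (auto simp: w3_in)
    also have "\<dots> = finprod E (\<lambda>j. w3 (\<delta> (\<alpha> j)) (\<delta> (\<beta> j)) (\<delta> h)) J"
      using h \<alpha>_closed \<beta>_closed_J \<delta>_closed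
      by (intro E.finprod_cong') (auto simp: ext_map_w3[OF \<delta>_hom] w3_in)
    finally show ?thesis using \<delta>_omega[OF h] by simp
  qed
  have D_quot: "ext3_quot_map H U \<delta> (c x) = c (?D x)" if "x \<in> carrier E" for x
    unfolding ext3_quot_map_def c_def
    by (rule quot_map_coset[OF E.comm_group_axioms subU ext_map_hom[OF \<delta>_hom] _ that])
      (use D_omega \<delta>_closed in \<open>auto simp: Ueq\<close>)
  have span_quot: "wedge3_span H U X1 X2 X3 = c ` span X1 X2 X3" for X1 X2 X3
    by (simp add: wedge3_span_def span_def c_def)
  define M where "M = variation ` HHY <#>\<^bsub>E\<^esub> YYY"
  interpret variation: group_hom E E variation using variation_hom by unfold_locales
  have HHY_E: "u \<in> carrier E" if "u \<in> HHY" for u using subgroup.mem_carrier[OF subgroup_HHY that] .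
  have HYY_E: "u \<in> carrier E" if "u \<in> HYY" for u using subgroup.mem_carrier[OF subgroup_HYY that] .
  have YYY_E: "u \<in> carrier E" if "u \<in> YYY" for u using subgroup.mem_carrier[OF subgroup_YYY that] .
  have subM: "subgroup M E"
    unfolding M_def
    by (rule E.mult_subgroups[OF variation.subgroup_img_is_subgroup[OF subgroup_HHY] subgroup_YYY])
  have M_HYY: "M \<subseteq> HYY"
    unfolding M_def set_mult_def
    using variation_HHY YYY_HYY by (auto intro!: subgroup.m_closed[OF subgroup_HYY])
  define Bk where "Bk = B_kernel H U Y \<delta>"
  have Bk: "Bk = c ` M"
  proof -
    have quot: "ext3_quot_map H U \<delta> (c u) \<otimes>\<^bsub>EU\<^esub> inv\<^bsub>EU\<^esub> c u = c (variation u)" if "u \<in> HHY" for u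
      using HHY_E[OF that] D_closed by (simp add: D_quot variation_def)
    have "{ext3_quot_map H U \<delta> x \<otimes>\<^bsub>EU\<^esub> inv\<^bsub>EU\<^esub> x | x. x \<in> c ` HHY} = c ` (variation ` HHY)"
      using quot by (auto simp: image_iff)
    then have "Bk = c ` (variation ` HHY) <#>\<^bsub>EU\<^esub> c ` YYY"
      by (simp add: Bk_def B_kernel_def span_quot EU_def)
    also have "\<dots> = c ` M"
    proof -
      have "c (variation u) \<otimes>\<^bsub>EU\<^esub> c s = c (variation u \<otimes>\<^bsub>E\<^esub> s)" if "u \<in> HHY" "s \<in> YYY" for u s
        using that HHY_E YYY_E by simp
      then show ?thesis unfolding M_def set_mult_def by (simp add: image_UN)
    qed
    finally show ?thesis .
  qed
  define W where "W = c ` HYY"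
  have subW: "subgroup W EU" unfolding W_def by (rule c.subgroup_img_is_subgroup[OF subgroup_HYY])
  have subBk: "subgroup Bk EU" unfolding Bk by (rule c.subgroup_img_is_subgroup[OF subM])
  have Bk_W: "Bk \<subseteq> W" unfolding Bk W_def using M_HYY by blast
  define EW where "EW = EU\<lparr>carrier := W\<rparr>"
  have comm_EW: "comm_group EW"
    unfolding EW_def
  proof (rule group.group_comm_groupI[OF EU.subgroup_imp_group[OF subW]])
    fix x y assume "x \<in> carrier (EU\<lparr>carrier := W\<rparr>)" "y \<in> carrier (EU\<lparr>carrier := W\<rparr>)"
    then have "x \<in> carrier EU" "y \<in> carrier EU" using subgroup.mem_carrier[OF subW] by auto
    then show "x \<otimes>\<^bsub>EU\<lparr>carrier := W\<rparr>\<^esub> y = y \<otimes>\<^bsub>EU\<lparr>carrier := W\<rparr>\<^esub> x"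
      using EU.m_comm by simp
  qed
  interpret EW: comm_group EW by (rule comm_EW)
  have subBkW: "subgroup Bk EW" unfolding EW_def by (rule EU.subgroup_incl[OF subBk subW Bk_W])
  have Beq: "B_quot H U Y \<delta> = EW Mod Bk"
    by (simp add: B_quot_def EW_def EU_def Bk_def W_def span_quot)
  have coset: "Bk #>\<^bsub>EW\<^esub> x = Bk #>\<^bsub>EU\<^esub> x" for x by (simp add: r_coset_def EW_def)
  have kPsi: "k \<circ> Psi \<in> hom E JK" by (rule hom_compose[OF Psi k])
  have omega_K: "omega_jac v \<in> K" if "v \<in> carrier V" for v
  proof -
    have "omega_jac v = omega_jac v \<otimes>\<^bsub>JH\<^esub> \<one>\<^bsub>JH\<^esub>" using that by simp
    then show ?thesis
      unfolding K_def jh21_kernel_eq set_mult_def using that subgroup.one_closed[OF subgroup_lattice] by blast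
  qed
  have lat_K: "l \<in> K" if "l \<in> monodromy_lattice G \<l>" for l
  proof -
    have "l = omega_jac \<one>\<^bsub>V\<^esub> \<otimes>\<^bsub>JH\<^esub> l" using subgroup.mem_carrier[OF subgroup_lattice that] by simp
    then show ?thesis
      unfolding K_def jh21_kernel_eq set_mult_def using that V.one_closed by blast
  qed
  obtain g where g: "g \<in> hom EU JK" and gc: "\<And>x. x \<in> carrier E \<Longrightarrow> g (c x) = k (Psi x)"
  proof (rule quotient_lift[OF E.comm_group_axioms subU JK.is_group kPsi])
    fix n assume "n \<in> U"
    then obtain h where h: "h \<in> carrier H" "n = omega_top h" by (auto simp: Ueq)
    then show "(k \<circ> Psi) n = \<one>\<^bsub>JK\<^esub>"
      using omega_K[OF form_closed] by (simp add: Psi_omega k_one form_closed)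
  next
    fix g assume "g \<in> hom (E Mod U) JK" "\<And>x. x \<in> carrier E \<Longrightarrow> g (U #>\<^bsub>E\<^esub> x) = (k \<circ> Psi) x"
    then show thesis using that[of g] by (simp add: EUeq c_def)
  qed
  have gW: "g \<in> hom EW JK"
    using g subgroup.mem_carrier[OF subW] by (auto simp: hom_def EW_def Pi_iff)
  obtain \<Phi> where \<Phi>: "\<Phi> \<in> hom (EW Mod Bk) JK" and \<Phi>c: "\<And>x. x \<in> HYY \<Longrightarrow> \<Phi> (Bk #>\<^bsub>EU\<^esub> c x) = k (Psi x)"
  proof (rule quotient_lift[OF comm_EW subBkW JK.is_group gW])
    fix n assume "n \<in> Bk"
    then obtain u s where us: "u \<in> HHY" "s \<in> YYY" "n = c (variation u \<otimes>\<^bsub>E\<^esub> s)"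
      unfolding Bk M_def set_mult_def by blast
    have "Psi (variation u \<otimes>\<^bsub>E\<^esub> s) = Psi (variation u)"
      using us HHY_E YYY_E by (simp add: Psi_YYY)
    moreover have "variation u \<otimes>\<^bsub>E\<^esub> s \<in> carrier E" using us HHY_E YYY_E by simp
    ultimately have "g n = k (Psi (variation u))" unfolding us(3) by (simp only: gc)
    then show "g n = \<one>\<^bsub>JK\<^esub>"
      using us HHY_E lat_K[OF Psi_variation_in_lattice[OF us(1)]] by (simp add: k_one)
  next
    fix \<Phi> assume \<Phi>: "\<Phi> \<in> hom (EW Mod Bk) JK" and *: "\<And>x. x \<in> carrier EW \<Longrightarrow> \<Phi> (Bk #>\<^bsub>EW\<^esub> x) = g x"
    have "\<Phi> (Bk #>\<^bsub>EU\<^esub> c x) = k (Psi x)" if "x \<in> HYY" for x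
      using *[of "c x"] that HYY_E gc by (simp add: coset EW_def W_def)
    with \<Phi> show thesis by (rule that)
  qed
  interpret \<Phi>: group_hom "EW Mod Bk" JK \<Phi>
    using \<Phi> EW.abelian_FactGroup[OF subBkW] JK.is_group
    by (simp add: group_hom_def group_hom_axioms_def comm_group_def)
  have "inj_on \<Phi> (carrier (EW Mod Bk))"
  proof (rule \<Phi>.trivial_ker_imp_inj)
    have "A = \<one>\<^bsub>EW Mod Bk\<^esub>" if A: "A \<in> carrier (EW Mod Bk)" "\<Phi> A = \<one>\<^bsub>JK\<^esub>" for A
    proof -
      obtain x where x: "x \<in> HYY" "A = Bk #>\<^bsub>EW\<^esub> c x"
        using A(1) by (auto simp: carrier_FactGroup EW_def W_def)
      then have "k (Psi x) = \<one>\<^bsub>JK\<^esub>" using A(2) \<Phi>c by (simp add: coset)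
      then have "Psi x \<in> jh21_kernel G \<l> T" using k_one x HYY_E by (simp add: K_def)
      from comparison_kernel[OF x(1) this] obtain h u s where
        hus: "h \<in> carrier H" "u \<in> HHY" "s \<in> YYY" "x = omega_top h \<otimes>\<^bsub>E\<^esub> (variation u \<otimes>\<^bsub>E\<^esub> s)" by blast
      have DsE: "variation u \<otimes>\<^bsub>E\<^esub> s \<in> carrier E" using hus HHY_E YYY_E by simp
      have "c (omega_top h) = \<one>\<^bsub>EU\<^esub>" using c_one hus(1) by (simp add: Ueq)
      then have "c x = c (variation u \<otimes>\<^bsub>E\<^esub> s)"
        unfolding hus(4) using c.hom_mult[OF omega_top.hom_closed[OF hus(1)] DsE] c.hom_closed[OF DsE] by simp
      moreover have "variation u \<otimes>\<^bsub>E\<^esub> s \<in> M" unfolding M_def set_mult_def using hus by blast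
      ultimately have "c x \<in> Bk" unfolding Bk by blast
      then show ?thesis
        unfolding x(2) using r_coset_eq_one_iff[OF comm_EW subBkW] x(1) by (simp add: EW_def W_def)
    qed
    then show "kernel (EW Mod Bk) JK \<Phi> = {\<one>\<^bsub>EW Mod Bk\<^esub>}"
      unfolding kernel_def using \<Phi>.hom_one \<Phi>.G.one_closed by blast
  qed
  moreover have "\<Phi> (B_kernel H U Y \<delta> #>\<^bsub>ext3_quot H U\<^esub> wedge3_quot H U (\<alpha> \<epsilon>\<^sub>1) (\<beta> \<epsilon>\<^sub>2) (\<beta> \<epsilon>\<^sub>3)) =
       jh21_kernel G \<l> T #>\<^bsub>JH\<^esub>
         bracket G (fundamental_cycle G T \<epsilon>\<^sub>1) (edge_form G \<epsilon>\<^sub>2) (edge_form G \<epsilon>\<^sub>3)"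
    if "\<epsilon>\<^sub>1 \<in> J" "\<epsilon>\<^sub>2 \<in> J" "\<epsilon>\<^sub>3 \<in> J" for \<epsilon>\<^sub>1 \<epsilon>\<^sub>2 \<epsilon>\<^sub>3
  proof -
    have e: "\<epsilon>\<^sub>2 \<in> arcs G" "\<epsilon>\<^sub>3 \<in> arcs G" using that J_arcs by auto
    have "w3 (\<alpha> \<epsilon>\<^sub>1) (\<beta> \<epsilon>\<^sub>2) (\<beta> \<epsilon>\<^sub>3) \<in> HYY"
      using that e by (intro w3_in_span) (auto simp: \<alpha>_closed \<beta>_in_Y)
    from \<Phi>c[OF this] show ?thesis
      using that e
      by (simp add: Bk_def EU_def wedge3_quot_def c_def k_def K_def Psi_w3 \<alpha>_closed \<beta>_closed
          contraction_HYY \<beta>_in_Y form_\<beta> fundamental_cycle_eq)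
  qed
  ultimately show ?thesis
    using \<Phi> unfolding Beq JK_def by blast
qed

end

theorem propositionA2:
  fixes G T :: "('v, 'e) pre_digraph" and \<l> :: "'e \<Rightarrow> nat" and g :: nat
    and S :: "'p topology" and \<mu> :: "'p chain set" and \<gamma> :: "'e \<Rightarrow> complex \<Rightarrow> 'p"
    and I :: "'p chain set \<Rightarrow> 'p chain set \<Rightarrow> int"
    and \<alpha> \<beta> :: "'e \<Rightarrow> 'p chain set" and es :: "'e list"
    and H :: "'p chain set monoid" and Fc :: "'e set"
    and U :: "('p chain set list \<Rightarrow>\<^sub>0 int) set set" and Y :: "'p chain set set"
    and \<delta> :: "'p chain set \<Rightarrow> 'p chain set"
  assumes "fin_digraph G" and "Digraph_Component.connected G"
    and "\<forall>e\<in>arcs G. \<l> e > 0"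
    and "(cycle_group G :: ('e \<Rightarrow> int) monoid) \<cong> free_Abelian_group {..<g}" and "g \<ge> 3"
    and "undirected_spanning_tree T G"
    and "closed_oriented_surface S \<mu> g"
    and "curve_system S \<mu> G \<gamma>"
    and "intersection_pairing S \<mu> I"
    and "H = homology_group 1 S"
    and "\<forall>e. \<beta> e = loop_class S (\<gamma> e)"
    and "Fc = arcs G - arcs T"
    and "symplectic_basis H I Fc \<alpha> \<beta>"
    and "distinct es" and "set es = arcs G"
    and "\<delta> = multitwist_action H I \<beta> \<l> es"
    and "Y = generate H (\<beta> ` arcs G)"
    and "U = omega_wedge H Fc \<alpha> \<beta>"
  shows "\<exists>\<Phi>. \<Phi> \<in> hom (B_quot H U Y \<delta>) (jh21 G \<l> T) \<and> inj_on \<Phi> (carrier (B_quot H U Y \<delta>)) \<and>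
    (\<forall>\<epsilon>\<^sub>1\<in>Fc. \<forall>\<epsilon>\<^sub>2\<in>Fc. \<forall>\<epsilon>\<^sub>3\<in>Fc.
       \<Phi> (B_kernel H U Y \<delta> #>\<^bsub>ext3_quot H U\<^esub> wedge3_quot H U (\<alpha> \<epsilon>\<^sub>1) (\<beta> \<epsilon>\<^sub>2) (\<beta> \<epsilon>\<^sub>3)) =
       jh21_kernel G \<l> T #>\<^bsub>jac_homology21 G\<^esub>
         bracket G (fundamental_cycle G T \<epsilon>\<^sub>1) (edge_form G \<epsilon>\<^sub>2) (edge_form G \<epsilon>\<^sub>3))"
proof -
  note \<beta> = assms(11)
  have S: "compact_space S" "Hausdorff_space S"
    using assms(7) by (auto simp: closed_oriented_surface_def)
  have pair: "I (x \<otimes>\<^bsub>H\<^esub> y) z = I x z + I y z" "I z (x \<otimes>\<^bsub>H\<^esub> y) = I z x + I z y" "I x x = 0"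
    if "x \<in> carrier H" "y \<in> carrier H" "z \<in> carrier H" for x y z
    using assms(9) that unfolding intersection_pairing_def assms(10) by blast+
  have "multitwist G T \<l> H I \<alpha> \<beta> Fc es \<delta>"
  proof (intro multitwist.intro jacobian_comparison.intro multitwist_axioms.intro)
    show "comm_group H" unfolding assms(10) by (rule abelian_homology_group)
    show "\<beta> e \<in> carrier H" if "e \<in> arcs G" for e
      using assms(8) that loop_class_in_homology \<beta> unfolding curve_system_def assms(10) by metis
    show "(\<lambda>e. if e \<in> arcs G then I x (\<beta> e) else 0) \<in> flows G" if "x \<in> carrier H" for x
    proof -
      have "(\<Sum>e | e \<in> arcs G \<and> tail G e = v. if e \<in> arcs G then I x (\<beta> e) else 0) =
          (\<Sum>e | e \<in> arcs G \<and> head G e = v. if e \<in> arcs G then I x (\<beta> e) else 0)" if v: "v \<in> verts G" for v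
        using intersection_numbers_flow[OF assms(1) S assms(8,9) _ v, of x] \<open>x \<in> carrier H\<close> \<beta>
        by (simp add: assms(10))
      then show ?thesis by (simp add: flows_def)
    qed
  qed (use assms pair in auto)
  then interpret multitwist G T \<l> H I \<alpha> \<beta> Fc es \<delta> .
  have "local.Y = Y" using assms(17) by (simp add: local.Y_def)
  then show ?thesis using comparison_embedding[OF assms(18)] by simp
qed

end
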